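(* $p(4,4)=5$. In particular, every quaternary quartic form in $\mathbb{R}[x_1,x_2,x_3,x_4]$ that is a sum of squares of forms is a sum of five squares of (quadratic) forms.
   Context: For $n\ge1$, $e\ge0$ let $\mathbb{R}[\mathtt{x}]_e$ denote the space of forms of degree $e$ in $\mathbb{R}[x_1,\dots,x_n]$. Let $\Sigma_{n,2d}\subseteq\mathbb{R}[\mathtt{x}]_{2d}$ be the set of forms of degree $2d$ that are finite sums of squares of forms in $\mathbb{R}[\mathtt{x}]_d$. For $f\in\Sigma_{n,2d}$ the sos length $\ell(f)$ is the smallest $r\ge0$ such that $f=p_1^2+\cdots+p_r^2$ for some $p_1,\dots,p_r\in\mathbb{R}[\mathtt{x}]_d$. The Pythagoras number is $p(n,2d)=\sup\{\ell(f)\colon f\in\Sigma_{n,2d}\}$. *)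

theory Defs
  imports Complex_Main "HOL-Library.Poly_Mapping" "HOL-Library.Extended_Nat"
begin

text \<open>
  Real polynomials are finitely supported maps from monomials to coefficients, and monomials are
  finitely supported maps from variable indices to exponents; the product is the convolution
  product of \<^theory>\<open>HOL-Library.Poly_Mapping\<close>. The variables
  $x_1, \ldots, x_n$ are those with indices $0, \ldots, n-1$.
\<close>
type_synonym rpoly = "(nat \<Rightarrow>\<^sub>0 nat) \<Rightarrow>\<^sub>0 real"

text \<open>As usual, the zero polynomial is a form of every degree.\<close>
definition forms :: "nat \<Rightarrow> nat \<Rightarrow> rpoly set" where
  "forms n e =
     {f. \<forall>m \<in> Poly_Mapping.keys f.
           Poly_Mapping.keys m \<subseteq> {..<n} \<and> (\<Sum>i<n. Poly_Mapping.lookup m i) = e}"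

definition is_sum_of_squares :: "nat \<Rightarrow> nat \<Rightarrow> nat \<Rightarrow> rpoly \<Rightarrow> bool" where
  "is_sum_of_squares n d r f \<longleftrightarrow>
     (\<exists>p :: nat \<Rightarrow> rpoly. (\<forall>i<r. p i \<in> forms n d) \<and> f = (\<Sum>i<r. (p i)\<^sup>2))"

text \<open>
  In the next three definitions the argument \<open>d\<close> is half the degree of the forms
  considered: they render $\Sigma_{n,2d}$, the sos length on it, and $p(n,2d)$.
\<close>
definition sos_forms :: "nat \<Rightarrow> nat \<Rightarrow> rpoly set" where
  "sos_forms n d = {f \<in> forms n (2 * d). \<exists>r. is_sum_of_squares n d r f}"

text \<open>Only meaningful for \<open>f \<in> sos_forms n d\<close>.\<close>
definition sos_length :: "nat \<Rightarrow> nat \<Rightarrow> rpoly \<Rightarrow> nat" where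
  "sos_length n d f = (LEAST r. is_sum_of_squares n d r f)"

text \<open>
  The supremum is taken in \<^typ>\<open>enat\<close>, so that a finite value carries the
  assertion that the lengths are bounded.
\<close>
definition pythagoras_number :: "nat \<Rightarrow> nat \<Rightarrow> enat" where
  "pythagoras_number n d = (SUP f \<in> sos_forms n d. enat (sos_length n d f))"

end

theory Submission
  imports Defs "HOL-Analysis.Analysis"
begin

text \<open>
  Let \<open>K\<close> be the closed cone of sums of five squares in the space of quartic forms and suppose that the
  cone \<open>\<Sigma>\<close> of all sums of squares is larger. Forms with a nonreal singular point have codimension two,
  so some segment leads from a point of \<open>int \<Sigma> - K\<close> to an interior point of \<open>K\<close> without meeting such
  forms. Where it enters \<open>K\<close> there is a form in \<open>int \<Sigma>\<close> without any complex singular point. Near it lies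
  a form outside \<open>K\<close>; let \<open>f = \<Sum> p\<^sub>i\<^sup>2\<close> be the point of \<open>K\<close> closest to that form. The normal vector at \<open>f\<close> is a
  functional \<open>L\<close> that kills all products of some \<open>p\<^sub>i\<close> with a quadric. If the \<open>p\<^sub>i\<close> are dependent, \<open>L\<close> is
  nonnegative on \<open>\<Sigma>\<close>, which is impossible as \<open>L f = 0\<close>. If they are independent, they have a common complex
  zero, because four quadrics without common zero generate an ideal with one-dimensional
  socle in degree four and a perfect pairing of quadrics; then \<open>f\<close> is singular there, again a contradiction.

  That the determinant generating the socle does not lie in the ideal is seen analytically,
  by an integration by parts that stands in for the global residue. For the lower bound, a sum of
  five squares of monomials with a unique Gram matrix is used.
\<close>

section \<open>Systems of quadratic forms without common zero\<close>

text \<open>A nonreal point of projective space has six real parameters, against eight real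
  conditions for a vanishing gradient: this is the codimension two. A real point has three
  parameters against four conditions, so a segment cannot be expected to avoid real singular points;
  they are excluded because forms in the interior of the cone are positive at real points.

  The number five is four plus one. Four quadrics in four variables without common zero form a
  complete intersection with socle in degree 4 (2 - 1) = 4, exactly the degree of the forms. A
  nonzero functional that kills their ideal in degree four is then the socle functional, and a fifth
  quadric whose products it also kills must lie in the ideal, that is, in the span of the four.

  \<open>K\<close> is not known to be convex, so a boundary point need not have a supporting
  hyperplane. A closest point always has a normal vector, and since absence of singular points is an
  open condition, a closest point near the entry point inherits it.\<close>

definition bform :: "'a::comm_ring_1^'n^'n \<Rightarrow> 'a^'n \<Rightarrow> 'a^'n \<Rightarrow> 'a" where
  "bform P x y = (\<Sum>i\<in>UNIV. x $ i * (P *v y) $ i)"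

definition qform :: "'a::comm_ring_1^'n^'n \<Rightarrow> 'a^'n \<Rightarrow> 'a" where
  "qform P x = bform P x x"

lemma bform_add_left: "bform P (x + x') y = bform P x y + bform P x' y"
  by (simp add: bform_def distrib_right sum.distrib)

lemma bform_add_right: "bform P x (y + y') = bform P x y + bform P x y'"
  by (simp add: bform_def matrix_vector_right_distrib distrib_left sum.distrib)

lemma bform_smult_left: "bform P (c *s x) y = c * bform P x y"
  by (simp add: bform_def sum_distrib_left mult.assoc)

lemma bform_sum_def: "bform P x y = (\<Sum>i\<in>UNIV. \<Sum>j\<in>UNIV. P $ i $ j * x $ i * y $ j)"
  by (simp add: bform_def matrix_vector_mult_def sum_distrib_left mult_ac)

lemma bform_smult_right: "bform P x (c *s y) = c * bform P x y"
  by (simp add: bform_sum_def sum_distrib_left mult_ac)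

lemma bform_commute: "transpose P = P \<Longrightarrow> bform P x y = bform P y x"
  unfolding bform_sum_def
  by (subst sum.swap) (simp add: transpose_def vec_eq_iff mult_ac)

lemma qform_add: "transpose P = P \<Longrightarrow> qform P (x + y) = qform P x + 2 * bform P x y + qform P y"
  by (simp add: qform_def bform_add_left bform_add_right bform_commute[of P y x])

lemma qform_smult: "qform P (c *s x) = c^2 * qform P x"
  by (simp add: qform_def bform_smult_left bform_smult_right power2_eq_square mult.assoc)

lemma qform_0 [simp]: "qform P 0 = 0"
  by (simp add: qform_def bform_def)

text \<open>For symmetric \<open>P i\<close> this is half the Jacobian matrix of the system at
  \<open>z\<close>, because the gradient of the form of \<open>P i\<close> is
  \<open>2 P i z\<close>.\<close>

definition Nmat :: "('n \<Rightarrow> 'a::comm_ring_1^'n^'n) \<Rightarrow> 'a^'n \<Rightarrow> 'a^'n^'n" where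
  "Nmat P z = (\<chi> i. P i *v z)"

lemma Nmat_mult_nth: "transpose (P i) = P i \<Longrightarrow> (Nmat P z *v v) $ i = bform (P i) z v"
proof -
  assume s: "transpose (P i) = P i"
  have "(Nmat P z *v v) $ i = bform (P i) v z"
    by (simp add: Nmat_def matrix_vector_mult_def bform_def mult.commute)
  then show ?thesis using bform_commute[OF s] by metis
qed

lemma continuous_qform [continuous_intros]:
  fixes P :: "complex^'n^'n"
  shows "continuous_on S f \<Longrightarrow> continuous_on S (\<lambda>x. qform P (f x))"
  unfolding qform_def bform_sum_def by (intro continuous_intros)

lemma norm_smult_complex: "norm (c *s (x::complex^'n)) = cmod c * norm x"
  by (simp add: norm_vec_def L2_set_def norm_mult power_mult_distrib
      flip: sum_distrib_left) (simp add: real_sqrt_mult)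

lemma smult_of_real: "of_real r *s (x::complex^'n) = r *\<^sub>R x"
  by (subst vec_eq_iff) (auto simp: complex_eq_iff)

text \<open>The sum has a positive minimum on the compact unit sphere, and it is homogeneous of
  degree four. The bound makes the system proper, which yields global minimisers and compactly
  supported cutoffs below.\<close>

lemma system_growth:
  fixes P :: "'i::finite \<Rightarrow> complex^'n^'n"
  assumes bpf: "\<And>z. (\<forall>i. qform (P i) z = 0) \<Longrightarrow> z = 0"
  obtains c where "c > 0" "\<And>z. c * norm z ^ 4 \<le> (\<Sum>i\<in>UNIV. (cmod (qform (P i) z))\<^sup>2)"
proof -
  define F where "F z = (\<Sum>i\<in>UNIV. (cmod (qform (P i) z))\<^sup>2)" for z
  have cF: "continuous_on S F" for S unfolding F_def by (intro continuous_intros)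
  have ne: "sphere (0::complex^'n) 1 \<noteq> {}" by simp
  obtain z0 where z0: "z0 \<in> sphere 0 1" "\<And>z. z \<in> sphere 0 1 \<Longrightarrow> F z0 \<le> F z"
    using continuous_attains_inf[OF compact_sphere ne cF] by blast
  have pos: "F z0 > 0"
  proof (rule ccontr)
    assume "\<not> F z0 > 0"
    then have "F z0 = 0" by (smt (verit) F_def sum_nonneg zero_le_power2)
    then have "\<forall>i. qform (P i) z0 = 0" by (simp add: F_def sum_nonneg_eq_0_iff)
    then show False using bpf z0(1) by force
  qed
  have "F z0 * norm z ^ 4 \<le> F z" for z
  proof (cases "z = 0")
    case False
    define w where "w = (1 / norm z) *\<^sub>R z"
    have w: "w \<in> sphere 0 1" using False by (simp add: w_def)
    have z: "z = of_real (norm z) *s w" using False by (simp add: w_def smult_of_real)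
    have "F z = norm z ^ 4 * F w"
      apply (subst z)
      by (simp add: F_def qform_smult norm_mult norm_power power_mult_distrib sum_distrib_left flip: power_mult)
    then show ?thesis using z0(2)[OF w] by (simp add: mult.commute mult_right_mono)
  qed (simp add: F_def)
  then show ?thesis using pos that unfolding F_def by blast
qed

text \<open>
  Let \<open>z\<close> minimise \<open>|u|\<^sup>2 - |z|\<^sup>2\<close>, where \<open>u\<close> is the vector of the forms. If \<open>v\<close> lies in the kernel
  of the Jacobian at \<open>z\<close>, then \<open>u (z + t v) = u z + t\<^sup>2 u v\<close>, and adding up the values at
  \<open>t = r, i r, -r, -i r\<close> contradicts minimality for small \<open>r\<close>.
\<close>

lemma jacobian_nonzero_somewhere:
  fixes P :: "'n::finite \<Rightarrow> complex^'n^'n"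
  assumes sym: "\<And>i. transpose (P i) = P i"
    and bpf: "\<And>z. (\<forall>i. qform (P i) z = 0) \<Longrightarrow> z = 0"
  shows "\<exists>z. det (Nmat P z) \<noteq> 0"
proof -
  obtain c where c: "c > 0" "\<And>z. c * norm z ^ 4 \<le> (\<Sum>i\<in>UNIV. (cmod (qform (P i) z))\<^sup>2)"
    using system_growth[of P] bpf by metis
  define F where "F z = (\<Sum>i\<in>UNIV. (cmod (qform (P i) z))\<^sup>2) - (norm z)\<^sup>2" for z
  have cF: "continuous_on S F" for S unfolding F_def by (intro continuous_intros)
  \<comment> \<open>Beyond this radius \<open>c |z|^4\<close> exceeds \<open>|z|^2\<close>, so
    \<open>F\<close> is nonnegative there, while \<open>F 0 = 0\<close>. A minimum over the ball is
    therefore global.\<close>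
  define R where "R = sqrt (1 / c) + 1"
  have R: "R > 0" "c * R^2 > 1"
  proof -
    show "R > 0" using c by (simp add: R_def add_nonneg_pos)
    have "c * (sqrt (1/c))^2 = 1" using c by simp
    moreover have "R^2 > (sqrt (1/c))^2" unfolding R_def
      by (rule power_strict_mono) (use c in auto)
    ultimately show "c * R^2 > 1" by (metis c(1) mult_less_cancel_left_pos)
  qed
  obtain z0 where z0: "z0 \<in> cball 0 R" "\<And>z. z \<in> cball 0 R \<Longrightarrow> F z0 \<le> F z"
    using continuous_attains_inf[OF compact_cball _ cF, of 0 R] R by force
  have min: "F z0 \<le> F z" for z
  proof (cases "z \<in> cball 0 R")
    case False
    then have nz: "norm z > R" by simp
    have "c * norm z ^ 4 - norm z ^ 2 = norm z ^ 2 * (c * norm z ^ 2 - 1)"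
      by (simp add: algebra_simps flip: power_add)
    moreover have "c * norm z ^ 2 > 1"
      using nz R c by (smt (verit) mult_less_cancel_left_pos power_strict_mono pos2)
    ultimately have "c * norm z ^ 4 - norm z ^ 2 \<ge> 0" by simp
    then have "F z \<ge> 0" using c(2)[of z] unfolding F_def by linarith
    moreover have "F z0 \<le> F 0" using z0(2) R by simp
    moreover have "F 0 = 0" by (simp add: F_def)
    ultimately show ?thesis by linarith
  qed (use z0 in auto)
  have "det (Nmat P z0) \<noteq> 0"
  proof
    assume "det (Nmat P z0) = 0"
    then obtain v where v: "v \<noteq> 0" "Nmat P z0 *v v = 0"
      using invertible_det_nz[of "Nmat P z0"] matrix_left_invertible_ker[of "Nmat P z0"]
        invertible_left_inverse[of "Nmat P z0"]
      by metis
    have b0: "bform (P i) z0 v = 0" for i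
      using v(2) Nmat_mult_nth[of P i z0 v, OF sym] by simp
    have q: "qform (P i) (z0 + t *s v) = qform (P i) z0 + t^2 * qform (P i) v" for i t
      by (simp add: qform_add sym bform_smult_right b0 qform_smult)
    have q2: "qform (P i) (z0 - t *s v) = qform (P i) z0 + t^2 * qform (P i) v" for i t
      using q[of i "- t"] by simp
    define A where "A = (\<Sum>i\<in>UNIV. (cmod (qform (P i) v))\<^sup>2)"
    have key: "2 * (norm v)\<^sup>2 * r^2 \<le> 2 * A * r^4" if "r > 0" for r
    proof -
      have nrm: "(norm (z0 + t *s v))\<^sup>2 + (norm (z0 + (-t) *s v))\<^sup>2 = 2 * (norm z0)\<^sup>2 + 2 * (cmod t)\<^sup>2 * (norm v)\<^sup>2" for t
      proof -
        have "(norm (z0 + w))\<^sup>2 + (norm (z0 - w))\<^sup>2 = 2 * (norm z0)\<^sup>2 + 2 * (norm w)\<^sup>2" for w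
          by (simp add: power2_norm_eq_inner inner_simps inner_commute)
        from this[of "t *s v"] show ?thesis by (simp add: norm_smult_complex power_mult_distrib)
      qed
      have s: "(cmod (a + b))\<^sup>2 + (cmod (a - b))\<^sup>2 = 2 * (cmod a)\<^sup>2 + 2 * (cmod b)\<^sup>2" for a b
        unfolding cmod_power2 by (simp add: power2_eq_square algebra_simps)
      have F1: "F (z0 + t *s v) + F (z0 + (-t) *s v) =
         2 * (\<Sum>i\<in>UNIV. (cmod (qform (P i) z0 + t^2 * qform (P i) v))\<^sup>2) - 2 * (norm z0)\<^sup>2 - 2 * (cmod t)\<^sup>2 * (norm v)\<^sup>2" for t
        using nrm[of t] unfolding F_def by (simp add: q q2)
      \<comment> \<open>The parameters \<open>r\<close> and \<open>i r\<close> have opposite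
        squares, so the parallelogram law cancels the terms that are linear in
        \<open>qform (P i) v\<close>.\<close>
      have "F (z0 + of_real r *s v) + F (z0 + (- of_real r) *s v) + (F (z0 + (\<i> * of_real r) *s v) + F (z0 + (-(\<i> * of_real r)) *s v))
        = 2 * (\<Sum>i\<in>UNIV. (cmod (qform (P i) z0 + of_real r^2 * qform (P i) v))\<^sup>2 + (cmod (qform (P i) z0 - of_real r^2 * qform (P i) v))\<^sup>2)
         - 4 * (norm z0)\<^sup>2 - 4 * r\<^sup>2 * (norm v)\<^sup>2"
        unfolding F1 by (simp add: sum.distrib power_mult_distrib norm_mult)
      also have "\<dots> = 4 * (\<Sum>i\<in>UNIV. (cmod (qform (P i) z0))\<^sup>2) + 4 * r^4 * A - 4 * (norm z0)\<^sup>2 - 4 * r\<^sup>2 * (norm v)\<^sup>2"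
        unfolding s by (simp add: sum.distrib A_def norm_mult norm_power power_mult_distrib sum_distrib_left mult.assoc flip: power_mult)
      finally have "4 * F z0 \<le> 4 * (\<Sum>i\<in>UNIV. (cmod (qform (P i) z0))\<^sup>2) + 4 * r^4 * A - 4 * (norm z0)\<^sup>2 - 4 * r\<^sup>2 * (norm v)\<^sup>2"
        using min[of "z0 + of_real r *s v"] min[of "z0 + (- of_real r) *s v"]
          min[of "z0 + (\<i> * of_real r) *s v"] min[of "z0 + (-(\<i> * of_real r)) *s v"] by linarith
      then show ?thesis unfolding F_def by (simp add: algebra_simps)
    qed
    have A0: "A \<ge> 0" by (simp add: A_def sum_nonneg)
    \<comment> \<open>Chosen so that \<open>A r^2 < |v|^2\<close>; the summand 1 makes the
      inequality strict and covers \<open>A = 0\<close>.\<close>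
    define r where "r = norm v / (sqrt A + 1)"
    have "sqrt A + 1 > 0" using A0 by (simp add: add_nonneg_pos)
    then have r: "r > 0" using v by (simp add: r_def)
    have "(norm v)\<^sup>2 \<le> A * r^2"
    proof -
      have "r^2 * (norm v)\<^sup>2 \<le> r^2 * (A * r^2)"
        using key[OF r] by (simp add: algebra_simps flip: power_add)
      then show ?thesis using r by simp
    qed
    moreover have "A * r^2 < (sqrt A + 1)^2 * r^2"
    proof (rule mult_strict_right_mono)
      have "(sqrt A + 1)^2 = A + 2 * sqrt A + 1" using A0 by (simp add: power2_sum)
      then show "A < (sqrt A + 1)^2" using A0 by (smt (verit) real_sqrt_ge_0_iff)
    qed (use r in simp)
    moreover have "(sqrt A + 1)^2 * r^2 = (norm v)\<^sup>2"
      using \<open>sqrt A + 1 > 0\<close> by (simp add: r_def power_divide)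
    ultimately show False by linarith
  qed
  then show ?thesis by blast
qed

section \<open>Integrals of derivatives of compactly supported functions\<close>

lemma integrable_compact_support:
  fixes f :: "'a::euclidean_space \<Rightarrow> 'b::{banach,second_countable_topology}"
  assumes "continuous_on UNIV f" "\<And>z. norm z > R \<Longrightarrow> f z = 0"
  shows "integrable lborel f"
proof -
  have "integrable lborel (\<lambda>x. indicator (cball 0 R) x *\<^sub>R f x)"
    by (rule borel_integrable_compact) (use assms(1) continuous_on_subset in auto)
  moreover have "(\<lambda>x. indicator (cball 0 R) x *\<^sub>R f x) = f"
    using assms(2) by (auto simp: fun_eq_iff indicator_def)
  ultimately show ?thesis by simp
qed

lemma integral_lborel_shift:
  fixes f :: "'a::euclidean_space \<Rightarrow> 'b::{banach,second_countable_topology}"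
  assumes "f \<in> borel_measurable borel"
  shows "(\<integral>z. f (c + z) \<partial>lborel) = (\<integral>z. f z \<partial>lborel)"
proof -
  have "(\<integral>z. f z \<partial>lborel) = (\<integral>z. f z \<partial>(distr lborel borel ((+) c)))"
    by (simp add: lborel_distr_plus)
  also have "\<dots> = (\<integral>z. f (c + z) \<partial>lborel)"
    by (rule integral_distr) (use assms in auto)
  finally show ?thesis by simp
qed

text \<open>By translation invariance every difference quotient has integral zero. The quotients are
  bounded by a Lipschitz constant and supported in a common ball, so dominated convergence passes to
  the derivative.\<close>

lemma integral_directional_derivative_compact_support:
  fixes f :: "'a::euclidean_space \<Rightarrow> 'b::euclidean_space"
  assumes der: "\<And>z. (f has_derivative f' z) (at z)"
    and cont: "continuous_on UNIV (\<lambda>z. f' z v)"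
    and supp: "\<And>z. norm z > R \<Longrightarrow> f z = 0"
  shows "(\<integral>z. f' z v \<partial>lborel) = 0"
proof -
  have cf: "continuous_on UNIV f"
    using der has_derivative_continuous_on has_derivative_at_withinI by blast
  have supp': "f' z v = 0" if "norm z > R" for z
  proof -
    have o: "open {z::'a. norm z > R}" by (intro open_Collect_less continuous_intros)
    have "((\<lambda>_. 0) has_derivative f' z) (at z)"
      by (rule has_derivative_transform_within_open[OF der o]) (use that supp in auto)
    then have "f' z = (\<lambda>_. 0)" using has_derivative_unique has_derivative_const by metis
    then show ?thesis by simp
  qed
  have "bounded ((\<lambda>z. f' z v) ` cball 0 R)"
    by (intro compact_imp_bounded compact_continuous_image) (use cont continuous_on_subset in auto)
  then obtain B where B: "B > 0" "\<And>z. z \<in> cball 0 R \<Longrightarrow> norm (f' z v) \<le> B"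
    by (metis bounded_pos imageI)
  have B': "norm (f' z v) \<le> B" for z
    using B(2)[of z] supp'[of z] B(1) by (cases "norm z > R") auto
  have lip: "norm (f (z + h *\<^sub>R v) - f z) \<le> B * h" if "h > 0" for z h
  proof -
    have d: "((\<lambda>t. f (z + t *\<^sub>R v)) has_derivative (\<lambda>s. f' (z + t *\<^sub>R v) (s *\<^sub>R v))) (at t within {0..h})" for t
      by (rule has_derivative_compose[OF _ der, of "\<lambda>t. z + t *\<^sub>R v"]) (auto intro!: derivative_eq_intros)
    have o: "onorm (\<lambda>s. f' (z + t *\<^sub>R v) (s *\<^sub>R v)) \<le> B" for t
    proof -
      have "f' (z + t *\<^sub>R v) (s *\<^sub>R v) = s *\<^sub>R f' (z + t *\<^sub>R v) v" for s
        using der has_derivative_bounded_linear bounded_linear.linear linear_scale by blast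
      then show ?thesis using B'[of "z + t *\<^sub>R v"]
        by (intro onorm_le) (simp add: mult.commute[of B] mult_left_mono)
    qed
    have "norm (f (z + h *\<^sub>R v) - f (z + 0 *\<^sub>R v)) \<le> B * norm (h - 0)"
      by (rule differentiable_bound[OF _ d o]) (use that in auto)
    then show ?thesis using that by simp
  qed
  define s where "s n z = real (Suc n) *\<^sub>R (f (z + (1 / real (Suc n)) *\<^sub>R v) - f z)" for n z
  have mf: "f \<in> borel_measurable borel" using cf by (rule borel_measurable_continuous_onI)
  have if0: "integrable lborel f" by (rule integrable_compact_support[OF cf supp])
  have if1: "integrable lborel (\<lambda>z. f (z + c))" for c
  proof (rule integrable_compact_support[of _ "R + norm c"])
    show "continuous_on UNIV (\<lambda>z. f (z + c))"
      by (intro continuous_on_compose2[OF cf] continuous_intros) auto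
    show "f (z + c) = 0" if "norm z > R + norm c" for z
      using that norm_diff_ineq[of z c] by (intro supp) linarith
  qed
  have s0: "(\<integral>z. s n z \<partial>lborel) = 0" for n
    unfolding s_def using if0 if1[of "(1 / real (Suc n)) *\<^sub>R v"]
      integral_lborel_shift[OF mf, of "(1 / real (Suc n)) *\<^sub>R v"]
    by (simp add: add.commute del: of_nat_Suc)
  have "(\<lambda>n. \<integral>z. s n z \<partial>lborel) \<longlonglongrightarrow> (\<integral>z. f' z v \<partial>lborel)"
  proof (rule integral_dominated_convergence)
    show "integrable lborel (\<lambda>z. B * indicat_real (cball 0 (R + norm v)) z)"
      by (intro integrable_mult_right integrable_real_indicator emeasure_bounded_finite) auto
    show "s n \<in> borel_measurable lborel" for n
      unfolding s_def using if0 if1 by (intro borel_measurable_scaleR borel_measurable_diff borel_measurable_const borel_measurable_integrable)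
    show "(\<lambda>z. f' z v) \<in> borel_measurable lborel"
      using borel_measurable_continuous_onI[OF cont] by simp
    have "(\<lambda>n. s n z) \<longlonglongrightarrow> f' z v" for z
    proof -
      have d: "((\<lambda>t. f (z + t *\<^sub>R v)) has_derivative (\<lambda>s. f' (z + 0 *\<^sub>R v) (s *\<^sub>R v))) (at 0)"
        by (rule has_derivative_compose[OF _ der, of "\<lambda>t. z + t *\<^sub>R v"]) (auto intro!: derivative_eq_intros)
      have sc: "f' z (s *\<^sub>R v) = s *\<^sub>R f' z v" for s
        using der has_derivative_bounded_linear bounded_linear.linear linear_scale by blast
      have "((\<lambda>t. f (z + t *\<^sub>R v)) has_vector_derivative f' z v) (at 0)"
        using d unfolding has_vector_derivative_def by (simp add: sc)
      then have "((\<lambda>h. norm (f (z + h *\<^sub>R v) - f z - h *\<^sub>R f' z v) / norm h) \<longlongrightarrow> 0) (at 0)"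
        by (simp add: has_vector_derivative_def has_derivative_at)
      then have "((\<lambda>h. norm ((f (z + h *\<^sub>R v) - f z) /\<^sub>R h - f' z v)) \<longlongrightarrow> 0) (at 0)"
      proof (rule Lim_transform_eventually)
        have "norm (a - h *\<^sub>R c) / norm h = norm (a /\<^sub>R h - c)" if "h \<noteq> 0" for a c :: 'b and h :: real
        proof -
          have "a /\<^sub>R h - c = (a - h *\<^sub>R c) /\<^sub>R h" using that by (simp add: scaleR_diff_right)
          then show ?thesis by (simp add: divide_inverse_commute)
        qed
        then show "\<forall>\<^sub>F h in at 0. norm (f (z + h *\<^sub>R v) - f z - h *\<^sub>R f' z v) / norm h = norm ((f (z + h *\<^sub>R v) - f z) /\<^sub>R h - f' z v)"
          by (auto simp: eventually_at_filter)
      qed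
      then have l: "((\<lambda>h. (f (z + h *\<^sub>R v) - f z) /\<^sub>R h) \<longlongrightarrow> f' z v) (at 0)"
        by (subst Lim_null) (rule tendsto_norm_zero_cancel) 
      have h: "filterlim (\<lambda>n. 1 / real (Suc n)) (at 0) sequentially"
        using LIMSEQ_inverse_real_of_nat[unfolded inverse_eq_divide]
        by (auto simp: filterlim_at simp del: of_nat_Suc)
      show ?thesis using filterlim_compose[OF l h] by (simp add: s_def)
    qed
    then show "AE z in lborel. (\<lambda>n. s n z) \<longlonglongrightarrow> f' z v" by simp
    have "norm (s n z) \<le> B * indicat_real (cball 0 (R + norm v)) z" for n z
    proof (cases "z \<in> cball 0 (R + norm v)")
      case True
      have "norm (s n z) \<le> real (Suc n) * (B * (1 / real (Suc n)))"
        unfolding s_def norm_scaleR by (intro mult_mono lip) auto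
      then show ?thesis using True by (simp del: of_nat_Suc)
    next
      case False
      then have *: "norm z > R + norm v" by simp
      then have "f z = 0" by (intro supp) (smt (verit) norm_ge_zero)
      moreover have "f (z + (1 / real (Suc n)) *\<^sub>R v) = 0"
      proof (rule supp)
        have "norm ((1 / real (Suc n)) *\<^sub>R v) \<le> norm v" by (simp add: divide_le_eq mult_le_cancel_left1)
        then show "R < norm (z + (1 / real (Suc n)) *\<^sub>R v)"
          using * norm_diff_ineq[of z "(1 / real (Suc n)) *\<^sub>R v"] by linarith
      qed
      ultimately show ?thesis using False by (simp add: s_def)
    qed
    then show "AE z in lborel. norm (s n z) \<le> B * indicat_real (cball 0 (R + norm v)) z" for n by simp
  qed
  then show ?thesis unfolding s0 using LIMSEQ_const_iff[of 0] by metis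
qed

section \<open>The determinant is not in the ideal of the system\<close>

text \<open>With \<open>x = axis k 1\<close> the determinant is the cofactor of \<open>A\<close> at
  position \<open>(i, k)\<close>; all uses of cofactors and of the adjugate go through this
  form.\<close>

definition repl_row :: "'n \<Rightarrow> 'a^'n \<Rightarrow> 'a^'n^'n \<Rightarrow> 'a::comm_ring_1^'n^'n" where
  "repl_row i x A = (\<chi> l. if l = i then x else A $ l)"

lemma repl_row_self: "repl_row i (A $ i) A = A"
  by (simp add: repl_row_def vec_eq_iff)

lemma det_repl_row_mult: "det (repl_row i (c *s x) A) = c * det (repl_row i x A)"
  unfolding repl_row_def by (rule det_row_mul)

lemma det_repl_row_sum: "finite S \<Longrightarrow> det (repl_row i (\<Sum>k\<in>S. a k) A) = (\<Sum>k\<in>S. det (repl_row i (a k) A))"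
  unfolding repl_row_def by (rule det_linear_row_sum)

lemma det_repl_row_expand:
  fixes x :: "'a::comm_ring_1^'n"
  shows "det (repl_row i x A) = (\<Sum>k\<in>UNIV. x $ k * det (repl_row i (axis k 1) A))"
proof -
  have "det (repl_row i x A) = det (repl_row i (\<Sum>k\<in>UNIV. x $ k *s axis k 1) A)"
    by (simp add: basis_expansion)
  also have "\<dots> = (\<Sum>k\<in>UNIV. x $ k * det (repl_row i (axis k 1) A))"
    by (simp add: det_repl_row_sum det_repl_row_mult)
  finally show ?thesis .
qed

lemma det_repl_row_other: "i \<noteq> j \<Longrightarrow> det (repl_row i (A $ j) A) = 0"
  by (rule det_identical_rows[of i j]) (auto simp: row_def repl_row_def vec_eq_iff)

lemma det_repl_row_swap:
  assumes "i \<noteq> j"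
  shows "det (repl_row i x (repl_row j y A)) = - det (repl_row i y (repl_row j x A))"
proof -
  let ?p = "Transposition.transpose i j"
  have p: "?p permutes UNIV" by (simp add: permutes_swap_id)
  have "repl_row i x (repl_row j y A) = (\<chi> l. repl_row i y (repl_row j x A) $ ?p l)"
    using assms by (auto simp: repl_row_def vec_eq_iff Transposition.transpose_def)
  then show ?thesis using det_permute_rows[OF p, of "repl_row i y (repl_row j x A)"] assms
    by (simp add: sign_swap_id)
qed

lemma has_derivative_det:
  fixes A :: "'b::real_normed_vector \<Rightarrow> 'a::real_normed_field^'n^'n"
  assumes "\<And>i j. ((\<lambda>z. A z $ i $ j) has_derivative (\<lambda>v. A' v $ i $ j)) (at z)"
  shows "((\<lambda>z. det (A z)) has_derivative (\<lambda>v. \<Sum>l\<in>UNIV. det (repl_row l (A' v $ l) (A z)))) (at z)"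
proof -
  have prod: "(\<Prod>m\<in>UNIV. repl_row l (A' v $ l) (A z) $ m $ p m) = A' v $ l $ p l * (\<Prod>m\<in>UNIV - {l}. A z $ m $ p m)" for l v p
    by (subst prod.remove[of UNIV l]) (auto simp: repl_row_def)
  have "(\<Sum>l\<in>UNIV. det (repl_row l (A' v $ l) (A z)))
    = (\<Sum>p\<in>{p. p permutes UNIV}. of_int (sign p) * (\<Sum>l\<in>UNIV. A' v $ l $ p l * (\<Prod>m\<in>UNIV - {l}. A z $ m $ p m)))" for v
    unfolding det_def prod by (subst sum.swap) (simp add: sum_distrib_left)
  moreover have "((\<lambda>z. det (A z)) has_derivative
     (\<lambda>v. \<Sum>p\<in>{p. p permutes UNIV}. of_int (sign p) * (\<Sum>l\<in>UNIV. A' v $ l $ p l * (\<Prod>m\<in>UNIV - {l}. A z $ m $ p m)))) (at z)"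
    unfolding det_def by (intro has_derivative_sum has_derivative_mult_right has_derivative_prod assms)
  ultimately show ?thesis by simp
qed

lemma continuous_on_det:
  fixes A :: "'b::topological_space \<Rightarrow> complex^'n^'n"
  assumes "\<And>i j. continuous_on S (\<lambda>z. A z $ i $ j)"
  shows "continuous_on S (\<lambda>z. det (A z))"
  unfolding det_def by (intro continuous_intros assms)

text \<open>The square makes the truncated line continuously differentiable at 1, enough for one
  integration by parts. The derivative is strictly negative below 1, so the final integrand has a
  sign.\<close>

lemma cutoff_derivative: "((\<lambda>s::real. (max 0 (1 - s))\<^sup>2) has_real_derivative (- 2 * max 0 (1 - s))) (at s)"
proof -
  consider "s < 1" | "s > 1" | "s = 1" by linarith
  then show ?thesis
  proof cases
    case 1
    have "((\<lambda>s::real. (1 - s)\<^sup>2) has_real_derivative (- 2 * max 0 (1 - s))) (at s)"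
      using 1 by (auto intro!: derivative_eq_intros)
    then show ?thesis
      by (rule has_field_derivative_transform_within_open[of _ _ _ "{..<1}"]) (use 1 in auto)
  next
    case 2
    have "((\<lambda>s::real. 0) has_real_derivative (- 2 * max 0 (1 - s))) (at s)"
      using 2 by (auto intro!: derivative_eq_intros)
    then show ?thesis
      by (rule has_field_derivative_transform_within_open[of _ _ _ "{1<..}"]) (use 2 in auto)
  next
    case 3
    have "((\<lambda>h. ((max 0 (1 - (1 + h)))\<^sup>2 - (max 0 (1 - 1))\<^sup>2) / h) \<longlongrightarrow> (0::real)) (at 0)"
    proof (rule Lim_null_comparison)
      have "norm (((max 0 (1 - (1 + h)))\<^sup>2 - (max 0 (1 - 1))\<^sup>2) / h) \<le> \<bar>h\<bar>" for h :: real
        by (cases "h < 0") (auto simp: power2_eq_square)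
      then show "\<forall>\<^sub>F h in at 0. norm (((max 0 (1 - (1 + h)))\<^sup>2 - (max 0 (1 - 1))\<^sup>2) / h) \<le> \<bar>h::real\<bar>" by simp
      show "(abs \<longlongrightarrow> 0) (at (0::real))" using tendsto_rabs_zero[OF tendsto_ident_at, of UNIV] by simp
    qed
    then show ?thesis unfolding 3 by (simp add: DERIV_def)
  qed
qed

lemma has_derivative_bform:
  fixes P :: "complex^'n^'n"
  shows "(qform P has_derivative (\<lambda>v. bform P z v + bform P v z)) (at z)"
proof -
  have "((\<lambda>z. \<Sum>i\<in>UNIV. \<Sum>j\<in>UNIV. P $ i $ j * z $ i * z $ j) has_derivative
     (\<lambda>v. \<Sum>i\<in>UNIV. \<Sum>j\<in>UNIV. P $ i $ j * z $ i * v $ j + P $ i $ j * v $ i * z $ j)) (at z)"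
    by (intro has_derivative_sum) (auto intro!: derivative_eq_intros bounded_linear_imp_has_derivative[OF bounded_linear_vec_nth] simp: algebra_simps)
  then show ?thesis by (simp add: qform_def[abs_def] bform_sum_def sum.distrib)
qed

lemma matrix_vector_mult_axis: "((A::'a::comm_ring_1^'n^'m) *v axis k 1) $ m = A $ m $ k"
  by (simp add: matrix_vector_mult_def axis_def if_distrib cong: if_cong)

text \<open>
  The Piola identity: for \<open>A = Nmat P z\<close> the left-hand side is the divergence of the
  \<open>i\<close>-th row of cofactors.
\<close>

lemma cofactor_divergence:
  fixes P :: "'n \<Rightarrow> 'a::{idom, ring_char_0}^'n^'n"
  assumes sym: "\<And>i. transpose (P i) = P i"
  shows "(\<Sum>k\<in>UNIV. \<Sum>l\<in>UNIV - {i}. det (repl_row l (P l *v axis k 1) (repl_row i (axis k 1) A))) = 0"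
proof -
  have "(\<Sum>k\<in>UNIV. det (repl_row l (P l *v axis k 1) (repl_row i (axis k 1) A))) = 0" if l: "l \<noteq> i" for l
  proof -
    \<comment> \<open>\<open>D\<close> is antisymmetric in its two indices and the Hessian entries
      \<open>P l $ m $ k\<close> are symmetric, so the contraction of the two vanishes.\<close>
    define D where "D m k = det (repl_row l (axis m 1) (repl_row i (axis k 1) A))" for m k
    have anti: "D m k = - D k m" for m k unfolding D_def by (rule det_repl_row_swap[OF l])
    have Ps: "P l $ m $ k = P l $ k $ m" for m k
      using sym[of l] by (simp add: transpose_def vec_eq_iff)
    have "det (repl_row l (P l *v axis k 1) (repl_row i (axis k 1) A)) = (\<Sum>m\<in>UNIV. P l $ m $ k * D m k)" for k
      unfolding D_def by (subst det_repl_row_expand) (simp add: matrix_vector_mult_axis)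
    then have S: "(\<Sum>k\<in>UNIV. det (repl_row l (P l *v axis k 1) (repl_row i (axis k 1) A))) = (\<Sum>k\<in>UNIV. \<Sum>m\<in>UNIV. P l $ m $ k * D m k)" by simp
    also have "\<dots> = (\<Sum>k\<in>UNIV. \<Sum>m\<in>UNIV. P l $ k $ m * D k m)" by (rule sum.swap)
    also have "\<dots> = - (\<Sum>k\<in>UNIV. \<Sum>m\<in>UNIV. P l $ m $ k * D m k)"
      unfolding sum_negf[symmetric] by (intro sum.cong refl) (metis Ps anti mult_minus_right)
    finally have "2 * (\<Sum>k\<in>UNIV. \<Sum>m\<in>UNIV. P l $ m $ k * D m k) = 0" by (simp only: S mult_2 eq_neg_iff_add_eq_0)
    then show ?thesis unfolding S by simp
  qed
  then show ?thesis by (subst sum.swap) simp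
qed

text \<open>
  Write \<open>u\<close> for the vector of the forms and \<open>\<delta>\<close> for the determinant. By the Piola identity
  \<open>\<chi>'(|u|\<^sup>2) u\<^sub>i\<close> times the conjugate of \<open>\<delta>\<close> is an antiholomorphic divergence, for the cutoff
  \<open>\<chi> s = (max 0 (1 - s))\<^sup>2\<close>, and it remains one after multiplication with a holomorphic function. So
  if \<open>\<delta> = \<Sum> u\<^sub>i g\<^sub>i\<close>, then \<open>\<chi>'(|u|\<^sup>2) |\<delta>|\<^sup>2\<close> has integral zero and \<open>\<delta>\<close> vanishes near the origin.
\<close>

theorem det_notin_ideal:
  fixes P G :: "'n::finite \<Rightarrow> complex^'n^'n"
  assumes sym: "\<And>i. transpose (P i) = P i"
    and bpf: "\<And>z. (\<forall>i. qform (P i) z = 0) \<Longrightarrow> z = 0"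
    and ideal: "\<And>z. det (Nmat P z) = (\<Sum>i\<in>UNIV. qform (P i) z * qform (G i) z)"
  shows False
proof -
  define U where "U z = (\<Sum>i\<in>UNIV. (cmod (qform (P i) z))\<^sup>2)" for z
  obtain c where c: "c > 0" "\<And>z. c * norm z ^ 4 \<le> U z"
    using system_growth[of P] bpf unfolding U_def by metis
  define chi where "chi s = (max 0 (1 - s))\<^sup>2" for s :: real
  define chi' where "chi' s = - 2 * max 0 (1 - s)" for s :: real
  define C where "C i k z = repl_row i (axis k 1) (Nmat P z)" for i k :: 'n and z
  \<comment> \<open>The derivative of the cofactor, row by row; row \<open>i\<close> is constant and
    contributes nothing.\<close>
  define dC where "dC i k z v = (\<Sum>l\<in>UNIV - {i}. det (repl_row l (P l *v v) (C i k z)))" for i k z v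
  define dU where "dU z v = (\<Sum>j\<in>UNIV. 2 * Re (cnj (qform (P j) z) * (2 * bform (P j) z v)))" for z v
  \<comment> \<open>For fixed \<open>i\<close>, the \<open>k\<close>-th component of the vector
    field to be integrated: a holomorphic factor, the cutoff, and a conjugated cofactor.\<close>
  define Psi where "Psi i k z = qform (G i) z * of_real (chi (U z)) * cnj (det (C i k z))" for i k z
  define dPsi where "dPsi i k z v = (bform (G i) z v + bform (G i) v z) * of_real (chi (U z)) * cnj (det (C i k z))
     + qform (G i) z * of_real (chi' (U z) * dU z v) * cnj (det (C i k z))
     + qform (G i) z * of_real (chi (U z)) * cnj (dC i k z v)" for i k z v
  have dP: "(qform (P j) has_derivative (\<lambda>v. 2 * bform (P j) z v)) (at z)" for j z
    using has_derivative_bform[of "P j" z] bform_commute[OF sym[of j], of z] by simp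
  have derU: "(U has_derivative dU z) (at z)" for z
  proof -
    have "((\<lambda>z. (cmod (qform (P j) z))\<^sup>2) has_derivative (\<lambda>v. 2 * Re (cnj (qform (P j) z) * (2 * bform (P j) z v)))) (at z)" for j
    proof -
      have "((\<lambda>z. (Re (qform (P j) z))\<^sup>2 + (Im (qform (P j) z))\<^sup>2) has_derivative
         (\<lambda>v. 2 * Re (cnj (qform (P j) z) * (2 * bform (P j) z v)))) (at z)"
        by (auto intro!: derivative_eq_intros dP simp: algebra_simps)
      then show ?thesis by (simp add: cmod_power2)
    qed
    then show ?thesis unfolding U_def[abs_def] dU_def by (intro has_derivative_sum)
  qed
  have derC: "((\<lambda>z. det (C i k z)) has_derivative dC i k z) (at z)" for i k z
  proof -
    define A' where "A' v = (\<chi> l. if l = i then 0 else P l *v v)" for v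
    have "((\<lambda>z. det (C i k z)) has_derivative (\<lambda>v. \<Sum>l\<in>UNIV. det (repl_row l (A' v $ l) (C i k z)))) (at z)"
    proof (rule has_derivative_det)
      fix a b
      show "((\<lambda>z. C i k z $ a $ b) has_derivative (\<lambda>v. A' v $ a $ b)) (at z)"
      proof (cases "a = i")
        case False
        have "((\<lambda>z. \<Sum>j\<in>UNIV. P a $ b $ j * z $ j) has_derivative (\<lambda>v. \<Sum>j\<in>UNIV. P a $ b $ j * v $ j)) (at z)"
          by (intro has_derivative_sum has_derivative_mult_right bounded_linear_imp_has_derivative[OF bounded_linear_vec_nth])
        then show ?thesis using False by (simp add: C_def A'_def repl_row_def Nmat_def matrix_vector_mult_def)
      qed (simp add: C_def A'_def repl_row_def)
    qed
    moreover have "(\<Sum>l\<in>UNIV. det (repl_row l (A' v $ l) (C i k z))) = dC i k z v" for v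
    proof -
      have "det (repl_row i (0 *s 0) (C i k z)) = 0" unfolding det_repl_row_mult by simp
      then have "det (repl_row i (A' v $ i) (C i k z)) = 0" by (simp add: A'_def)
      then show ?thesis unfolding dC_def
        by (subst sum.remove[of UNIV i]) (auto intro!: sum.cong simp: A'_def)
    qed
    ultimately show ?thesis by simp
  qed
  have derchi: "((\<lambda>z. chi (U z)) has_derivative (\<lambda>v. chi' (U z) * dU z v)) (at z)" for z
    using has_derivative_compose[OF derU[of z] cutoff_derivative[of "U z", unfolded has_field_derivative_def]]
    by (simp add: chi_def chi'_def)
  have derPsi: "(Psi i k has_derivative dPsi i k z) (at z)" for i k z
    using has_derivative_mult[OF has_derivative_mult[OF has_derivative_bform[of "G i" z] has_derivative_of_real[OF derchi[of z]]]
        has_derivative_cnj[OF derC[of i k z]]]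
    unfolding Psi_def[abs_def] dPsi_def[abs_def] by (simp add: algebra_simps)
  have cont_bf: "continuous_on UNIV (\<lambda>z. bform (Q::complex^'n^'n) z v)" "continuous_on UNIV (\<lambda>z. bform Q v z)" for Q v
    unfolding bform_sum_def by (intro continuous_intros)+
  have contU: "continuous_on UNIV U" unfolding U_def by (intro continuous_intros)
  have cont_mv: "continuous_on UNIV (\<lambda>z. (Nmat P z) $ a $ b)" for a b
    unfolding Nmat_def matrix_vector_mult_def by (simp, intro continuous_intros)
  have contC: "continuous_on UNIV (\<lambda>z. C i k z $ a $ b)" for i k a b
    unfolding C_def repl_row_def using cont_mv by (cases "a = i") auto
  have contdC: "continuous_on UNIV (\<lambda>z. dC i k z v)" for i k v
    unfolding dC_def
  proof (intro continuous_on_sum continuous_on_det)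
    fix l a b show "continuous_on UNIV (\<lambda>z. repl_row l (P l *v v) (C i k z) $ a $ b)"
      unfolding repl_row_def using contC by (cases "a = l") auto
  qed
  have contchi: "continuous_on UNIV (\<lambda>z. chi (U z))" "continuous_on UNIV (\<lambda>z. chi' (U z))"
    unfolding chi_def chi'_def by (intro continuous_intros contU)+
  have contdU: "continuous_on UNIV (\<lambda>z. dU z v)" for v
    unfolding dU_def by (intro continuous_intros cont_bf)
  have cont_dPsi: "continuous_on UNIV (\<lambda>z. dPsi i k z v)" for i k v
    unfolding dPsi_def
    by (intro continuous_intros cont_bf contchi contdU continuous_on_det contC contdC)
  \<comment> \<open>For \<open>|z| > 1\<close> one has \<open>|z| <= |z|^4\<close>, so
    \<open>|z| > 1 / c\<close> forces \<open>U z >= 1\<close>, where the cutoff and its derivative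
    vanish.\<close>
  define R where "R = max 1 (1 / c)"
  have supp: "chi (U z) = 0 \<and> chi' (U z) = 0" if "norm z > R" for z
  proof -
    have z1: "norm z > 1" "norm z > 1 / c" using that by (auto simp: R_def)
    have "norm z ^ 1 \<le> norm z ^ 4" using z1 by (intro power_increasing) auto
    then have "1 / c \<le> norm z ^ 4" using z1 by simp
    then have "1 \<le> c * norm z ^ 4" using c(1) by (simp add: divide_le_eq mult.commute)
    then have "U z \<ge> 1" using c(2)[of z] by linarith
    then show ?thesis by (simp add: chi_def chi'_def)
  qed
  have int0: "(\<integral>z. dPsi i k z v \<partial>lborel) = 0" for i k v
    by (rule integral_directional_derivative_compact_support[OF derPsi cont_dPsi, of R])
       (use supp in \<open>auto simp: Psi_def\<close>)
  have intg: "integrable lborel (\<lambda>z. dPsi i k z v)" for i k v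
    by (rule integrable_compact_support[OF cont_dPsi, of R])
       (use supp in \<open>auto simp: dPsi_def\<close>)
  \<comment> \<open>\<open>D v + i D (i v)\<close> is twice the antiholomorphic derivative in
    direction \<open>v\<close>. It annihilates complex linear derivatives, so the factor coming from
    \<open>G i\<close> is not differentiated.\<close>
  define E where "E z = (\<Sum>i\<in>UNIV. \<Sum>k\<in>UNIV. dPsi i k z (axis k 1) + \<i> * dPsi i k z (\<i> *s axis k 1))" for z
  have intE: "(\<integral>z. E z \<partial>lborel) = 0"
    unfolding E_def by (simp add: intg int0)
  have Eval: "E z = of_real (4 * chi' (U z) * (cmod (det (Nmat P z)))\<^sup>2)" for z
  proof -
    have dU': "of_real (dU z v) + \<i> * of_real (dU z (\<i> *s v)) = (\<Sum>j\<in>UNIV. 4 * qform (P j) z * cnj (bform (P j) z v))" for v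
    proof -
      have "complex_of_real (2 * Re (cnj u * (2 * b))) + \<i> * complex_of_real (2 * Re (cnj u * (2 * (\<i> * b)))) = 4 * u * cnj b" for u b
        by (simp add: complex_eq_iff)
      then show ?thesis unfolding dU_def bform_smult_right
        by (simp only: of_real_sum sum_distrib_left sum.distrib[symmetric])
    qed
    have dC': "cnj (dC i k z v) + \<i> * cnj (dC i k z (\<i> *s v)) = 2 * cnj (dC i k z v)" for i k v
    proof -
      have "P l *v (\<i> *s v) = \<i> *s (P l *v v)" for l by (simp add: vector_scalar_commute)
      then have "dC i k z (\<i> *s v) = \<i> * dC i k z v"
        unfolding dC_def by (simp only: det_repl_row_mult sum_distrib_left)
      then show ?thesis by (simp add: complex_eq_iff)
    qed
    have one: "dPsi i k z v + \<i> * dPsi i k z (\<i> *s v) =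
       qform (G i) z * of_real (chi' (U z)) * (\<Sum>j\<in>UNIV. 4 * qform (P j) z * cnj (bform (P j) z v)) * cnj (det (C i k z))
       + 2 * qform (G i) z * of_real (chi (U z)) * cnj (dC i k z v)" for i k v
    proof -
      have "dPsi i k z v + \<i> * dPsi i k z (\<i> *s v) =
        qform (G i) z * of_real (chi' (U z)) * (of_real (dU z v) + \<i> * of_real (dU z (\<i> *s v))) * cnj (det (C i k z))
       + qform (G i) z * of_real (chi (U z)) * (cnj (dC i k z v) + \<i> * cnj (dC i k z (\<i> *s v)))"
        unfolding dPsi_def bform_smult_left bform_smult_right by (simp add: algebra_simps)
      then show ?thesis unfolding dU' dC' by (simp add: algebra_simps)
    qed
    \<comment> \<open>Expanding row \<open>j\<close> against the cofactors of row \<open>i\<close>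
      gives a determinant with two equal rows unless \<open>j = i\<close>.\<close>
    have cof: "(\<Sum>k\<in>UNIV. bform (P j) z (axis k 1) * det (C i k z)) = (if j = i then det (Nmat P z) else 0)" for i j
    proof -
      have "bform (P j) z (axis k 1) = Nmat P z $ j $ k" for k
        using Nmat_mult_nth[of P j z "axis k 1", OF sym] by (simp add: matrix_vector_mult_axis)
      then have "(\<Sum>k\<in>UNIV. bform (P j) z (axis k 1) * det (C i k z)) = det (repl_row i (Nmat P z $ j) (Nmat P z))"
        unfolding C_def by (subst det_repl_row_expand[of i]) simp
      then show ?thesis using repl_row_self[of i] det_repl_row_other[of i j "Nmat P z"] by (auto simp: repl_row_self)
    qed
    have "(\<Sum>k\<in>UNIV. dC i k z (axis k 1)) = 0" for i
      unfolding dC_def C_def using cofactor_divergence[OF sym] .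
    then have piola: "(\<Sum>k\<in>UNIV. cnj (dC i k z (axis k 1))) = 0" for i by (metis cnj_sum complex_cnj_zero)
    have "(\<Sum>k\<in>UNIV. (\<Sum>j\<in>UNIV. 4 * qform (P j) z * cnj (bform (P j) z (axis k 1))) * cnj (det (C i k z)))
       = (\<Sum>j\<in>UNIV. 4 * qform (P j) z * cnj (\<Sum>k\<in>UNIV. bform (P j) z (axis k 1) * det (C i k z)))" for i
      by (simp add: sum_distrib_left sum_distrib_right mult.assoc) (rule sum.swap)
    then have inner: "(\<Sum>k\<in>UNIV. (\<Sum>j\<in>UNIV. 4 * qform (P j) z * cnj (bform (P j) z (axis k 1))) * cnj (det (C i k z)))
       = 4 * qform (P i) z * cnj (det (Nmat P z))" for i
      unfolding cof by (simp add: if_distrib cong: if_cong)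
    have "E z = (\<Sum>i\<in>UNIV. qform (G i) z * of_real (chi' (U z)) *
          (\<Sum>k\<in>UNIV. (\<Sum>j\<in>UNIV. 4 * qform (P j) z * cnj (bform (P j) z (axis k 1))) * cnj (det (C i k z)))
       + 2 * qform (G i) z * of_real (chi (U z)) * (\<Sum>k\<in>UNIV. cnj (dC i k z (axis k 1))))"
    proof -
      have "(\<Sum>k\<in>UNIV. a * s k * d k + b * e k) = a * (\<Sum>k\<in>UNIV. s k * d k) + b * (\<Sum>k\<in>UNIV. e k)"
        for a b :: complex and s d e :: "'n \<Rightarrow> complex"
        by (simp add: sum.distrib sum_distrib_left mult.assoc)
      then show ?thesis unfolding E_def one by simp
    qed
    also have "\<dots> = 4 * of_real (chi' (U z)) * (\<Sum>i\<in>UNIV. qform (P i) z * qform (G i) z) * cnj (det (Nmat P z))"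
      unfolding inner piola by (simp add: sum_distrib_left sum_distrib_right mult_ac)
    also have "\<dots> = 4 * of_real (chi' (U z)) * (det (Nmat P z) * cnj (det (Nmat P z)))"
      unfolding ideal by (simp add: mult.assoc)
    also have "\<dots> = of_real (4 * chi' (U z) * (cmod (det (Nmat P z)))\<^sup>2)"
      unfolding complex_norm_square[symmetric] by simp
    finally show ?thesis .
  qed
  define W where "W z = - 4 * chi' (U z) * (cmod (det (Nmat P z)))\<^sup>2" for z
  have contW: "continuous_on UNIV W"
    unfolding W_def by (intro continuous_intros contchi continuous_on_det cont_mv)
  have intW: "integrable lborel W"
    by (rule integrable_compact_support[OF contW, of R]) (use supp in \<open>auto simp: W_def\<close>)
  have "(\<integral>z. W z \<partial>lborel) = 0"
  proof -
    have "E z = complex_of_real (- W z)" for z unfolding Eval W_def by simp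
    then have "complex_of_real (\<integral>z. - W z \<partial>lborel) = 0" using intE by (simp only: integral_complex_of_real)
    then show ?thesis by simp
  qed
  moreover have Wpos: "W z \<ge> 0" for z by (simp add: W_def chi'_def)
  ultimately have ae: "AE z in lborel. W z = 0"
    using integral_nonneg_eq_0_iff_AE[OF intW] by simp
  have W0: "W z = 0" for z
  proof (rule ccontr)
    assume "W z \<noteq> 0"
    have o: "open {z. W z \<noteq> 0}" using contW by (intro open_Collect_neq continuous_intros)
    have "{z. W z \<noteq> 0} \<in> null_sets lborel" using ae o by (subst AE_iff_null_sets[of _ lborel]) auto
    then have "negligible {z. W z \<noteq> 0}" by (metis negligible_iff_null_sets null_sets_completionI)
    then show False using open_not_negligible[OF o] \<open>W z \<noteq> 0\<close> by blast
  qed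
  \<comment> \<open>The determinant is homogeneous, so a point where it does not vanish can be
    scaled into the region \<open>U < 1\<close>, where \<open>chi'\<close> is nonzero.\<close>
  obtain z0 where z0: "det (Nmat P z0) \<noteq> 0" using jacobian_nonzero_somewhere[of P] sym bpf by metis
  have "((\<lambda>r. U (r *\<^sub>R z0)) \<longlongrightarrow> U (0 *\<^sub>R z0)) (at_right 0)"
  proof (rule continuous_on_tendsto_compose[OF contU])
    show "((\<lambda>r. r *\<^sub>R z0) \<longlongrightarrow> 0 *\<^sub>R z0) (at_right 0)" by (intro tendsto_intros)
  qed auto
  moreover have "U 0 = 0" by (simp add: U_def)
  ultimately have "\<forall>\<^sub>F r in at_right 0. U (r *\<^sub>R z0) < 1 \<and> r > 0"
    by (auto intro!: eventually_conj eventually_at_right_less elim: order_tendstoD)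
  then obtain r where r: "U (r *\<^sub>R z0) < 1" "r > 0" using eventually_happens'[of "at_right (0::real)"] by auto
  have "Nmat P (r *\<^sub>R z0) = (\<chi> i. of_real r *s (P i *v z0))"
    unfolding Nmat_def smult_of_real[symmetric] by (simp add: vector_scalar_commute)
  then have "det (Nmat P (r *\<^sub>R z0)) = (\<Prod>i\<in>(UNIV::'n set). of_real r) * det (Nmat P z0)"
    using det_rows_mul[of "\<lambda>_. of_real r" "\<lambda>i. P i *v z0"] by (simp add: Nmat_def)
  then have "det (Nmat P (r *\<^sub>R z0)) \<noteq> 0" using r z0 by simp
  then show False using W0[of "r *\<^sub>R z0"] r by (simp add: W_def chi'_def)
qed

section \<open>Duality for complete intersections of four quadrics\<close>

definition repl_col :: "'n \<Rightarrow> 'a^'n \<Rightarrow> 'a^'n^'n \<Rightarrow> 'a::comm_ring_1^'n^'n" where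
  "repl_col k x A = transpose (repl_row k x (transpose A))"

text \<open>Both determinants are the same cofactor: only permutations with \<open>p i = k\<close>
  contribute, and on these the two products agree.\<close>

lemma det_repl_row_col: "det (repl_row i (axis k 1) A) = det (repl_col k (axis i 1) A)"
  for A :: "'a::comm_ring_1^'n^'n"
  unfolding det_def
proof (rule sum.cong, rule refl)
  fix p assume "p \<in> {p. p permutes (UNIV::'n set)}"
  then have p: "p permutes UNIV" by simp
  have "(\<Prod>m\<in>UNIV. repl_row i (axis k 1) A $ m $ p m) = (\<Prod>m\<in>UNIV. repl_col k (axis i 1) A $ m $ p m)"
  proof (cases "p i = k")
    case True
    then have "p m = k \<longleftrightarrow> m = i" for m using permutes_inj[OF p] by (auto dest: injD)
    then show ?thesis
      by (intro prod.cong refl) (auto simp: repl_row_def repl_col_def transpose_def axis_def True)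
  next
    case False
    obtain m where m: "p m = k" using permutes_surj[OF p] by (metis surjD)
    have "(\<Prod>m\<in>UNIV. repl_row i (axis k 1) A $ m $ p m) = 0"
      by (rule prod_zero) (use False in \<open>auto simp: repl_row_def axis_def intro!: exI[of _ i]\<close>)
    moreover have "(\<Prod>m\<in>UNIV. repl_col k (axis i 1) A $ m $ p m) = 0"
      by (rule prod_zero) (use False m in \<open>auto simp: repl_col_def repl_row_def transpose_def axis_def intro!: exI[of _ m]\<close>)
    ultimately show ?thesis by simp
  qed
  then show "of_int (sign p) * (\<Prod>m\<in>UNIV. repl_row i (axis k 1) A $ m $ p m)
    = of_int (sign p) * (\<Prod>m\<in>UNIV. repl_col k (axis i 1) A $ m $ p m)" by simp
qed

text \<open>Cramer's rule for row vectors, free of division. After expanding in the entries of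
  \<open>w\<close>, the sums over \<open>i\<close> are determinants in which column \<open>k\<close>
  of \<open>A\<close> is replaced by column \<open>j\<close>, so only \<open>k = j\<close>
  survives.\<close>

lemma det_smult_vector:
  fixes A :: "'a::comm_ring_1^'n^'n"
  shows "det A * w $ j = (\<Sum>i\<in>UNIV. det (repl_row i w A) * A $ i $ j)"
proof -
  have col: "(\<Sum>i\<in>UNIV. A $ i $ j * det (repl_row i (axis k 1) A)) = (if j = k then det A else 0)" for k
  proof -
    have e: "det (repl_row i (axis k 1) A) = det (repl_row k (axis i 1) (transpose A))" for i
      using det_repl_row_col[of i k A] by (simp add: repl_col_def)
    have "(\<Sum>i\<in>UNIV. A $ i $ j * det (repl_row i (axis k 1) A)) = det (repl_row k (transpose A $ j) (transpose A))"
      by (subst det_repl_row_expand[of k]) (simp only: e, simp add: transpose_def)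
    then show ?thesis using det_repl_row_other[of k j "transpose A"]
      by (auto simp: repl_row_self)
  qed
  have "(\<Sum>i\<in>UNIV. det (repl_row i w A) * A $ i $ j) = (\<Sum>i\<in>UNIV. \<Sum>k\<in>UNIV. w $ k * (A $ i $ j * det (repl_row i (axis k 1) A)))"
    by (subst det_repl_row_expand) (simp add: sum_distrib_left sum_distrib_right mult_ac)
  also have "\<dots> = (\<Sum>k\<in>UNIV. w $ k * (\<Sum>i\<in>UNIV. A $ i $ j * det (repl_row i (axis k 1) A)))"
    by (subst sum.swap) (simp add: sum_distrib_left)
  also have "\<dots> = det A * w $ j" unfolding col by (simp add: if_distrib mult.commute cong: if_cong)
  finally show ?thesis by simp
qed

text \<open>Cramer's rule writes \<open>Q s\<close> through the rows \<open>P i s\<close>; the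
  result is paired with \<open>v\<close>. Keeping \<open>s\<close> and \<open>v\<close> independent
  permits the substitution \<open>s = x + t y\<close>, \<open>v = x - t y\<close> later.\<close>

lemma cramer_bform:
  assumes "\<And>i. transpose (P i) = P i" "transpose Q = Q"
  shows "det (Nmat P s) * bform Q s v = (\<Sum>i\<in>UNIV. det (Nmat (P(i := Q)) s) * bform (P i) s v)"
proof -
  have r: "repl_row i (Q *v s) (Nmat P s) = Nmat (P(i := Q)) s" for i
    by (simp add: repl_row_def Nmat_def vec_eq_iff)
  have b: "bform R s v = (\<Sum>j\<in>UNIV. v $ j * (R *v s) $ j)" if "transpose R = R" for R
    using bform_commute[OF that, of s v] by (simp add: bform_def)
  have "det (Nmat P s) * bform Q s v = (\<Sum>j\<in>UNIV. v $ j * (det (Nmat P s) * (Q *v s) $ j))"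
    unfolding b[OF assms(2)] by (simp add: sum_distrib_left mult_ac)
  also have "\<dots> = (\<Sum>j\<in>UNIV. v $ j * (\<Sum>i\<in>UNIV. det (Nmat (P(i := Q)) s) * (P i *v s) $ j))"
  proof -
    have "det (Nmat P s) * (Q *v s) $ j = (\<Sum>i\<in>UNIV. det (Nmat (P(i := Q)) s) * (P i *v s) $ j)" for j
      using det_smult_vector[of "Nmat P s" "Q *v s" j] by (simp only: r) (simp add: Nmat_def)
    then show ?thesis by simp
  qed
  also have "\<dots> = (\<Sum>i\<in>UNIV. det (Nmat (P(i := Q)) s) * bform (P i) s v)"
    unfolding b[OF assms(1)] sum_distrib_left by (subst sum.swap) (simp add: mult_ac)
  finally show ?thesis .
qed

section \<open>Quadratic functions and polarisation of quartics\<close>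

definition quadratic :: "(complex^'n \<Rightarrow> complex) \<Rightarrow> bool" where
  "quadratic g \<longleftrightarrow> (\<exists>G. g = qform G)"

lemma qform_sum_def: "qform G z = (\<Sum>i\<in>UNIV. \<Sum>j\<in>UNIV. G $ i $ j * z $ i * z $ j)"
  by (simp add: qform_def bform_sum_def)

lemma quadratic_qform [simp]: "quadratic (qform G)" by (auto simp: quadratic_def)

lemma quadratic_add: "quadratic f \<Longrightarrow> quadratic g \<Longrightarrow> quadratic (\<lambda>z. f z + g z)"
proof -
  assume "quadratic f" "quadratic g"
  then obtain F G where "f = qform F" "g = qform G" by (auto simp: quadratic_def)
  then have "(\<lambda>z. f z + g z) = qform (F + G)"
    by (simp add: fun_eq_iff qform_sum_def sum.distrib distrib_right)
  then show ?thesis by (auto simp: quadratic_def)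
qed

lemma quadratic_cmult: "quadratic f \<Longrightarrow> quadratic (\<lambda>z. c * f z)"
proof -
  assume "quadratic f"
  then obtain F where "f = qform F" by (auto simp: quadratic_def)
  then have "(\<lambda>z. c * f z) = qform (\<chi> i j. c * F $ i $ j)"
    by (simp add: fun_eq_iff qform_sum_def sum_distrib_left mult.assoc)
  then show ?thesis by (auto simp: quadratic_def)
qed

lemma quadratic_zero: "quadratic (\<lambda>z. 0)"
  using quadratic_cmult[OF quadratic_qform, of 0] by simp

lemma quadratic_sum: "(\<And>i. i \<in> I \<Longrightarrow> quadratic (f i)) \<Longrightarrow> quadratic (\<lambda>z. \<Sum>i\<in>I. f i z)"
  by (induction I rule: infinite_finite_induct) (auto intro: quadratic_zero quadratic_add)

lemma quadratic_linear_mult: "quadratic (\<lambda>z. c * ((A *v z) $ a * (B *v z) $ b))"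
proof (rule quadratic_cmult)
  have "(\<lambda>z. (A *v z) $ a * (B *v z) $ b) = qform (\<chi> i j. A $ a $ i * B $ b $ j)"
    by (simp add: fun_eq_iff qform_sum_def matrix_vector_mult_def sum_product mult_ac)
  then show "quadratic (\<lambda>z. (A *v z) $ a * (B *v z) $ b)" by (auto simp: quadratic_def)
qed

text \<open>\<open>D\<close> is the part of bidegree \<open>(2, 2)\<close> of
  \<open>F (x + t y)\<close>. Being quadratic in each variable, it may be multiplied by a quadric of
  the system and the product is then killed by the functional.\<close>

definition polar :: "(complex^'n \<Rightarrow> complex) \<Rightarrow> (complex^'n \<Rightarrow> complex^'n \<Rightarrow> complex) \<Rightarrow> bool" where
  "polar F D \<longleftrightarrow> (\<exists>D1 D3. \<forall>x y t. F (x + t *s y) = F x + t * D1 x y + t^2 * D x y + t^3 * D3 x y + t^4 * F y)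
     \<and> (\<forall>x. quadratic (D x)) \<and> (\<forall>y. quadratic (\<lambda>x. D x y))"

lemma polar_cmult: "polar F D \<Longrightarrow> polar (\<lambda>z. c * F z) (\<lambda>x y. c * D x y)"
  unfolding polar_def
  apply (elim conjE exE)
  subgoal for D1 D3
    by (intro conjI exI[of _ "\<lambda>x y. c * D1 x y"] exI[of _ "\<lambda>x y. c * D3 x y"])
       (auto intro: quadratic_cmult simp: algebra_simps)
  done

lemma polar_add: "polar F D \<Longrightarrow> polar F' D' \<Longrightarrow> polar (\<lambda>z. F z + F' z) (\<lambda>x y. D x y + D' x y)"
  unfolding polar_def
  apply (elim conjE exE)
  subgoal for D1 D1' D3 D3'
    by (intro conjI exI[of _ "\<lambda>x y. D1 x y + D1' x y"] exI[of _ "\<lambda>x y. D3 x y + D3' x y"])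
       (auto intro: quadratic_add simp: algebra_simps)
  done

lemma polar_sum: "finite I \<Longrightarrow> (\<And>i. i \<in> I \<Longrightarrow> \<exists>D. polar (F i) D) \<Longrightarrow> \<exists>D. polar (\<lambda>z. \<Sum>i\<in>I. F i z) D"
proof (induction I rule: finite_induct)
  case empty
  have "polar (\<lambda>z. 0) (\<lambda>x y. 0 :: complex)"
    unfolding polar_def by (auto intro!: quadratic_zero exI[of _ "\<lambda>x y. 0"])
  then show ?case by auto
next
  case (insert i I)
  obtain D where "polar (F i) D" using insert.prems by auto
  moreover obtain D' where "polar (\<lambda>z. \<Sum>i\<in>I. F i z) D'" using insert by auto
  ultimately have "polar (F i) D" "polar (\<lambda>z. \<Sum>i\<in>I. F i z) D'" .
  from polar_add[OF this] show ?case using insert by auto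
qed

lemma polar_prod4:
  fixes A B C E :: "complex^'n^'n"
  shows "\<exists>D. polar (\<lambda>z. (A *v z) $ a * (B *v z) $ b * (C *v z) $ c * (E *v z) $ e) D"
proof -
  define f g h k where "f z = (A *v z) $ a" "g z = (B *v z) $ b" "h z = (C *v z) $ c" "k z = (E *v z) $ e" for z
  have lin: "f (x + t *s y) = f x + t * f y" "g (x + t *s y) = g x + t * g y"
    "h (x + t *s y) = h x + t * h y" "k (x + t *s y) = k x + t * k y" for x y t
    by (simp_all add: f_g_h_k_def matrix_vector_right_distrib vector_scalar_commute)
  \<comment> \<open>The six ways to evaluate two of the four linear factors at
    \<open>y\<close>.\<close>
  define D where "D x y = f x * g x * (h y * k y) + f x * h x * (g y * k y) + f x * k x * (g y * h y)
     + g x * h x * (f y * k y) + g x * k x * (f y * h y) + h x * k x * (f y * g y)" for x y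
  have "polar (\<lambda>z. f z * g z * h z * k z) D"
    unfolding polar_def
  proof (intro conjI allI exI)
    fix x y t
    show "f (x + t *s y) * g (x + t *s y) * h (x + t *s y) * k (x + t *s y) =
      f x * g x * h x * k x + t * (f y * g x * h x * k x + f x * g y * h x * k x + f x * g x * h y * k x + f x * g x * h x * k y)
       + t\<^sup>2 * D x y + t ^ 3 * (f x * g y * h y * k y + f y * g x * h y * k y + f y * g y * h x * k y + f y * g y * h y * k x) + t ^ 4 * (f y * g y * h y * k y)"
      unfolding lin D_def by algebra
  next
    fix x show "quadratic (D x)"
      unfolding D_def[abs_def] f_g_h_k_def by (intro quadratic_add quadratic_linear_mult)
  next
    fix y have "D x y = (h y * k y) * (f x * g x) + (g y * k y) * (f x * h x) + (g y * h y) * (f x * k x)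
     + (f y * k y) * (g x * h x) + (f y * h y) * (g x * k x) + (f y * g y) * (h x * k x)" for x
      by (simp add: D_def mult_ac)
    then show "quadratic (\<lambda>x. D x y)"
      unfolding f_g_h_k_def by (simp only: quadratic_add quadratic_linear_mult)
  qed
  then show ?thesis unfolding f_g_h_k_def by auto
qed

lemma polar_det:
  fixes P :: "4 \<Rightarrow> complex^4^4"
  shows "\<exists>D. polar (\<lambda>z. det (Nmat P z)) D"
  unfolding det_def
proof (rule polar_sum)
  show "finite {p. p permutes (UNIV :: 4 set)}" by (rule finite_permutations) (rule finite)
next
  fix p :: "4 \<Rightarrow> 4"
  have "(\<Prod>i\<in>UNIV. Nmat P z $ i $ p i) = (P 1 *v z) $ p 1 * (P 2 *v z) $ p 2 * (P 3 *v z) $ p 3 * (P 4 *v z) $ p 4" for z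
    unfolding UNIV_4 by (simp add: Nmat_def mult.assoc)
  then show "\<exists>D. polar (\<lambda>z. of_int (sign p) * (\<Prod>i\<in>UNIV. Nmat P z $ i $ p i)) D"
    using polar_prod4[of "P 1" "p 1" "P 2" "p 2" "P 3" "p 3" "P 4" "p 4"] by (auto intro: polar_cmult)
qed

text \<open>
  The coefficients of \<open>t\<^sup>4\<close> and \<open>t\<^sup>2\<close> in Cramer's rule at \<open>s = x + t y\<close>, \<open>v = x - t y\<close>.
\<close>

lemma bezout_coefficients:
  fixes P :: "4 \<Rightarrow> complex^4^4"
  assumes sym: "\<And>i. transpose (P i) = P i" "transpose Q = Q"
    and D: "polar (\<lambda>z. det (Nmat P z)) D"
    and E: "\<And>i. polar (\<lambda>z. det (Nmat (P(i := Q)) z)) (E i)"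
  shows "det (Nmat P y) * qform Q x - D x y * qform Q y
      = (\<Sum>i\<in>UNIV. det (Nmat (P(i := Q)) y) * qform (P i) x - E i x y * qform (P i) y)"
    and "D x y * qform Q x - det (Nmat P x) * qform Q y
      = (\<Sum>i\<in>UNIV. E i x y * qform (P i) x - det (Nmat (P(i := Q)) x) * qform (P i) y)"
proof -
  obtain D1 D3 where d: "\<And>x y t. det (Nmat P (x + t *s y)) = det (Nmat P x) + t * D1 x y + t^2 * D x y + t^3 * D3 x y + t^4 * det (Nmat P y)"
    using D unfolding polar_def by blast
  have "\<forall>i. \<exists>E1 E3. \<forall>x y t. det (Nmat (P(i := Q)) (x + t *s y)) = det (Nmat (P(i := Q)) x) + t * E1 x y + t^2 * E i x y + t^3 * E3 x y + t^4 * det (Nmat (P(i := Q)) y)"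
    using E unfolding polar_def by blast
  then obtain E1 E3 where e: "\<And>i x y t. det (Nmat (P(i := Q)) (x + t *s y)) = det (Nmat (P(i := Q)) x) + t * E1 i x y + t^2 * E i x y + t^3 * E3 i x y + t^4 * det (Nmat (P(i := Q)) y)"
    by metis
  \<comment> \<open>By symmetry the mixed terms cancel, so this factor has only two coefficients and
    each compared coefficient of the product has two terms.\<close>
  have b: "bform R (x + t *s y) (x + (-t) *s y) = qform R x - t^2 * qform R y" if "transpose R = R" for R t
    using bform_commute[OF that, of x y] unfolding qform_def bform_add_left bform_add_right bform_smult_left bform_smult_right
    by (simp add: power2_eq_square algebra_simps)
  define p where "p = [:det (Nmat P x), D1 x y, D x y, D3 x y, det (Nmat P y):] * [:qform Q x, 0, - qform Q y:]"
  define r where "r = (\<Sum>i\<in>UNIV. [:det (Nmat (P(i := Q)) x), E1 i x y, E i x y, E3 i x y, det (Nmat (P(i := Q)) y):] * [:qform (P i) x, 0, - qform (P i) y:])"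
  have "poly p t = poly r t" for t
  proof -
    have "poly p t = det (Nmat P (x + t *s y)) * bform Q (x + t *s y) (x + (-t) *s y)"
      unfolding p_def d b[OF sym(2)] by (simp add: algebra_simps power2_eq_square power3_eq_cube power4_eq_xxxx)
    also have "\<dots> = (\<Sum>i\<in>UNIV. det (Nmat (P(i := Q)) (x + t *s y)) * bform (P i) (x + t *s y) (x + (-t) *s y))"
      by (rule cramer_bform[OF sym])
    also have "\<dots> = poly r t"
      unfolding r_def e b[OF sym(1)] poly_sum by (simp add: algebra_simps power2_eq_square power3_eq_cube power4_eq_xxxx)
    finally show ?thesis .
  qed
  then have pr: "p = r" by (simp add: poly_eq_poly_eq_iff[symmetric] fun_eq_iff)
  have n4: "(4::nat) = Suc (Suc (Suc (Suc 0)))" by simp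
  have n2: "(2::nat) = Suc (Suc 0)" by simp
  have c4: "coeff ([:a, b, c, d, e:] * [:f, 0, - g:]) 4 = e * f - c * g" for a b c d e f g :: complex
    unfolding n4 by simp
  have c2: "coeff ([:a, b, c, d, e:] * [:f, 0, - g:]) 2 = c * f - a * g" for a b c d e f g :: complex
    unfolding n2 by simp
  have "coeff p 4 = coeff r 4" "coeff p 2 = coeff r 2" using pr by auto
  then show "det (Nmat P y) * qform Q x - D x y * qform Q y
      = (\<Sum>i\<in>UNIV. det (Nmat (P(i := Q)) y) * qform (P i) x - E i x y * qform (P i) y)"
    and "D x y * qform Q x - det (Nmat P x) * qform Q y
      = (\<Sum>i\<in>UNIV. E i x y * qform (P i) x - det (Nmat (P(i := Q)) x) * qform (P i) y)"
    unfolding p_def r_def coeff_sum c4 c2 by auto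
qed

text \<open>
  Apply \<open>L\<close> in the variable \<open>y\<close> to the two identities above. The first gives
  \<open>L \<delta> Q = \<Sum> L \<kappa>\<^sub>i P\<^sub>i\<close>, which settles the case \<open>L \<delta> \<noteq> 0\<close>. Both together, with \<open>h = A B\<close>, give
  \<open>L \<delta> h - L h \<delta> = \<Sum> P\<^sub>i g\<^sub>i\<close>, so \<open>L \<delta> = 0\<close> would put \<open>\<delta>\<close> into the ideal.
\<close>

theorem complete_intersection_duality:
  fixes P :: "4 \<Rightarrow> complex^4^4" and c :: "'k \<Rightarrow> complex" and xs :: "'k \<Rightarrow> complex^4" and K :: "'k set"
  defines "L \<equiv> \<lambda>F. \<Sum>k\<in>K. c k * F (xs k)"
  assumes sym: "\<And>i. transpose (P i) = P i" "transpose Q = Q"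
    and bpf: "\<And>z. (\<forall>i. qform (P i) z = 0) \<Longrightarrow> z = 0"
    and kill: "\<And>i G. L (\<lambda>y. qform (P i) y * qform G y) = 0" "\<And>G. L (\<lambda>y. qform Q y * qform G y) = 0"
    and nz: "transpose A = A" "transpose B = B" "L (\<lambda>y. qform A y * qform B y) \<noteq> 0"
  shows "\<exists>a. \<forall>x. qform Q x = (\<Sum>i\<in>UNIV. a i * qform (P i) x)"
proof -
  have Ladd: "L (\<lambda>y. F y + G y) = L F + L G" for F G
    unfolding L_def by (simp add: distrib_left sum.distrib)
  have Ldiff: "L (\<lambda>y. F y - G y) = L F - L G" for F G
    unfolding L_def by (simp add: right_diff_distrib sum_subtractf)
  have Lcm: "L (\<lambda>y. a * F y) = a * L F" for F a
    unfolding L_def sum_distrib_left by (intro sum.cong refl) (simp only: mult_ac)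
  have Lmc: "L (\<lambda>y. F y * a) = L F * a" for F a
    unfolding L_def sum_distrib_right by (intro sum.cong refl) (simp only: mult_ac)
  have Lsum: "L (\<lambda>y. \<Sum>i\<in>UNIV. F i y) = (\<Sum>i\<in>UNIV. L (F i))" for F :: "4 \<Rightarrow> _"
    unfolding L_def sum_distrib_left by (rule sum.swap)
  have kill1: "L (\<lambda>y. g y * qform (P i) y) = 0" if "quadratic g" for i g
    using that kill(1)[of i] by (auto simp: quadratic_def mult.commute)
  have kill2: "L (\<lambda>y. g y * qform Q y) = 0" if "quadratic g" for g
    using that kill(2) by (auto simp: quadratic_def mult.commute)
  obtain D where D: "polar (\<lambda>z. det (Nmat P z)) D" using polar_det by blast
  have Ex: "\<exists>E. \<forall>i. polar (\<lambda>z. det (Nmat (P(i := R)) z)) (E i)" for R by (intro choice allI polar_det)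
  have quadL: "quadratic (\<lambda>x. L (\<lambda>y. f y * g x y))" if "\<And>y. quadratic (\<lambda>x. g x y)" for f g
    unfolding L_def by (intro quadratic_sum quadratic_cmult that)
  have Dq: "quadratic (D x)" for x using D by (simp add: polar_def)
  have first: "L (\<lambda>y. det (Nmat P y)) * qform Q x = (\<Sum>i\<in>UNIV. L (\<lambda>y. det (Nmat (P(i := Q)) y)) * qform (P i) x)" for x
  proof -
    obtain E where E: "\<And>i. polar (\<lambda>z. det (Nmat (P(i := Q)) z)) (E i)" using Ex by blast
    have Eq: "quadratic (E i x)" for i using E[of i] by (simp add: polar_def)
    have "L (\<lambda>y. det (Nmat P y) * qform Q x - D x y * qform Q y)
      = L (\<lambda>y. \<Sum>i\<in>UNIV. det (Nmat (P(i := Q)) y) * qform (P i) x - E i x y * qform (P i) y)"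
      using bezout_coefficients(1)[OF sym D E] by simp
    then show ?thesis unfolding Lsum Ldiff Lmc kill2[OF Dq] kill1[OF Eq] by simp
  qed
  show ?thesis
  proof (cases "L (\<lambda>y. det (Nmat P y)) = 0")
    case False
    then have "qform Q x = (\<Sum>i\<in>UNIV. (L (\<lambda>y. det (Nmat (P(i := Q)) y)) / L (\<lambda>y. det (Nmat P y))) * qform (P i) x)" for x
      using first[of x] by (simp add: field_simps sum_divide_distrib[symmetric])
    then show ?thesis by (intro exI allI)
  next
    case True
    obtain E where E: "\<And>i. polar (\<lambda>z. det (Nmat (P(i := A)) z)) (E i)" using Ex by blast
    obtain F where F: "\<And>i. polar (\<lambda>z. det (Nmat (P(i := B)) z)) (F i)" using Ex by blast
    have Eq: "quadratic (E i x)" for i x using E[of i] by (simp add: polar_def)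
    have Fq: "quadratic (\<lambda>x. F i x y)" for i y using F[of i] by (simp add: polar_def)
    define h where "h y = qform A y * qform B y" for y
    define g where "g i x = qform B x * L (\<lambda>y. det (Nmat (P(i := A)) y)) + L (\<lambda>y. qform A y * F i x y)" for i x
    have gq: "quadratic (g i)" for i
    proof -
      have "quadratic (\<lambda>x. L (\<lambda>y. det (Nmat (P(i := A)) y)) * qform B x + L (\<lambda>y. qform A y * F i x y))"
        by (intro quadratic_add quadratic_cmult quadratic_qform quadL Fq)
      then show ?thesis by (simp add: g_def[abs_def] mult.commute)
    qed
    have main: "det (Nmat P x) * L h = - (\<Sum>i\<in>UNIV. qform (P i) x * g i x)" for x
    proof -
      \<comment> \<open>The first identity for \<open>A\<close> is multiplied by \<open>B x\<close>,
        the second for \<open>B\<close> by \<open>A y\<close>; the terms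
        \<open>D x y * A y * B x\<close> cancel between them.\<close>
      have "det (Nmat P y) * h x - det (Nmat P x) * h y =
        qform B x * (\<Sum>i\<in>UNIV. det (Nmat (P(i := A)) y) * qform (P i) x - E i x y * qform (P i) y)
        + qform A y * (\<Sum>i\<in>UNIV. F i x y * qform (P i) x - det (Nmat (P(i := B)) x) * qform (P i) y)" for y
        unfolding bezout_coefficients(1)[OF sym(1) nz(1) D E, symmetric]
          bezout_coefficients(2)[OF sym(1) nz(2) D F, symmetric] h_def
        by (simp add: algebra_simps)
      then have "L (\<lambda>y. det (Nmat P y) * h x - det (Nmat P x) * h y) =
        L (\<lambda>y. qform B x * (\<Sum>i\<in>UNIV. det (Nmat (P(i := A)) y) * qform (P i) x - E i x y * qform (P i) y)
        + (\<Sum>i\<in>UNIV. (qform A y * F i x y) * qform (P i) x - det (Nmat (P(i := B)) x) * (qform A y * qform (P i) y)))"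
        by (simp add: sum_distrib_left right_diff_distrib mult_ac)
      then have "L (\<lambda>y. det (Nmat P y)) * h x - det (Nmat P x) * L h =
         qform B x * (\<Sum>i\<in>UNIV. L (\<lambda>y. det (Nmat (P(i := A)) y)) * qform (P i) x) + (\<Sum>i\<in>UNIV. L (\<lambda>y. qform A y * F i x y) * qform (P i) x)"
        unfolding Ladd Lcm Lsum Ldiff Lmc kill1[OF Eq] kill1[OF quadratic_qform] by simp
      also have "\<dots> = (\<Sum>i\<in>UNIV. qform (P i) x * g i x)"
        unfolding g_def by (simp add: sum_distrib_left sum.distrib distrib_left mult_ac)
      finally have "- (det (Nmat P x) * L h) = (\<Sum>i\<in>UNIV. qform (P i) x * g i x)" unfolding True by simp
      then show ?thesis by (metis minus_minus)
    qed
    have "\<forall>i. \<exists>G. g i = qform G" using gq by (simp add: quadratic_def)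
    then obtain G where G: "\<And>i. g i = qform (G i)" by metis
    have Lh: "L h \<noteq> 0" using nz(3) by (simp add: h_def[abs_def])
    define G' where "G' i = (\<chi> a b. - (1 / L h) * G i $ a $ b)" for i
    have G': "qform (G' i) x = - (1 / L h) * qform (G i) x" for i x
      unfolding qform_sum_def G'_def sum_distrib_left by (simp add: mult.assoc)
    have "det (Nmat P x) = (\<Sum>i\<in>UNIV. qform (P i) x * qform (G' i) x)" for x
    proof -
      have "det (Nmat P x) = - (1 / L h) * (\<Sum>i\<in>UNIV. qform (P i) x * qform (G i) x)"
        using main[of x] Lh by (simp add: G field_simps)
      then show ?thesis unfolding G' sum_distrib_left by (simp add: mult_ac)
    qed
    then have False using det_notin_ideal[of P G'] sym(1) bpf by metis
    then show ?thesis ..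
  qed
qed

section \<open>Five independent quadrics\<close>

definition cmat :: "real^'n^'m \<Rightarrow> complex^'n^'m" where
  "cmat A = (\<chi> i j. complex_of_real (A $ i $ j))"

definition cvec :: "real^'n \<Rightarrow> complex^'n" where
  "cvec x = (\<chi> i. complex_of_real (x $ i))"

lemma qform_cmat_cvec: "qform (cmat A) (cvec x) = complex_of_real (qform A x)"
  by (simp add: qform_def bform_sum_def cmat_def cvec_def)

lemma transpose_cmat: "transpose A = A \<Longrightarrow> transpose (cmat A) = cmat A"
  by (simp add: cmat_def transpose_def vec_eq_iff)

lemma qform_eq_0_symmetric:
  fixes A :: "real^'n^'n"
  assumes sym: "transpose A = A" and z: "\<And>x. qform A x = 0"
  shows "A = 0"
proof -
  have "bform A x y = 0" for x y
    using qform_add[OF sym, of x y] by (simp add: z)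
  then have "bform A (axis i 1) (axis j 1) = 0" for i j by blast
  moreover have "bform A (axis i 1) (axis j 1) = A $ i $ j" for i j
  proof -
    have "bform A (axis i 1) (axis j 1) = (\<Sum>k\<in>UNIV. (if k = i then (A *v axis j 1) $ k else 0))"
      unfolding bform_def by (intro sum.cong refl) (simp add: axis_def)
    then show ?thesis by (simp only: sum.delta finite) (simp add: matrix_vector_mult_axis)
  qed
  ultimately show ?thesis by (simp add: vec_eq_iff)
qed

lemma qform_sum_matrix:
  fixes P :: "'i::finite \<Rightarrow> 'a::comm_ring_1^'n^'n"
  shows "qform (\<chi> r c. \<Sum>j\<in>UNIV. b j * P j $ r $ c) z = (\<Sum>j\<in>UNIV. b j * qform (P j) z)"
proof -
  have "qform (\<chi> r c. \<Sum>j\<in>UNIV. b j * P j $ r $ c) z = (\<Sum>r\<in>UNIV. \<Sum>c\<in>UNIV. \<Sum>j\<in>UNIV. b j * (P j $ r $ c * z $ r * z $ c))"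
    by (simp add: qform_def bform_sum_def sum_distrib_right mult.assoc)
  also have "\<dots> = (\<Sum>r\<in>UNIV. \<Sum>j\<in>UNIV. \<Sum>c\<in>UNIV. b j * (P j $ r $ c * z $ r * z $ c))"
    by (intro sum.cong refl sum.swap)
  also have "\<dots> = (\<Sum>j\<in>UNIV. \<Sum>r\<in>UNIV. \<Sum>c\<in>UNIV. b j * (P j $ r $ c * z $ r * z $ c))"
    by (rule sum.swap)
  finally show ?thesis by (simp add: qform_def bform_sum_def sum_distrib_left)
qed

text \<open>Evaluation at real points separates the real and imaginary parts of the coefficients,
  and each part is a real relation.\<close>

lemma independent_over_complex:
  fixes P :: "'i::finite \<Rightarrow> real^'n^'n"
  assumes sym: "\<And>i. transpose (P i) = P i"
    and indep: "\<And>a. (\<Sum>i\<in>UNIV. a i *\<^sub>R P i) = 0 \<Longrightarrow> \<forall>i. a i = 0"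
    and zero: "\<And>x. (\<Sum>i\<in>UNIV. b i * qform (cmat (P i)) x) = 0"
  shows "b i = 0"
proof -
  have real: "a = (\<lambda>_. 0)" if "\<And>x. (\<Sum>i\<in>UNIV. a i * qform (P i) x) = 0" for a
  proof -
    let ?M = "\<chi> r c. \<Sum>j\<in>UNIV. a j * P j $ r $ c"
    have "P j $ s $ r = P j $ r $ s" for j r s using arg_cong[OF sym[of j], of "\<lambda>A. A $ r $ s"] by (simp add: transpose_def)
    then have "transpose ?M = ?M" by (simp add: transpose_def vec_eq_iff)
    then have "?M = 0"
    proof (rule qform_eq_0_symmetric)
      show "qform ?M x = 0" for x unfolding qform_sum_matrix by (rule that)
    qed
    moreover have "?M = (\<Sum>i\<in>UNIV. a i *\<^sub>R P i)" by (simp add: vec_eq_iff)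
    ultimately show ?thesis using indep[of a] by auto
  qed
  have *: "(\<Sum>i\<in>UNIV. b i * complex_of_real (qform (P i) x)) = 0" for x
    using zero[of "cvec x"] by (simp add: qform_cmat_cvec)
  have "(\<Sum>i\<in>UNIV. Re (b i) * qform (P i) x) = 0" for x
    using arg_cong[OF *[of x], of Re] by simp
  moreover have "(\<Sum>i\<in>UNIV. Im (b i) * qform (P i) x) = 0" for x
    using arg_cong[OF *[of x], of Im] by simp
  ultimately have "(\<lambda>i. Re (b i)) = (\<lambda>_. 0)" "(\<lambda>i. Im (b i)) = (\<lambda>_. 0)" using real[of "\<lambda>i. Re (b i)"] real[of "\<lambda>i. Im (b i)"] by auto
  then show ?thesis by (auto simp: complex_eq_iff fun_eq_iff)
qed

text \<open>A differentiable image of an eight-dimensional real space is negligible in a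
  ten-dimensional one, and so is a hyperplane. The point \<open>l\<close> serves as the centre of a
  projection.\<close>

lemma exists_outside_image:
  fixes P :: "4 option \<Rightarrow> complex^4^4"
  obtains l :: "complex^(4 option)" where "l $ None \<noteq> 0" "\<And>z. (\<chi> i. qform (P i) z) \<noteq> l"
proof -
  define f :: "complex^4 \<Rightarrow> complex^(4 option)" where "f z = (\<chi> i. qform (P i) z)" for z
  have "f differentiable (at z)" for z
  proof -
    have "linear (axis i :: complex \<Rightarrow> complex^(4 option))" for i
      by (rule linearI) (auto simp: axis_def vec_eq_iff)
    then have bl: "bounded_linear (axis i :: complex \<Rightarrow> complex^(4 option))" for i
      by (simp add: linear_conv_bounded_linear)
    have "f = (\<lambda>z. \<Sum>i\<in>UNIV. axis i (qform (P i) z))"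
      by (simp add: fun_eq_iff f_def vec_eq_iff axis_def)
    moreover have "((\<lambda>z. \<Sum>i\<in>UNIV. axis i (qform (P i) z) :: complex^(4 option)) has_derivative
        (\<lambda>v. \<Sum>i\<in>UNIV. axis i (bform (P i) z v + bform (P i) v z))) (at z)"
      by (intro has_derivative_sum bounded_linear.has_derivative[OF bl] has_derivative_bform)
    ultimately show ?thesis by (auto intro: differentiableI)
  qed
  then have "f differentiable_on UNIV" by (simp add: differentiable_on_def)
  then have n1: "negligible (range f)"
    by (rule negligible_differentiable_image_lowdim[rotated]) simp
  have "negligible {l :: complex^(4 option). l \<bullet> axis None 1 = 0}"
    by (rule negligible_standard_hyperplane) (auto simp: Basis_vec_def Basis_complex_def)
  then have n2: "negligible {l :: complex^(4 option). l $ None = 0}"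
    by (rule negligible_subset) (auto simp: inner_axis)
  have "range f \<union> {l. l $ None = 0} \<noteq> UNIV"
    using negligible_Un[OF n1 n2] non_negligible_UNIV by metis
  then show ?thesis using that unfolding f_def by blast
qed

text \<open>
  Without common zero, a generic linear projection turns the five quadrics into four that still
  have none, and the duality then makes the fifth one dependent on them.
\<close>

theorem five_quadrics_common_zero:
  fixes P :: "4 option \<Rightarrow> real^4^4" and c :: "'k \<Rightarrow> real" and xs :: "'k \<Rightarrow> real^4" and K :: "'k set"
  defines "L \<equiv> \<lambda>F. \<Sum>k\<in>K. c k * F (xs k)"
  assumes sym: "\<And>i. transpose (P i) = P i"
    and indep: "\<And>a. (\<Sum>i\<in>UNIV. a i *\<^sub>R P i) = 0 \<Longrightarrow> \<forall>i. a i = 0"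
    and kill: "\<And>i G. L (\<lambda>y. qform (P i) y * qform G y) = 0"
    and nz: "transpose A = A" "transpose B = B" "L (\<lambda>y. qform A y * qform B y) \<noteq> 0"
  shows "\<exists>z. z \<noteq> 0 \<and> (\<forall>i. qform (cmat (P i)) z = 0)"
proof (rule ccontr)
  assume "\<not> ?thesis"
  then have bpf: "z = 0" if "\<forall>i. qform (cmat (P i)) z = 0" for z using that by blast
  obtain l :: "complex^(4 option)" where l: "l $ None \<noteq> 0" "\<And>z. (\<chi> i. qform (cmat (P i)) z) \<noteq> l"
    using exists_outside_image[of "\<lambda>i. cmat (P i)"] by blast
  \<comment> \<open>The forms \<open>U i\<close> are the coordinates of the projection from
    \<open>l\<close>: they vanish together at \<open>z\<close> only if the vector of values of the
    five quadrics is a multiple of \<open>l\<close>.\<close>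
  define m where "m i = l $ Some i / l $ None" for i
  define U where "U i = (\<chi> r s. cmat (P (Some i)) $ r $ s - m i * cmat (P None) $ r $ s)" for i
  have U: "qform (U i) z = qform (cmat (P (Some i))) z - m i * qform (cmat (P None)) z" for i z
    unfolding U_def qform_sum_def by (simp add: left_diff_distrib sum_subtractf sum_distrib_left mult.assoc)
  define Lc where "Lc F = (\<Sum>k\<in>K. complex_of_real (c k) * F (cvec (xs k)))" for F
  have Lc_kill: "Lc (\<lambda>y. qform (cmat (P i)) y * qform G y) = 0" for i G
  proof -
    define R I where "R = (\<chi> r s. Re (G $ r $ s))" and "I = (\<chi> r s. Im (G $ r $ s))"
    have "qform G (cvec x) = complex_of_real (qform R x) + \<i> * complex_of_real (qform I x)" for x
    proof -
      have "G $ r $ s * complex_of_real a * complex_of_real b = complex_of_real (R $ r $ s * a * b) + \<i> * complex_of_real (I $ r $ s * a * b)" for r s a b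
        by (simp add: R_def I_def complex_eq_iff)
      then show ?thesis by (simp add: qform_sum_def cvec_def sum.distrib sum_distrib_left)
    qed
    then have "Lc (\<lambda>y. qform (cmat (P i)) y * qform G y) =
      complex_of_real (L (\<lambda>y. qform (P i) y * qform R y)) + \<i> * complex_of_real (L (\<lambda>y. qform (P i) y * qform I y))"
      unfolding Lc_def L_def qform_cmat_cvec of_real_sum sum_distrib_left sum.distrib[symmetric]
      by (intro sum.cong refl) (simp add: algebra_simps)
    then show ?thesis by (simp add: kill)
  qed
  have "\<exists>a. \<forall>x. qform (cmat (P None)) x = (\<Sum>i\<in>UNIV. a i * qform (U i) x)"
  proof (rule complete_intersection_duality[where c = "\<lambda>k. complex_of_real (c k)" and xs = "\<lambda>k. cvec (xs k)" and K = K and A = "cmat A" and B = "cmat B"])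
    show "transpose (U i) = U i" for i
      using transpose_cmat[OF sym[of "Some i"]] transpose_cmat[OF sym[of None]]
      by (simp add: U_def transpose_def vec_eq_iff)
    show "z = 0" if "\<forall>i. qform (U i) z = 0" for z
    proof -
      define s where "s = qform (cmat (P None)) z / l $ None"
      have val: "qform (cmat (P i)) z = s * l $ i" for i
        using that l(1) by (cases i) (auto simp: U m_def s_def)
      show ?thesis
      proof (cases "s = 0")
        case True then show ?thesis using val bpf by simp
      next
        case False
        \<comment> \<open>The forms are quadratic, so dividing \<open>z\<close> by a square root of
          \<open>s\<close> divides their values by \<open>s\<close>, which would put
          \<open>l\<close> into the image.\<close>
        have "qform (cmat (P i)) ((1 / csqrt s) *s z) = l $ i" for i
          using False by (simp add: qform_smult val power_divide)
        then have "(\<chi> i. qform (cmat (P i)) ((1 / csqrt s) *s z)) = l" by (simp add: vec_eq_iff)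
        then show ?thesis using l(2) by blast
      qed
    qed
    show "(\<Sum>k\<in>K. complex_of_real (c k) * (qform (U i) (cvec (xs k)) * qform G (cvec (xs k)))) = 0" for i G
    proof -
      have "(\<Sum>k\<in>K. complex_of_real (c k) * (qform (U i) (cvec (xs k)) * qform G (cvec (xs k)))) =
        Lc (\<lambda>y. qform (cmat (P (Some i))) y * qform G y) - m i * Lc (\<lambda>y. qform (cmat (P None)) y * qform G y)"
        unfolding Lc_def U sum_distrib_left sum_subtractf[symmetric] by (intro sum.cong refl) (simp add: algebra_simps)
      then show ?thesis by (simp add: Lc_kill)
    qed
    show "(\<Sum>k\<in>K. complex_of_real (c k) * (qform (cmat (P None)) (cvec (xs k)) * qform G (cvec (xs k)))) = 0" for G
      using Lc_kill[of None G] by (simp add: Lc_def)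
    show "(\<Sum>k\<in>K. complex_of_real (c k) * (qform (cmat A) (cvec (xs k)) * qform (cmat B) (cvec (xs k)))) \<noteq> 0"
    proof -
      have "(\<Sum>k\<in>K. complex_of_real (c k) * (qform (cmat A) (cvec (xs k)) * qform (cmat B) (cvec (xs k)))) = complex_of_real (L (\<lambda>y. qform A y * qform B y))"
        by (simp add: L_def qform_cmat_cvec)
      then show ?thesis using nz(3) by simp
    qed
  qed (use transpose_cmat sym nz in auto)
  then obtain a where a: "\<And>x. qform (cmat (P None)) x = (\<Sum>i\<in>UNIV. a i * qform (U i) x)" by blast
  \<comment> \<open>The coefficients of \<open>P None - sum a i U i\<close> in the original five
    quadrics. The entries at \<open>Some i\<close> force \<open>a = 0\<close>, and then the entry at
    \<open>None\<close> is 1.\<close>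
  define b where "b = case_option (1 + (\<Sum>i\<in>UNIV. a i * m i)) (\<lambda>i. - a i)"
  have "(\<Sum>j\<in>UNIV. b j * qform (cmat (P j)) x) = 0" for x
  proof -
    have "(\<Sum>j\<in>UNIV. b j * qform (cmat (P j)) x) = b None * qform (cmat (P None)) x + (\<Sum>i\<in>UNIV. b (Some i) * qform (cmat (P (Some i))) x)"
      unfolding UNIV_option_conv by (subst sum.insert) (auto simp: sum.reindex)
    also have "\<dots> = qform (cmat (P None)) x - (\<Sum>i\<in>UNIV. a i * qform (U i) x)"
      by (simp add: b_def U distrib_right sum_distrib_right right_diff_distrib sum_subtractf sum_negf mult.assoc)
    finally show ?thesis using a by simp
  qed
  then have b0: "b i = 0" for i using independent_over_complex[of P b] sym indep by blast
  then have "a i = 0" for i using b0[of "Some i"] by (simp add: b_def)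
  then show False using b0[of None] by (simp add: b_def)
qed

section \<open>Quartic forms as vectors of coefficients\<close>

text \<open>
  The elements of the type \<^typ>\<open>4\<close> are \<open>1, 2, 3, 4\<close> with \<open>4 = 0\<close>, so the last one stands for the
  variable with index \<open>0\<close>.
\<close>

definition idx :: "4 \<Rightarrow> nat" where
  "idx k = (if k = 1 then 1 else if k = 2 then 2 else if k = 3 then 3 else 0)"

lemma idx_bij: "bij_betw idx UNIV {..<4}"
proof -
  have "inj idx" unfolding inj_def idx_def by (simp add: forall_4)
  moreover have "range idx = {..<4}"
    unfolding UNIV_4 by (auto simp: idx_def)
  ultimately show ?thesis by (simp add: bij_betw_def)
qed

lemma idx_inj: "idx i = idx j \<longleftrightarrow> i = j"
  using idx_bij by (auto simp: bij_betw_def dest: injD)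

definition quartic_monomials :: "(nat \<Rightarrow>\<^sub>0 nat) set" where
  "quartic_monomials = {m. Poly_Mapping.keys m \<subseteq> {..<4} \<and> (\<Sum>i<4. Poly_Mapping.lookup m i) = 4}"

definition qmono :: "4 \<Rightarrow> 4 \<Rightarrow> 4 \<Rightarrow> 4 \<Rightarrow> (nat \<Rightarrow>\<^sub>0 nat)" where
  "qmono i j k l = Poly_Mapping.single (idx i) 1 + Poly_Mapping.single (idx j) 1
     + Poly_Mapping.single (idx k) 1 + Poly_Mapping.single (idx l) 1"

lemma degree_induct_step:
  fixes m :: "nat \<Rightarrow>\<^sub>0 nat"
  assumes "Poly_Mapping.keys m \<subseteq> {..<4}" "(\<Sum>i<4. Poly_Mapping.lookup m i) = Suc d"
  obtains i m' where "m = m' + Poly_Mapping.single (idx i) 1"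
    "Poly_Mapping.keys m' \<subseteq> {..<4}" "(\<Sum>i<4. Poly_Mapping.lookup m' i) = d"
proof -
  obtain a where a: "a < 4" "Poly_Mapping.lookup m a \<noteq> 0"
    using assms(2) by (metis lessThan_iff nat.distinct(1) sum.not_neutral_contains_not_neutral)
  then obtain i where i: "a = idx i" using idx_bij by (metis bij_betw_imp_surj_on imageE lessThan_iff)
  define m' where "m' = m - Poly_Mapping.single a 1"
  have m: "m = m' + Poly_Mapping.single a 1"
    using a(2) by (intro poly_mapping_eqI) (auto simp: m'_def lookup_add lookup_minus lookup_single when_def)
  have "Poly_Mapping.keys m' \<subseteq> {..<4}"
  proof
    fix x assume "x \<in> Poly_Mapping.keys m'"
    then have "Poly_Mapping.lookup m x \<noteq> 0" by (auto simp: in_keys_iff m'_def lookup_minus)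
    then have "x \<in> Poly_Mapping.keys m" by (simp only: in_keys_iff not_False_eq_True)
    then show "x \<in> {..<4}" using assms(1) by blast
  qed
  moreover have "(\<Sum>i<4. Poly_Mapping.lookup m i) = (\<Sum>i<4. Poly_Mapping.lookup m' i) + 1"
    using a(1) by (subst m) (simp add: lookup_add sum.distrib lookup_single when_def)
  ultimately show ?thesis using that[of m' i] m i assms(2) by simp
qed

lemma quartic_monomials_eq: "quartic_monomials = (\<Union>i j k l. {qmono i j k l})"
proof
  show "quartic_monomials \<subseteq> (\<Union>i j k l. {qmono i j k l})"
  proof
    fix m assume "m \<in> quartic_monomials"
    then have m: "Poly_Mapping.keys m \<subseteq> {..<4}" "(\<Sum>i<4. Poly_Mapping.lookup m i) = Suc (Suc (Suc (Suc 0)))"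
      by (auto simp: quartic_monomials_def)
    obtain i m1 where 1: "m = m1 + Poly_Mapping.single (idx i) 1" "Poly_Mapping.keys m1 \<subseteq> {..<4}" "(\<Sum>i<4. Poly_Mapping.lookup m1 i) = Suc (Suc (Suc 0))"
      using degree_induct_step[OF m] by metis
    obtain j m2 where 2: "m1 = m2 + Poly_Mapping.single (idx j) 1" "Poly_Mapping.keys m2 \<subseteq> {..<4}" "(\<Sum>i<4. Poly_Mapping.lookup m2 i) = Suc (Suc 0)"
      using degree_induct_step[OF 1(2,3)] by metis
    obtain k m3 where 3: "m2 = m3 + Poly_Mapping.single (idx k) 1" "Poly_Mapping.keys m3 \<subseteq> {..<4}" "(\<Sum>i<4. Poly_Mapping.lookup m3 i) = Suc 0"
      using degree_induct_step[OF 2(2,3)] by metis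
    obtain l m4 where 4: "m3 = m4 + Poly_Mapping.single (idx l) 1" "Poly_Mapping.keys m4 \<subseteq> {..<4}" "(\<Sum>i<4. Poly_Mapping.lookup m4 i) = 0"
      using degree_induct_step[OF 3(2,3)] by metis
    have "m4 = 0" using 4(2,3) by (intro poly_mapping_eqI) (auto simp: in_keys_iff subset_iff)
    then have "m = qmono l k j i" using 1 2 3 4 by (simp add: qmono_def)
    then show "m \<in> (\<Union>i j k l. {qmono i j k l})" by blast
  qed
  have "qmono i j k l \<in> quartic_monomials" for i j k l
  proof -
    have lt: "idx i < 4" for i using idx_bij by (auto simp: bij_betw_def)
    then have "(\<Sum>a<4. if idx i = a then 1 else 0) = (1::nat)" for i by simp
    then have "(\<Sum>a<4. Poly_Mapping.lookup (qmono i j k l) a) = 4"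
      by (simp add: qmono_def lookup_add lookup_single when_def sum.distrib lt)
    moreover have "Poly_Mapping.keys (qmono i j k l) \<subseteq> {..<4}"
      using lt by (auto simp: qmono_def in_keys_iff lookup_add lookup_single when_def split: if_splits)
    ultimately show ?thesis by (simp add: quartic_monomials_def)
  qed
  then show "(\<Union>i j k l. {qmono i j k l}) \<subseteq> quartic_monomials" by blast
qed

text \<open>With the 35 quartic monomials as an index type, \<open>real^mon4\<close> is a Euclidean
  space, so that compactness, closest points and the Baire theorem apply to quartic forms
  directly.\<close>

typedef mon4 = quartic_monomials
  unfolding quartic_monomials_eq by blast

definition bm :: "4 \<Rightarrow> 4 \<Rightarrow> 4 \<Rightarrow> 4 \<Rightarrow> mon4" where
  "bm i j k l = Abs_mon4 (qmono i j k l)"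

lemma Rep_bm: "Rep_mon4 (bm i j k l) = qmono i j k l"
  unfolding bm_def by (rule Abs_mon4_inverse) (auto simp: quartic_monomials_eq)

lemma bm_cases: obtains i j k l where "m = bm i j k l"
proof -
  have "Rep_mon4 m \<in> quartic_monomials" by (rule Rep_mon4)
  then obtain i j k l where "Rep_mon4 m = qmono i j k l" by (auto simp: quartic_monomials_eq)
  then have "m = bm i j k l" unfolding bm_def using Rep_mon4_inverse[of m] by simp
  then show ?thesis using that by blast
qed

instance mon4 :: finite
proof
  have "finite quartic_monomials" unfolding quartic_monomials_eq by simp
  moreover have "inj Rep_mon4" "range Rep_mon4 = quartic_monomials"
    using type_definition.Rep_range[OF type_definition_mon4] Rep_mon4_inject by (auto simp: inj_def)
  ultimately show "finite (UNIV :: mon4 set)" by (metis finite_imageD)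
qed

section \<open>Products and values of quartic forms\<close>

definition mulq :: "real^4^4 \<Rightarrow> real^4^4 \<Rightarrow> real^mon4" where
  "mulq P Q = (\<Sum>i\<in>UNIV. \<Sum>j\<in>UNIV. \<Sum>k\<in>UNIV. \<Sum>l\<in>UNIV. (P $ i $ j * Q $ k $ l) *\<^sub>R axis (bm i j k l) 1)"

definition expo :: "mon4 \<Rightarrow> 4 \<Rightarrow> nat" where
  "expo m k = Poly_Mapping.lookup (Rep_mon4 m) (idx k)"

definition evq :: "real^mon4 \<Rightarrow> complex^4 \<Rightarrow> complex" where
  "evq f z = (\<Sum>m\<in>UNIV. of_real (f $ m) * (\<Prod>k\<in>UNIV. z $ k ^ expo m k))"

lemma expo_bm: "expo (bm i j k l) a = of_bool (a = i) + of_bool (a = j) + of_bool (a = k) + of_bool (a = l)"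
  by (simp add: expo_def Rep_bm qmono_def lookup_add lookup_single when_def idx_inj)

lemma monomial_bm: "(\<Prod>a\<in>UNIV. (z::'a::comm_ring_1^4) $ a ^ expo (bm i j k l) a) = z $ i * z $ j * z $ k * z $ l"
proof -
  have "(\<Prod>a\<in>UNIV. z $ a ^ of_bool (a = i)) = z $ i" for i
  proof -
    have "(\<Prod>a\<in>UNIV. z $ a ^ of_bool (a = i)) = (\<Prod>a\<in>UNIV. if a = i then z $ i else 1)"
      by (intro prod.cong) auto
    then show ?thesis by simp
  qed
  then show ?thesis unfolding expo_bm power_add prod.distrib by simp
qed

lemma evq_add: "evq (f + g) z = evq f z + evq g z"
  by (simp add: evq_def distrib_right sum.distrib)

lemma evq_scaleR: "evq (c *\<^sub>R f) z = of_real c * evq f z"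
  by (simp add: evq_def sum_distrib_left mult.assoc)

lemma evq_sum: "evq (\<Sum>i\<in>I. f i) z = (\<Sum>i\<in>I. evq (f i) z)"
  by (induction I rule: infinite_finite_induct) (simp_all add: evq_add, simp_all add: evq_def)

lemma evq_axis: "evq (axis m 1) z = (\<Prod>k\<in>UNIV. z $ k ^ expo m k)"
proof -
  have "evq (axis m 1) z = (\<Sum>n\<in>UNIV. if n = m then (\<Prod>k\<in>UNIV. z $ k ^ expo n k) else 0)"
    unfolding evq_def by (intro sum.cong) (auto simp: axis_def)
  then show ?thesis by simp
qed

lemma evq_mulq: "evq (mulq P Q) z = qform (cmat P) z * qform (cmat Q) z"
proof -
  have "evq (mulq P Q) z = (\<Sum>i\<in>UNIV. \<Sum>j\<in>UNIV. \<Sum>k\<in>UNIV. \<Sum>l\<in>UNIV. of_real (P $ i $ j * Q $ k $ l) * (z $ i * z $ j * z $ k * z $ l))"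
    unfolding mulq_def evq_sum evq_scaleR evq_axis monomial_bm ..
  also have "\<dots> = qform (cmat P) z * qform (cmat Q) z"
    unfolding qform_sum_def[of "cmat P"] sum_distrib_right
    unfolding qform_sum_def sum_distrib_left by (intro sum.cong refl) (simp add: cmat_def)
  finally show ?thesis .
qed

lemma mulq_bilinear: "mulq (P + P') Q = mulq P Q + mulq P' Q" "mulq P (Q + Q') = mulq P Q + mulq P Q'"
  "mulq (c *\<^sub>R P) Q = c *\<^sub>R mulq P Q" "mulq P (c *\<^sub>R Q) = c *\<^sub>R mulq P Q"
  by (simp_all add: mulq_def distrib_right distrib_left scaleR_left_distrib sum.distrib scaleR_sum_right mult_ac)

lemma bm_perm: "bm i j k l = bm k l i j" "bm i j k l = bm j i k l" "bm i j k l = bm i k j l"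
  by (simp_all add: bm_def qmono_def add_ac)

lemma mulq_commute: "mulq P Q = mulq Q P"
proof -
  have "mulq P Q = (\<Sum>i\<in>UNIV. \<Sum>k\<in>UNIV. \<Sum>j\<in>UNIV. \<Sum>l\<in>UNIV. (P $ i $ j * Q $ k $ l) *\<^sub>R axis (bm i j k l) 1)"
    unfolding mulq_def by (intro sum.cong refl sum.swap)
  also have "\<dots> = (\<Sum>k\<in>UNIV. \<Sum>i\<in>UNIV. \<Sum>j\<in>UNIV. \<Sum>l\<in>UNIV. (P $ i $ j * Q $ k $ l) *\<^sub>R axis (bm i j k l) 1)"
    by (rule sum.swap)
  also have "\<dots> = (\<Sum>k\<in>UNIV. \<Sum>i\<in>UNIV. \<Sum>l\<in>UNIV. \<Sum>j\<in>UNIV. (P $ i $ j * Q $ k $ l) *\<^sub>R axis (bm i j k l) 1)"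
    by (intro sum.cong refl sum.swap)
  also have "\<dots> = (\<Sum>k\<in>UNIV. \<Sum>l\<in>UNIV. \<Sum>i\<in>UNIV. \<Sum>j\<in>UNIV. (P $ i $ j * Q $ k $ l) *\<^sub>R axis (bm i j k l) 1)"
    by (intro sum.cong refl sum.swap)
  also have "\<dots> = mulq Q P" unfolding mulq_def
    by (intro sum.cong refl, subst bm_perm(1), simp add: mult.commute)
  finally show ?thesis .
qed

definition elem :: "4 \<Rightarrow> 4 \<Rightarrow> real^4^4" where "elem i j = axis i (axis j 1)"

lemma mulq_elem: "mulq (elem i j) (elem k l) = axis (bm i j k l) 1"
proof -
  have e: "elem i j $ a $ b = (if a = i then if b = j then 1 else 0 else 0)" for i j a b
    by (simp add: elem_def axis_def)
  have "(elem i j $ a $ b * elem k l $ c $ d) *\<^sub>R axis (bm a b c d) (1::real) =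
    (if d = l then if c = k then if b = j then if a = i then axis (bm a b c d) 1 else 0 else 0 else 0 else 0)" for a b c d
    by (simp add: e)
  then show ?thesis unfolding mulq_def by simp
qed

section \<open>Gradients and singular points\<close>

definition gradq :: "real^mon4 \<Rightarrow> complex^4 \<Rightarrow> complex^4" where
  "gradq f z = (\<chi> k. \<Sum>m\<in>UNIV. of_real (f $ m) * (of_nat (expo m k) * z $ k ^ (expo m k - 1) * (\<Prod>a\<in>UNIV - {k}. z $ a ^ expo m a)))"

lemma has_derivative_evq: "(evq f has_derivative (\<lambda>w. \<Sum>k\<in>UNIV. gradq f z $ k * w $ k)) (at z)"
proof -
  have p: "((\<lambda>z. z $ k ^ n) has_derivative (\<lambda>w. of_nat n * w $ k * z $ k ^ (n - 1))) (at z)" for k :: 4 and n and z :: "complex^4"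
    by (rule has_derivative_power[OF bounded_linear_imp_has_derivative[OF bounded_linear_vec_nth]])
  have "(evq f has_derivative (\<lambda>w. \<Sum>m\<in>UNIV. of_real (f $ m) * (\<Sum>k\<in>UNIV. of_nat (expo m k) * w $ k * z $ k ^ (expo m k - 1) * (\<Prod>a\<in>UNIV - {k}. z $ a ^ expo m a)))) (at z)"
    unfolding evq_def[abs_def] by (intro has_derivative_sum has_derivative_mult_right has_derivative_prod p)
  moreover have "(\<Sum>m\<in>UNIV. of_real (f $ m) * (\<Sum>k\<in>UNIV. of_nat (expo m k) * w $ k * z $ k ^ (expo m k - 1) * (\<Prod>a\<in>UNIV - {k}. z $ a ^ expo m a)))
    = (\<Sum>k\<in>UNIV. gradq f z $ k * w $ k)" for w
    unfolding gradq_def by (simp add: sum_distrib_left sum_distrib_right mult_ac) (rule sum.swap)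
  ultimately show ?thesis by simp
qed

text \<open>In this form the chain rule handles rescaling and Euler's identity without the explicit
  partial derivatives.\<close>

lemma gradq_eq_0_iff: "gradq f z = 0 \<longleftrightarrow> (evq f has_derivative (\<lambda>w. 0)) (at z)"
proof
  assume "(evq f has_derivative (\<lambda>w. 0)) (at z)"
  then have e: "(\<lambda>w. \<Sum>k\<in>UNIV. gradq f z $ k * w $ k) = (\<lambda>w. 0)"
    using has_derivative_evq has_derivative_unique by blast
  have "gradq f z $ a = 0" for a
  proof -
    have "(\<Sum>k\<in>UNIV. gradq f z $ k * axis a 1 $ k) = (\<Sum>k\<in>UNIV. if k = a then gradq f z $ k else 0)"
      by (intro sum.cong) (auto simp: axis_def)
    then show ?thesis using fun_cong[OF e, of "axis a 1"] by simp
  qed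
  then show "gradq f z = 0" by (simp add: vec_eq_iff)
qed (use has_derivative_evq[of f z] in simp)

lemma gradq_linear: "gradq (f + g) z = gradq f z + gradq g z" "gradq (c *\<^sub>R f) z = c *\<^sub>R gradq f z"
proof -
  have c: "c *\<^sub>R w = of_real c * w" for w :: complex by (rule scaleR_conv_of_real)
  show "gradq (f + g) z = gradq f z + gradq g z"
    by (simp add: gradq_def vec_eq_iff distrib_right sum.distrib)
  show "gradq (c *\<^sub>R f) z = c *\<^sub>R gradq f z"
    unfolding vec_eq_iff vector_scaleR_component c by (simp add: gradq_def sum_distrib_left mult.assoc)
qed

lemma linear_gradq: "linear (\<lambda>f. gradq f z)"
  by (rule linearI) (simp_all add: gradq_linear)

lemma gradq_mulq:
  "(\<Sum>k\<in>UNIV. gradq (mulq P Q) z $ k * w $ k) =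
    qform (cmat P) z * (bform (cmat Q) z w + bform (cmat Q) w z) + (bform (cmat P) z w + bform (cmat P) w z) * qform (cmat Q) z"
proof -
  have "(evq (mulq P Q) has_derivative (\<lambda>w. qform (cmat P) z * (bform (cmat Q) z w + bform (cmat Q) w z) + (bform (cmat P) z w + bform (cmat P) w z) * qform (cmat Q) z)) (at z)"
    unfolding evq_mulq[abs_def] by (intro has_derivative_mult has_derivative_bform)
  then show ?thesis using fun_cong[OF has_derivative_unique[OF has_derivative_evq]] by blast
qed

lemma differentiable_gradq: "gradq f differentiable (at z)"
proof -
  have "linear (axis i :: complex \<Rightarrow> complex^4)" for i
    by (rule linearI) (auto simp: axis_def vec_eq_iff)
  then have bl: "bounded_linear (axis i :: complex \<Rightarrow> complex^4)" for i
    by (simp add: linear_conv_bounded_linear)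
  have nth: "(\<lambda>z::complex^4. z $ k) differentiable (at z)" for k z
    using bounded_linear_imp_differentiable[OF bounded_linear_vec_nth] .
  have pr: "finite I \<Longrightarrow> (\<lambda>z::complex^4. \<Prod>a\<in>I. z $ a ^ g a) differentiable (at z)" for I g z
    by (induction I rule: finite_induct) (auto intro!: differentiable_mult differentiable_power nth)
  have c: "(\<lambda>z. gradq f z $ k) differentiable (at z)" for k
    unfolding gradq_def vec_lambda_beta
  proof (intro differentiable_sum ballI finite)
    fix m
    show "(\<lambda>z. of_real (f $ m) * (of_nat (expo m k) * z $ k ^ (expo m k - 1) * (\<Prod>a\<in>UNIV - {k}. z $ a ^ expo m a))) differentiable (at z)"
      by (rule differentiable_mult[OF differentiable_const differentiable_mult[OF differentiable_mult[OF differentiable_const differentiable_power[OF nth]] pr]]) simp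
  qed
  have "gradq f = (\<lambda>z. \<Sum>k\<in>UNIV. axis k (gradq f z $ k))"
    by (simp add: fun_eq_iff vec_eq_iff axis_def)
  moreover have "(\<lambda>z. \<Sum>k\<in>UNIV. axis k (gradq f z $ k)) differentiable (at z)"
  proof -
    have "\<forall>k. \<exists>D. ((\<lambda>z. gradq f z $ k) has_derivative D) (at z)"
      using c by (simp add: differentiable_def)
    then obtain D where D: "\<And>k. ((\<lambda>z. gradq f z $ k) has_derivative D k) (at z)" by metis
    have "((\<lambda>z. \<Sum>k\<in>UNIV. axis k (gradq f z $ k) :: complex^4) has_derivative (\<lambda>w. \<Sum>k\<in>UNIV. axis k (D k w))) (at z)"
      by (intro has_derivative_sum bounded_linear.has_derivative[OF bl] D)
    then show ?thesis by (rule differentiableI)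
  qed
  ultimately show ?thesis by simp
qed

lemma continuous_gradq2: "continuous_on UNIV (\<lambda>p. gradq (fst p) (snd p))"
  unfolding gradq_def by (intro continuous_on_vec_lambda continuous_intros)

lemma evq_homogeneous: "evq f (c *s z) = c ^ 4 * evq f z"
proof -
  have "(\<Prod>k\<in>UNIV. (c *s z) $ k ^ expo m k) = c ^ 4 * (\<Prod>k\<in>UNIV. z $ k ^ expo m k)" for m
    by (rule bm_cases[of m]) (simp only: monomial_bm, simp add: power4_eq_xxxx)
  then show ?thesis unfolding evq_def sum_distrib_left by (intro sum.cong refl) (simp only: mult.left_commute)
qed

lemma gradq_smult_eq_0:
  assumes "c \<noteq> 0" "gradq f z = 0"
  shows "gradq f (c *s z) = 0"
proof -
  have "evq f w = c ^ 4 * evq f ((1 / c) *s w)" for w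
    using assms(1) evq_homogeneous[of f c "(1 / c) *s w"] by simp
  then have "evq f = (\<lambda>w. c ^ 4 * evq f ((1 / c) *s w))" ..
  moreover have "bounded_linear (\<lambda>w::complex^4. (1 / c) *s w)"
    unfolding linear_conv_bounded_linear[symmetric] by (rule linearI) (simp_all add: vec_eq_iff algebra_simps)
  then have "((\<lambda>w. c ^ 4 * evq f ((1 / c) *s w)) has_derivative (\<lambda>w. c ^ 4 * 0)) (at (c *s z))"
  proof (intro has_derivative_mult_right)
    assume bl: "bounded_linear (\<lambda>w::complex^4. (1 / c) *s w)"
    have "(evq f has_derivative (\<lambda>w. 0)) (at ((1 / c) *s (c *s z)))"
      using assms by (simp add: gradq_eq_0_iff)
    from has_derivative_compose[OF bounded_linear_imp_has_derivative[OF bl] this]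
    show "((\<lambda>w. evq f ((1 / c) *s w)) has_derivative (\<lambda>w. 0)) (at (c *s z))" .
  qed
  ultimately show ?thesis unfolding gradq_eq_0_iff by simp
qed

text \<open>Euler's identity, obtained by differentiating \<open>t^4 f(z) = f(t z)\<close> at
  \<open>t = 1\<close>.\<close>

lemma euler_zero: "gradq f z = 0 \<Longrightarrow> evq f z = 0"
proof -
  assume g: "gradq f z = 0"
  have bl: "bounded_linear (\<lambda>t::complex. t *s z)"
    unfolding linear_conv_bounded_linear[symmetric] by (rule linearI) (simp_all add: vec_eq_iff algebra_simps)
  have "(evq f has_derivative (\<lambda>w. 0)) (at (1 *s z))" using g by (simp add: gradq_eq_0_iff)
  from has_derivative_compose[OF bounded_linear_imp_has_derivative[OF bl] this]
  have "((\<lambda>t. t ^ 4 * evq f z) has_derivative (\<lambda>t. 0)) (at 1)" by (simp add: evq_homogeneous)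
  moreover have "((\<lambda>t. t ^ 4 * evq f z) has_derivative (\<lambda>t. 4 * t * evq f z)) (at 1)"
    by (auto intro!: derivative_eq_intros)
  ultimately have "(\<lambda>t. 0) = (\<lambda>t. 4 * t * evq f z)" by (rule has_derivative_unique)
  then show ?thesis by (auto dest!: fun_cong[where x = 1])
qed

section \<open>Pencils without nonreal singular members\<close>

text \<open>Reality is meant in projective space: complex multiples of real vectors, and with them
  0, count as real.\<close>

definition nonreal :: "complex^'n \<Rightarrow> bool" where
  "nonreal z \<longleftrightarrow> \<not> (\<exists>c x. z = c *s cvec x)"

definition linf :: "real^'n \<Rightarrow> complex^'n \<Rightarrow> complex" where
  "linf u z = (\<Sum>i\<in>UNIV. of_real (u $ i) * z $ i)"

lemma linf_diff: "linf (u - v) z = linf u z - linf v z"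
  by (simp add: linf_def left_diff_distrib sum_subtractf)

lemma linf_scaleR: "linf (c *\<^sub>R u) z = of_real c * linf u z"
  by (simp add: linf_def sum_distrib_left mult.assoc)

lemma linf_axis: "linf (axis k 1) z = z $ k"
proof -
  have "linf (axis k 1) z = (\<Sum>i\<in>UNIV. if i = k then z $ i else 0)"
    unfolding linf_def by (intro sum.cong) (auto simp: axis_def)
  then show ?thesis by simp
qed

definition rank1 :: "real^'n \<Rightarrow> real^'n \<Rightarrow> real^'n^'n" where
  "rank1 u v = (\<chi> i j. u $ i * v $ j)"

lemma bform_rank1: "bform (cmat (rank1 u v)) z w = linf u z * linf v w"
  unfolding bform_sum_def linf_def sum_product
  by (intro sum.cong refl) (simp add: cmat_def rank1_def)

lemma linf_value: "linf u z = Complex (u \<bullet> (\<chi> i. Re (z $ i))) (u \<bullet> (\<chi> i. Im (z $ i)))"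
  by (simp add: linf_def complex_eq_iff inner_vec_def)

text \<open>The real and imaginary parts of \<open>z\<close> are linearly independent, for equality
  in Cauchy-Schwarz would make \<open>z\<close> a multiple of a real vector. Hence their Gram
  determinant \<open>d\<close> is nonzero, and \<open>A\<close>, \<open>B\<close> are the dual basis
  in their span.\<close>

lemma nonreal_dual_basis:
  assumes "nonreal z"
  obtains A B where "linf A z = 1" "linf B z = \<i>"
    "\<And>u. linf (u - Re (linf u z) *\<^sub>R A - Im (linf u z) *\<^sub>R B) z = 0"
proof -
  define x where "x = (\<chi> i. Re (z $ i))"
  define y where "y = (\<chi> i. Im (z $ i))"
  have z: "z = cvec x + \<i> *s cvec y"
    by (simp add: vec_eq_iff x_def y_def cvec_def complex_eq_iff)
  define d where "d = (x \<bullet> x) * (y \<bullet> y) - (x \<bullet> y)\<^sup>2"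
  have d: "d \<noteq> 0"
  proof
    assume "d = 0"
    then have "(x \<bullet> y)\<^sup>2 = (norm x * norm y)\<^sup>2"
      by (simp add: d_def power_mult_distrib power2_norm_eq_inner)
    then have "\<bar>x \<bullet> y\<bar> = norm x * norm y"
      by (metis abs_mult abs_norm_cancel power2_eq_iff_nonneg abs_ge_zero power2_abs)
    then have "collinear {0, x, y}" by (rule norm_cauchy_schwarz_equal[THEN iffD1])
    then consider "y = 0" | c where "x = c *\<^sub>R y"
      unfolding collinear_lemma by (metis scaleR_zero_left scaleR_left_imp_eq scaleR_scaleR right_inverse scaleR_one)
    then show False
    proof cases
      case 1
      then have "z = 1 *s cvec x" by (simp add: z cvec_def vec_eq_iff)
      then show False using assms unfolding nonreal_def by blast
    next
      case 2
      then have "z = (of_real c + \<i>) *s cvec y" by (simp add: z cvec_def vec_eq_iff algebra_simps)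
      then show False using assms unfolding nonreal_def by blast
    qed
  qed
  define A where "A = (1 / d) *\<^sub>R ((y \<bullet> y) *\<^sub>R x - (x \<bullet> y) *\<^sub>R y)"
  define B where "B = (1 / d) *\<^sub>R ((x \<bullet> x) *\<^sub>R y - (x \<bullet> y) *\<^sub>R x)"
  have "A \<bullet> x = d / d" "B \<bullet> y = d / d"
    by (simp_all add: A_def B_def inner_diff_left inner_diff_right d_def power2_eq_square inner_commute mult.commute)
  moreover have "A \<bullet> y = 0" "B \<bullet> x = 0"
    by (simp_all add: A_def B_def inner_diff_left inner_diff_right inner_commute)
  ultimately have AB: "linf A z = 1" "linf B z = \<i>"
    using d unfolding linf_value x_def[symmetric] y_def[symmetric] by (simp_all add: complex_eq_iff)
  have "linf (u - Re (linf u z) *\<^sub>R A - Im (linf u z) *\<^sub>R B) z = 0" for u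
    unfolding linf_diff linf_scaleR AB by (simp add: complex_eq_iff)
  then show ?thesis using that AB by blast
qed

text \<open>
  In coordinates in which \<open>z = (1, i, 0, 0)\<close>, products of the coordinate forms suffice.
\<close>

lemma gradq_surjective:
  assumes "nonreal z"
  shows "surj (\<lambda>f. gradq f z)"
proof (rule ccontr)
  assume ns: "\<not> surj (\<lambda>f. gradq f z)"
  have sub: "subspace (range (\<lambda>f. gradq f z))"
    by (rule linear_subspace_image[OF linear_gradq subspace_UNIV])
  have "dim (range (\<lambda>f. gradq f z)) \<noteq> DIM(complex^4)"
  proof
    assume "dim (range (\<lambda>f. gradq f z)) = DIM(complex^4)"
    then have "span (range (\<lambda>f. gradq f z)) = UNIV" by (rule dim_eq_full[THEN iffD1])
    moreover have "span (range (\<lambda>f. gradq f z)) = range (\<lambda>f. gradq f z)" using sub by (rule span_eq_iff[THEN iffD2])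
    ultimately show False using ns by simp
  qed
  then have "dim (range (\<lambda>f. gradq f z)) < DIM(complex^4)"
    using dim_subset_UNIV[of "range (\<lambda>f. gradq f z)"] by simp
  then have "\<exists>b. b \<noteq> 0 \<and> (\<forall>y\<in>span (range (\<lambda>f. gradq f z)). orthogonal b y)"
    by (rule orthogonal_to_subspace_exists) (intro exI conjI ballI)
  then obtain b where
    b: "b \<noteq> 0" "\<And>y. y \<in> span (range (\<lambda>f. gradq f z)) \<Longrightarrow> orthogonal b y"
    by auto
  \<comment> \<open>Conjugation turns the real inner product with \<open>b\<close> into the real
    part of a complex bilinear pairing, that is, of the derivative in direction
    \<open>a\<close>.\<close>
  define a where "a = (\<chi> k. cnj (b $ k))"
  have orth: "Re (\<Sum>k\<in>UNIV. gradq f z $ k * a $ k) = 0" for f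
  proof -
    have "b \<bullet> gradq f z = 0" using b(2)[OF span_base[OF rangeI]] by (simp add: orthogonal_def)
    moreover have "b \<bullet> gradq f z = Re (\<Sum>k\<in>UNIV. gradq f z $ k * a $ k)"
      by (simp add: inner_vec_def inner_complex_def a_def mult.commute)
    ultimately show ?thesis by simp
  qed
  have D: "Re (linf u z * linf v z * (linf s z * linf t a + linf s a * linf t z) + (linf u z * linf v a + linf u a * linf v z) * (linf s z * linf t z)) = 0" for u v s t
    using orth[of "mulq (rank1 u v) (rank1 s t)"] unfolding gradq_mulq qform_def bform_rank1 .
  obtain A B where AB: "linf A z = 1" "linf B z = \<i>"
    and ker: "\<And>u. linf (u - Re (linf u z) *\<^sub>R A - Im (linf u z) *\<^sub>R B) z = 0"
    using nonreal_dual_basis[OF assms] by blast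
  \<comment> \<open>If \<open>u\<close> vanishes at \<open>z\<close>, the derivatives of
    \<open>A^3 u\<close> and \<open>A^2 B u\<close> in direction \<open>a\<close> are
    \<open>u(a)\<close> and \<open>i u(a)\<close>; their real parts give both parts of
    \<open>u(a)\<close>.\<close>
  have u0: "linf u a = 0" if "linf u z = 0" for u
    using D[of A A A u] D[of A A B u] that by (simp add: AB complex_eq_iff)
  have "Re (linf A a) = 0" using D[of A A A A] by (simp add: AB)
  moreover have "Im (linf B a) = 0" using D[of B B B B] by (simp add: AB)
  \<comment> \<open>The products \<open>A^3 B\<close> and \<open>A B^3\<close> give
    \<open>Re B(a) = 3 Im A(a)\<close> and \<open>Im A(a) = 3 Re B(a)\<close>, whose only solution
    is zero.\<close>
  moreover have "Im (linf A a) = 0" "Re (linf B a) = 0"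
    using D[of A A A B] D[of A B B B] by (simp_all add: AB)
  ultimately have AB0: "linf A a = 0" "linf B a = 0" by (simp_all add: complex_eq_iff)
  have "linf u a = 0" for u
    using u0[OF ker[of u]] unfolding linf_diff linf_scaleR AB0 by simp
  then have "a $ k = 0" for k using linf_axis[of k a] by metis
  then have "b = 0" by (simp add: a_def vec_eq_iff)
  then show False using b(1) by simp
qed

text \<open>A right inverse of the gradient map at \<open>z0\<close> remains, by continuity, within
  distance one half of a right inverse at all nearby points. One fixed family \<open>R e\<close> of
  forms thus controls the gradients on a whole ball.\<close>

lemma local_right_inverse:
  assumes "nonreal z0"
  obtains R :: "complex^4 \<Rightarrow> real^mon4" and r where "linear R" "r > 0"
    "\<And>z e. z \<in> cball z0 r \<Longrightarrow> norm e \<le> 2 * norm (gradq (R e) z)"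
proof -
  obtain R where R: "linear R" "(\<lambda>f. gradq f z0) \<circ> R = id"
    using linear_surjective_right_inverse[OF linear_gradq gradq_surjective[OF assms]] by blast
  then have R0: "gradq (R e) z0 = e" for e by (simp add: fun_eq_iff)
  \<comment> \<open>The errors at the basis vectors are summed, so this makes the total error at
    most half the norm.\<close>
  define eps where "eps = 1 / (2 * real (DIM(complex^4)))"
  have eps: "eps > 0" by (simp add: eps_def)
  have "\<forall>\<^sub>F z in at z0. \<forall>b\<in>Basis. dist (gradq (R b) z) (gradq (R b) z0) < eps"
  proof (intro eventually_ball_finite ballI)
    fix b :: "complex^4"
    have "isCont (gradq (R b)) z0" using differentiable_gradq differentiable_imp_continuous_within by blast
    then show "\<forall>\<^sub>F z in at z0. dist (gradq (R b) z) (gradq (R b) z0) < eps"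
      using eps by (auto simp: isCont_def intro: tendstoD)
  qed simp
  then obtain d where d: "d > 0" "\<And>z b. z \<noteq> z0 \<Longrightarrow> dist z z0 < d \<Longrightarrow> b \<in> Basis \<Longrightarrow> dist (gradq (R b) z) (gradq (R b) z0) < eps"
    unfolding eventually_at by auto
  have "norm e \<le> 2 * norm (gradq (R e) z)" if z: "z \<in> cball z0 (d / 2)" for z e
  proof -
    have dz: "norm (gradq (R b) z - b) \<le> eps" if "b \<in> Basis" for b
    proof (cases "z = z0")
      case False
      have "dist z z0 < d" using z d(1) by (simp add: dist_commute)
      then show ?thesis using d(2)[OF False _ that] R0[of b] by (simp add: dist_norm less_imp_le)
    qed (use eps R0 in simp)
    have lin: "linear (\<lambda>e. gradq (R e) z - e)"
      by (intro linear_compose_sub linear_compose[OF R(1) linear_gradq, unfolded o_def] linear_ident)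
    have "gradq (R e) z - e = (\<Sum>b\<in>Basis. (e \<bullet> b) *\<^sub>R (gradq (R b) z - b))"
      using linear_sum[OF lin, of "\<lambda>b. (e \<bullet> b) *\<^sub>R b" Basis] linear_scale[OF lin] by (simp add: euclidean_representation)
    also have "norm \<dots> \<le> (\<Sum>b\<in>(Basis :: (complex^4) set). norm e * eps)"
    proof (rule sum_norm_le)
      fix b :: "complex^4" assume b: "b \<in> Basis"
      then show "norm ((e \<bullet> b) *\<^sub>R (gradq (R b) z - b)) \<le> norm e * eps"
        using dz[OF b] Basis_le_norm[OF b, of e] by (simp add: mult_mono)
    qed
    also have "\<dots> = norm e / 2" by (simp add: eps_def)
    finally have "norm (gradq (R e) z - e) \<le> norm e / 2" .
    moreover have "norm e \<le> norm (gradq (R e) z) + norm (gradq (R e) z - e)"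
      by (metis norm_triangle_sub norm_minus_commute)
    ultimately show ?thesis by simp
  qed
  then show ?thesis using that[OF R(1), of "d / 2"] d(1) by simp
qed

text \<open>
  Normalising \<open>z\<close> by \<open>z\<^sub>j = 1\<close> leaves seven real parameters for \<open>(z, t)\<close>, against the eight real
  conditions that the gradient vanishes.
\<close>

definition singular_near :: "real^mon4 \<Rightarrow> (complex^4) set \<Rightarrow> 4 \<Rightarrow> nat \<Rightarrow> (real^mon4) set" where
  "singular_near h V j N = {c. \<exists>z t. z \<in> V \<and> z $ j = 1 \<and> \<bar>t\<bar> \<le> real N \<and> gradq (c + t *\<^sub>R h) z = 0}"

text \<open>The pairs \<open>(z, t)\<close> range over a compact set, so singular points of
  convergent forms converge along a subsequence. This is why \<open>t\<close> is bounded by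
  \<open>N\<close> and \<open>z\<close> confined to \<open>V\<close>.\<close>

lemma closed_singular_near:
  assumes "compact V"
  shows "closed (singular_near h V j N)"
proof -
  have cont: "continuous_on UNIV (\<lambda>p::(real^mon4) \<times> (complex^4) \<times> real. gradq (fst p + snd (snd p) *\<^sub>R h) (fst (snd p)))"
    using continuous_on_compose2[OF continuous_gradq2, of UNIV "\<lambda>p::(real^mon4) \<times> (complex^4) \<times> real. (fst p + snd (snd p) *\<^sub>R h, fst (snd p))"]
    by (simp add: continuous_intros)
  show ?thesis
    unfolding closed_sequential_limits
  proof (intro allI impI, elim conjE)
    fix x l assume x: "\<forall>n. x n \<in> singular_near h V j N" and l: "x \<longlonglongrightarrow> l"
    have "\<forall>n. \<exists>p. p \<in> V \<times> {- real N..real N} \<and> fst p $ j = 1 \<and> gradq (x n + snd p *\<^sub>R h) (fst p) = 0"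
    proof
      fix n
      obtain z t where "z \<in> V" "z $ j = 1" "\<bar>t\<bar> \<le> real N" "gradq (x n + t *\<^sub>R h) z = 0"
        using x[rule_format, of n] by (auto simp: singular_near_def)
      then show "\<exists>p. p \<in> V \<times> {- real N..real N} \<and> fst p $ j = 1 \<and> gradq (x n + snd p *\<^sub>R h) (fst p) = 0"
        by (intro exI[of _ "(z, t)"]) (auto simp: abs_le_iff)
    qed
    then obtain p where p: "\<And>n. p n \<in> V \<times> {- real N..real N}" "\<And>n. fst (p n) $ j = 1" "\<And>n. gradq (x n + snd (p n) *\<^sub>R h) (fst (p n)) = 0"
      by metis
    have "compact (V \<times> {- real N..real N})" using assms by (intro compact_Times compact_Icc)
    then obtain q s where q: "q \<in> V \<times> {- real N..real N}" "strict_mono s" "(p \<circ> s) \<longlonglongrightarrow> q"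
      using p(1) unfolding compact_def by meson
    have xs: "(x \<circ> s) \<longlonglongrightarrow> l" using l q(2) by (rule LIMSEQ_subseq_LIMSEQ)
    have "(\<lambda>n. ((x \<circ> s) n, (p \<circ> s) n)) \<longlonglongrightarrow> (l, q)" using xs q(3) by (rule tendsto_Pair)
    then have "(\<lambda>n. gradq (fst ((x \<circ> s) n, (p \<circ> s) n) + snd (snd ((x \<circ> s) n, (p \<circ> s) n)) *\<^sub>R h) (fst (snd ((x \<circ> s) n, (p \<circ> s) n))))
       \<longlonglongrightarrow> gradq (fst (l, q) + snd (snd (l, q)) *\<^sub>R h) (fst (snd (l, q)))"
      by (rule continuous_on_tendsto_compose[OF cont]) auto
    then have "(\<lambda>n. 0) \<longlonglongrightarrow> gradq (l + snd q *\<^sub>R h) (fst q)" using p(3) by simp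
    then have g0: "gradq (l + snd q *\<^sub>R h) (fst q) = 0" by (metis LIMSEQ_const_iff)
    have "(\<lambda>n. fst ((p \<circ> s) n) $ j) \<longlonglongrightarrow> fst q $ j" by (intro tendsto_intros q(3))
    then have "fst q $ j = 1" using p(2) by (simp add: LIMSEQ_const_iff)
    then show "l \<in> singular_near h V j N"
      using g0 q(1) unfolding singular_near_def by (intro CollectI exI[of _ "fst q"] exI[of _ "snd q"]) auto
  qed
qed

lemma local_lipschitz_zero:
  fixes H :: "'a::real_normed_vector \<Rightarrow> 'b::real_normed_vector"
  assumes "H differentiable (at x)" "H x = 0"
  shows "\<exists>d B. d > 0 \<and> (\<forall>y. norm (y - x) < d \<longrightarrow> norm (H y) \<le> B * norm (y - x))"
proof -
  obtain H' where H': "(H has_derivative H') (at x)" using assms(1) by (auto simp: differentiable_def)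
  then obtain d where d: "d > 0" "\<And>y. norm (y - x) < d \<Longrightarrow> norm (H y - H x - H' (y - x)) \<le> 1 * norm (y - x)"
    unfolding has_derivative_at_alt by (metis zero_less_one)
  obtain B where B: "\<And>v. norm (H' v) \<le> norm v * B"
    using bounded_linear.bounded[OF has_derivative_bounded_linear[OF H']] by blast
  have "norm (H y) \<le> (1 + B) * norm (y - x)" if "norm (y - x) < d" for y
  proof -
    have "norm (H y) \<le> norm (H y - H' (y - x)) + norm (H' (y - x))" by (metis norm_triangle_sub add.commute)
    also have "\<dots> \<le> norm (y - x) + norm (y - x) * B" using d(2)[OF that] B[of "y - x"] assms(2) by simp
    finally show ?thesis by (simp add: algebra_simps)
  qed
  then show ?thesis using d(1) by blast
qed

text \<open>
  The pair \<open>(z, t)\<close> is encoded as a vector \<open>w\<close> with \<open>w\<^sub>j = t\<close> real, so that it ranges over a hyperplane.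
  The direction \<open>e\<close> is a locally Lipschitz function of \<open>w\<close>.
\<close>

lemma negligible_singular_directions:
  fixes R :: "complex^4 \<Rightarrow> real^mon4"
  assumes R: "linear R" and inv: "\<And>z e. z \<in> V \<Longrightarrow> norm e \<le> 2 * norm (gradq (R e) z)"
  shows "negligible {e. \<exists>z t. z \<in> V \<and> z $ j = 1 \<and> gradq (c + R e + t *\<^sub>R h) z = 0}"
proof -
  \<comment> \<open>Restores the normalisation by putting 1 in coordinate \<open>j\<close>, the slot
    that carries \<open>t\<close>.\<close>
  define zz :: "complex^4 \<Rightarrow> complex^4" where "zz w = w + axis j (1 - w $ j)" for w
  define tt where "tt w = Re (w $ j)" for w :: "complex^4"
  define rel where "rel w e \<longleftrightarrow> zz w \<in> V \<and> gradq (c + R e + tt w *\<^sub>R h) (zz w) = 0" for w e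
  define S where "S = {w. Im (w $ j) = 0 \<and> (\<exists>e. rel w e)}"
  define g where "g w = (SOME e. rel w e)" for w
  have g: "rel w (g w)" if "w \<in> S" for w
    using that unfolding S_def g_def by (metis (mono_tags, lifting) mem_Collect_eq someI_ex)
  \<comment> \<open>The distance of any \<open>e'\<close> from a solution \<open>e\<close> is
    bounded by the gradient left over at \<open>e'\<close>. This gives uniqueness of the solution,
    and its Lipschitz dependence on \<open>w\<close> as well.\<close>
  have key: "norm (e - e') \<le> 2 * norm (gradq (c + R e' + tt w *\<^sub>R h) (zz w))" if "rel w e" for w e e'
  proof -
    have "gradq (R (e - e')) (zz w) + gradq (c + R e' + tt w *\<^sub>R h) (zz w) = gradq (c + R e + tt w *\<^sub>R h) (zz w)"
      unfolding gradq_linear(1)[symmetric] linear_diff[OF R] by (simp add: algebra_simps)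
    then have "gradq (R (e - e')) (zz w) = - gradq (c + R e' + tt w *\<^sub>R h) (zz w)"
      using that unfolding rel_def by (simp add: eq_neg_iff_add_eq_0)
    then show ?thesis using inv[of "zz w" "e - e'"] that unfolding rel_def by simp
  qed
  have sub: "{e. \<exists>z t. z \<in> V \<and> z $ j = 1 \<and> gradq (c + R e + t *\<^sub>R h) z = 0} \<subseteq> g ` S"
  proof
    fix e assume "e \<in> {e. \<exists>z t. z \<in> V \<and> z $ j = 1 \<and> gradq (c + R e + t *\<^sub>R h) z = 0}"
    then obtain z t where zt: "z \<in> V" "z $ j = 1" "gradq (c + R e + t *\<^sub>R h) z = 0" by blast
    define w where "w = z + axis j (of_real t - 1)"
    have wj: "w $ j = of_real t" using zt(2) by (simp add: w_def axis_def)
    have "zz w = z" unfolding zz_def wj by (simp add: w_def vec_eq_iff axis_def)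
    then have rw: "rel w e" using zt by (simp add: rel_def tt_def wj)
    then have wS: "w \<in> S" by (auto simp: S_def wj)
    have "norm (g w - e) \<le> 2 * norm (gradq (c + R e + tt w *\<^sub>R h) (zz w))" by (rule key[OF g[OF wS]])
    also have "\<dots> = 0" using rw by (simp add: rel_def)
    finally have "g w = e" by simp
    then show "e \<in> g ` S" using wS by blast
  qed
  have "negligible (g ` S)"
  proof (rule negligible_locally_Lipschitz_image)
    have "negligible {w :: complex^4. w \<bullet> axis j \<i> = 0}"
      by (rule negligible_standard_hyperplane) (auto simp: Basis_vec_def Basis_complex_def)
    then show "negligible S"
      by (rule negligible_subset) (auto simp: S_def inner_axis inner_complex_def)
    fix w0 assume w0: "w0 \<in> S"
    define H where "H w = gradq (c + R (g w0)) (zz w) + tt w *\<^sub>R gradq h (zz w)" for w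
    have H: "H w = gradq (c + R (g w0) + tt w *\<^sub>R h) (zz w)" for w
      by (simp add: H_def gradq_linear)
    have bl: "bounded_linear (axis j :: complex \<Rightarrow> complex^4)"
      unfolding linear_conv_bounded_linear[symmetric] by (rule linearI) (auto simp: axis_def vec_eq_iff)
    have dz: "(zz has_derivative (\<lambda>v. v + axis j (0 - v $ j))) (at w)" for w
      unfolding zz_def[abs_def]
      by (intro has_derivative_add has_derivative_ident bounded_linear.has_derivative[OF bl] has_derivative_diff
          has_derivative_const bounded_linear_imp_has_derivative[OF bounded_linear_vec_nth])
    then have dzz: "zz differentiable (at w)" for w by (rule differentiableI)
    have dg: "(\<lambda>w. gradq f (zz w)) differentiable (at w)" for f w
      using differentiable_compose[OF differentiable_gradq dzz] .
    have dt: "tt differentiable (at w)" for w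
      unfolding tt_def[abs_def]
      by (rule differentiableI[OF bounded_linear_imp_has_derivative])
         (rule bounded_linear_compose[OF bounded_linear_Re bounded_linear_vec_nth])
    have "H differentiable (at w0)"
      unfolding H_def[abs_def] by (intro differentiable_add dg differentiable_scaleR dt)
    moreover have "H w0 = 0" using g[OF w0] by (simp add: H rel_def)
    ultimately obtain d B where dB: "d > 0" "\<And>w. norm (w - w0) < d \<Longrightarrow> norm (H w) \<le> B * norm (w - w0)"
      using local_lipschitz_zero[of H w0] by auto
    have "norm (g w - g w0) \<le> (2 * B) * norm (w - w0)" if "w \<in> S \<inter> ball w0 d" for w
    proof -
      have "norm (g w - g w0) \<le> 2 * norm (H w)" using key[OF g[of w]] that unfolding H by blast
      also have "\<dots> \<le> 2 * (B * norm (w - w0))" using dB(2)[of w] that by (simp add: dist_norm norm_minus_commute)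
      finally show ?thesis by simp
    qed
    then show "\<exists>T B. open T \<and> w0 \<in> T \<and> (\<forall>y\<in>S \<inter> T. norm (g y - g w0) \<le> B * norm (y - w0))"
      using dB(1) by (intro exI[of _ "ball w0 d"] exI[of _ "2 * B"]) auto
  qed simp
  then show ?thesis using sub negligible_subset by blast
qed

text \<open>On the affine space \<open>c + R e\<close> the bad parameters are negligible, so every
  ball around 0 contains a good \<open>e\<close>.\<close>

lemma dense_complement_singular_near:
  fixes R :: "complex^4 \<Rightarrow> real^mon4"
  assumes R: "linear R" and inv: "\<And>z e. z \<in> V \<Longrightarrow> norm e \<le> 2 * norm (gradq (R e) z)"
  shows "closure (- singular_near h V j N) = UNIV"
proof -
  have "\<exists>c'\<in>- singular_near h V j N. dist c' c < eps" if "eps > 0" for c eps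
  proof -
    obtain B where B: "B > 0" "\<And>e. norm (R e) \<le> B * norm e" using linear_bounded_pos[OF R] by blast
    have "\<not> negligible (ball (0::complex^4) (eps / B))"
      using that B(1) by (intro open_not_negligible) (simp_all add: not_le)
    then obtain e where e: "e \<in> ball 0 (eps / B)" "\<not> (\<exists>z t. z \<in> V \<and> z $ j = 1 \<and> gradq (c + R e + t *\<^sub>R h) z = 0)"
      using negligible_subset[OF negligible_singular_directions[OF R inv, where c = c and j = j and h = h]] by blast
    have "norm (R e) < eps"
      using B(2)[of e] e(1) B(1) by (simp add: pos_less_divide_eq mult.commute)
    then show ?thesis using e(2) by (intro bexI[of _ "c + R e"]) (auto simp: singular_near_def dist_norm)
  qed
  then have "c \<in> closure (- singular_near h V j N)" for c unfolding closure_approachable by blast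
  then show ?thesis by blast
qed

text \<open>By the Lindelof property countably many balls with a local right inverse cover the
  nonreal points. Together with the choices of \<open>j\<close> and \<open>N\<close> they give
  countably many dense open sets, and Baire's theorem yields a point of \<open>W\<close> in all of
  them.\<close>

theorem generic_no_nonreal_singularity:
  fixes h :: "real^mon4"
  assumes "open W" "W \<noteq> {}"
  shows "\<exists>c\<in>W. \<forall>z t. nonreal z \<longrightarrow> gradq (c + t *\<^sub>R h) z \<noteq> 0"
proof -
  define good where "good z r \<longleftrightarrow> r > 0 \<and> (\<exists>R::complex^4 \<Rightarrow> real^mon4. linear R \<and> (\<forall>z'\<in>cball z r. \<forall>e. norm e \<le> 2 * norm (gradq (R e) z')))" for z r
  have ex: "\<exists>r. good z r" if "nonreal z" for z
    using local_right_inverse[OF that] unfolding good_def by metis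
  define F where "F = {ball z r |z r. good z r}"
  obtain F' where F': "F' \<subseteq> F" "countable F'" "\<Union>F' = \<Union>F"
    by (rule Lindelof[of F]) (auto simp: F_def)
  have "\<forall>X\<in>F'. \<exists>z r. X = ball z r \<and> good z r" using F'(1) by (auto simp: F_def)
  then obtain zc rc where zr: "\<And>X. X \<in> F' \<Longrightarrow> X = ball (zc X) (rc X) \<and> good (zc X) (rc X)" by metis
  define G where "G = (\<lambda>(X, j, N). - singular_near h (cball (zc X) (rc X)) j N) ` (F' \<times> UNIV \<times> UNIV)"
  have "UNIV \<subseteq> closure (\<Inter>G)"
  proof (rule Baire)
    show "countable G" unfolding G_def using F'(2) by (intro countable_image countable_SIGMA) auto
    fix T assume "T \<in> G"
    then obtain X j N where T: "X \<in> F'" "T = - singular_near h (cball (zc X) (rc X)) j N" by (auto simp: G_def)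
    obtain R :: "complex^4 \<Rightarrow> real^mon4" where R: "linear R" "\<And>z e. z \<in> cball (zc X) (rc X) \<Longrightarrow> norm e \<le> 2 * norm (gradq (R e) z)"
      using zr[OF T(1)] unfolding good_def by blast
    have "closure T = UNIV" unfolding T(2) by (rule dense_complement_singular_near[OF R])
    moreover have "open T" unfolding T(2) using closed_singular_near by (auto simp: open_closed)
    ultimately show "openin (top_of_set UNIV) T \<and> UNIV \<subseteq> closure T" by simp
  qed simp
  then have "W \<inter> closure (\<Inter>G) \<noteq> {}" using assms(2) by auto
  then obtain c where c: "c \<in> W" "c \<in> \<Inter>G" using open_Int_closure_eq_empty[OF assms(1)] by blast
  have "gradq (c + t *\<^sub>R h) z \<noteq> 0" if z: "nonreal z" for z t
  proof
    assume g0: "gradq (c + t *\<^sub>R h) z = 0"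
    have "z \<noteq> 0 *s cvec 0" using z unfolding nonreal_def by blast
    then obtain j where j: "z $ j \<noteq> 0" by (auto simp: vec_eq_iff)
    define w where "w = (1 / z $ j) *s z"
    have zw: "z = z $ j *s w" using j by (simp add: w_def vec_eq_iff)
    have nw: "nonreal w"
      unfolding nonreal_def
    proof
      assume "\<exists>c x. w = c *s cvec x"
      then obtain c x where "w = c *s cvec x" by blast
      then have "z = (z $ j * c) *s cvec x" using zw by (metis vector_smult_assoc)
      then show False using z unfolding nonreal_def by blast
    qed
    have gw: "gradq (c + t *\<^sub>R h) w = 0"
      unfolding w_def by (rule gradq_smult_eq_0) (use j g0 in auto)
    obtain r where "good w r" using ex[OF nw] by blast
    then have "w \<in> \<Union>F" unfolding F_def using good_def by (auto intro!: exI[of _ "ball w r"])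
    then obtain X where X: "X \<in> F'" "w \<in> X" using F'(3) by blast
    then have wX: "w \<in> cball (zc X) (rc X)" using zr[OF X(1)] ball_subset_cball by blast
    obtain N where "\<bar>t\<bar> \<le> real N" using real_arch_simple by blast
    then have "c \<in> singular_near h (cball (zc X) (rc X)) j N"
      unfolding singular_near_def using wX gw j by (intro CollectI exI[of _ w] exI[of _ t]) (auto simp: w_def)
    moreover have "- singular_near h (cball (zc X) (rc X)) j N \<in> G" using X(1) by (auto simp: G_def)
    ultimately show False using c(2) by blast
  qed
  then show ?thesis using c(1) by blast
qed

section \<open>Sums of five squares\<close>

lemma bounded_bilinear_mulq: "bounded_bilinear mulq"
  unfolding bilinear_conv_bounded_bilinear[symmetric] bilinear_def
  by (auto intro!: linearI simp: mulq_bilinear)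

interpretation mulq: bounded_bilinear mulq by (rule bounded_bilinear_mulq)

text \<open>A quadric determines its symmetric matrix but not a general one; injectivity and
  compactness arguments therefore pass to this representative.\<close>

definition symm :: "real^4^4 \<Rightarrow> real^4^4" where
  "symm P = (1/2) *\<^sub>R (P + transpose P)"

lemma transpose_symm [simp]: "transpose (symm P) = symm P"
  by (simp add: symm_def transpose_def vec_eq_iff add.commute)

lemma mulq_transpose: "mulq (transpose P) Q = mulq P Q"
proof -
  have "mulq (transpose P) Q = (\<Sum>i\<in>UNIV. \<Sum>j\<in>UNIV. \<Sum>k\<in>UNIV. \<Sum>l\<in>UNIV. (P $ j $ i * Q $ k $ l) *\<^sub>R axis (bm j i k l) 1)"
    unfolding mulq_def by (intro sum.cong refl) (subst bm_perm(2), simp add: transpose_def)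
  also have "\<dots> = mulq P Q" unfolding mulq_def by (rule sum.swap)
  finally show ?thesis .
qed

lemma mulq_symm_left: "mulq (symm P) Q = mulq P Q"
proof -
  have "mulq (symm P) Q = (1/2) *\<^sub>R (mulq P Q + mulq P Q)"
    unfolding symm_def mulq_bilinear mulq_transpose ..
  also have "\<dots> = mulq P Q" by (simp flip: scaleR_2)
  finally show ?thesis .
qed

lemma mulq_symm: "mulq (symm P) (symm Q) = mulq P Q"
  by (metis mulq_symm_left mulq_commute)

text \<open>The index type \<open>4 option\<close> has five elements; \<open>None\<close> marks the
  quadric that the projection in \<open>five_quadrics_common_zero\<close> removes.\<close>

definition gramsum :: "real^4^4^(4 option) \<Rightarrow> real^mon4" where
  "gramsum p = (\<Sum>i\<in>UNIV. mulq (p $ i) (p $ i))"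

definition five_squares :: "(real^mon4) set" where
  "five_squares = range gramsum"

definition sos :: "(real^mon4) set" where
  "sos = {f. \<exists>(n::nat) p. f = (\<Sum>i<n. mulq (p i) (p i))}"

lemma five_squares_symmetric:
  assumes "f \<in> five_squares"
  obtains p where "f = gramsum p" "\<And>i. transpose (p $ i) = p $ i"
proof -
  obtain q where q: "f = gramsum q" using assms by (auto simp: five_squares_def)
  have "f = gramsum (\<chi> i. symm (q $ i))" unfolding q gramsum_def by (simp add: mulq_symm)
  then show ?thesis using that by simp
qed

lemma sos_add: "f \<in> sos \<Longrightarrow> g \<in> sos \<Longrightarrow> f + g \<in> sos"
proof -
  assume "f \<in> sos" "g \<in> sos"
  then obtain n m :: nat and p q where f: "f = (\<Sum>i<n. mulq (p i) (p i))" and g: "g = (\<Sum>i<m. mulq (q i) (q i))"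
    by (auto simp: sos_def)
  define r where "r i = (if i < n then p i else q (i - n))" for i
  have "(\<Sum>i<n + m. mulq (r i) (r i)) = (\<Sum>i<n. mulq (r i) (r i)) + (\<Sum>i<m. mulq (r (n + i)) (r (n + i)))"
    by (induction m) (auto simp: add.assoc)
  also have "\<dots> = f + g" unfolding f g by (simp add: r_def)
  finally show ?thesis unfolding sos_def by (metis (mono_tags, lifting) mem_Collect_eq)
qed

lemma sos_scaleR: "f \<in> sos \<Longrightarrow> 0 \<le> c \<Longrightarrow> c *\<^sub>R f \<in> sos"
proof -
  assume "f \<in> sos" and c: "0 \<le> c"
  then obtain n :: nat and p where f: "f = (\<Sum>i<n. mulq (p i) (p i))" by (auto simp: sos_def)
  have "c *\<^sub>R f = (\<Sum>i<n. mulq (sqrt c *\<^sub>R p i) (sqrt c *\<^sub>R p i))"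
    unfolding f using c by (simp add: mulq_bilinear scaleR_sum_right)
  then show ?thesis unfolding sos_def by (intro CollectI exI)
qed

lemma sos_square: "mulq P P \<in> sos"
  unfolding sos_def by (intro CollectI exI[of _ 1] exI[of _ "\<lambda>_. P"]) simp

lemma sos_zero: "0 \<in> sos"
  unfolding sos_def by (intro CollectI exI[of _ 0]) simp

lemma five_squares_sos: "five_squares \<subseteq> sos"
proof -
  have "(\<Sum>i\<in>I. mulq (p $ i) (p $ i)) \<in> sos" for I :: "4 option set" and p
    by (induction I rule: infinite_finite_induct) (auto intro: sos_zero sos_add sos_square)
  then show ?thesis by (auto simp: five_squares_def gramsum_def)
qed

lemma five_squares_scaleR: "f \<in> five_squares \<Longrightarrow> 0 \<le> c \<Longrightarrow> c *\<^sub>R f \<in> five_squares"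
proof -
  assume "f \<in> five_squares" and c: "0 \<le> c"
  then obtain p where f: "f = gramsum p" by (auto simp: five_squares_def)
  have "c *\<^sub>R f = gramsum (\<chi> i. sqrt c *\<^sub>R p $ i)"
    unfolding f gramsum_def using c by (simp add: mulq_bilinear scaleR_sum_right)
  then show ?thesis unfolding five_squares_def by blast
qed

section \<open>Closedness of the cone of five squares\<close>

lemma continuous_gramsum: "continuous_on S gramsum"
  unfolding gramsum_def[abs_def] by (intro continuous_intros mulq.continuous_on)

lemma gramsum_scaleR: "gramsum (c *\<^sub>R p) = c\<^sup>2 *\<^sub>R gramsum p"
  by (simp add: gramsum_def mulq_bilinear scaleR_sum_right power2_eq_square)

lemma evq_square_real: "evq (mulq P P) (cvec x) = of_real ((qform P x)\<^sup>2)"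
  by (simp add: evq_mulq qform_cmat_cvec power2_eq_square)

lemma sos_nonneg: "f \<in> sos \<Longrightarrow> \<exists>r\<ge>0. evq f (cvec x) = of_real r"
proof -
  assume "f \<in> sos"
  then obtain n :: nat and p where f: "f = (\<Sum>i<n. mulq (p i) (p i))" by (auto simp: sos_def)
  have "evq f (cvec x) = of_real (\<Sum>i<n. (qform (p i) x)\<^sup>2)"
    unfolding f evq_sum evq_square_real by simp
  then show ?thesis by (meson sum_nonneg zero_le_power2)
qed

lemma gramsum_eq_0:
  assumes "gramsum p = 0" "\<And>i. transpose (p $ i) = p $ i"
  shows "p = 0"
proof -
  have "qform (p $ i) x = 0" for i x
  proof -
    have "complex_of_real (\<Sum>i\<in>UNIV. (qform (p $ i) x)\<^sup>2) = evq (gramsum p) (cvec x)"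
      unfolding gramsum_def evq_sum evq_square_real by simp
    also have "\<dots> = 0" unfolding assms(1) by (simp add: evq_def)
    finally have "(\<Sum>i\<in>UNIV. (qform (p $ i) x)\<^sup>2) = 0" by (simp only: of_real_eq_0_iff)
    then show ?thesis by (simp add: sum_nonneg_eq_0_iff)
  qed
  then have "p $ i = 0" for i using qform_eq_0_symmetric assms(2) by blast
  then show ?thesis by (simp add: vec_eq_iff)
qed

text \<open>On symmetric tuples \<open>gramsum\<close> is homogeneous of degree two and vanishes
  only at 0, so it grows at least like \<open>m |p|^2\<close>. Tuples representing a convergent
  sequence are therefore bounded, and a subsequence converges.\<close>

lemma closed_five_squares: "closed five_squares"
proof -
  define Sy where "Sy = {p :: real^4^4^(4 option). \<forall>i a b. p $ i $ a $ b = p $ i $ b $ a}"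
  have Sy: "p \<in> Sy \<longleftrightarrow> (\<forall>i. transpose (p $ i) = p $ i)" for p
    unfolding Sy_def by (auto simp: transpose_def vec_eq_iff)
  have clSy: "closed Sy" unfolding Sy_def
    by (intro closed_Collect_all closed_Collect_eq continuous_intros)
  have "compact (Sy \<inter> sphere 0 1)" by (intro closed_Int_compact clSy) auto
  then obtain m where m: "m > 0" "\<And>p. p \<in> Sy \<inter> sphere 0 1 \<Longrightarrow> m \<le> norm (gramsum p)"
  proof (cases "Sy \<inter> sphere 0 1 = {}")
    case True then show ?thesis using that[of 1] by auto
  next
    case False
    obtain q where q: "q \<in> Sy \<inter> sphere 0 1" "\<And>p. p \<in> Sy \<inter> sphere 0 1 \<Longrightarrow> norm (gramsum q) \<le> norm (gramsum p)"
      using continuous_attains_inf[OF \<open>compact (Sy \<inter> sphere 0 1)\<close> False, of "\<lambda>p. norm (gramsum p)"]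
        continuous_on_norm[OF continuous_gramsum] by blast
    have "gramsum q \<noteq> 0" using gramsum_eq_0[of q] q(1) Sy by force
    then show ?thesis using that[of "norm (gramsum q)"] q(2) by auto
  qed
  have grow: "m * (norm p)\<^sup>2 \<le> norm (gramsum p)" if "p \<in> Sy" for p
  proof (cases "p = 0")
    case False
    define u where "u = (1 / norm p) *\<^sub>R p"
    have "u \<in> Sy \<inter> sphere 0 1" using that False by (auto simp: u_def Sy_def)
    then have "m \<le> norm (gramsum u)" by (rule m(2))
    moreover have "gramsum p = (norm p)\<^sup>2 *\<^sub>R gramsum u"
      using gramsum_scaleR[of "norm p" u] False by (simp add: u_def)
    ultimately show ?thesis by (simp add: mult.commute mult_right_mono)
  qed simp
  show ?thesis
    unfolding closed_sequential_limits
  proof (intro allI impI, elim conjE)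
    fix x l assume x: "\<forall>n. x n \<in> five_squares" and l: "x \<longlonglongrightarrow> l"
    have "\<forall>n. \<exists>p. p \<in> Sy \<and> x n = gramsum p" using x five_squares_symmetric Sy by metis
    then obtain p where p: "\<And>n. p n \<in> Sy" "\<And>n. x n = gramsum (p n)" by metis
    obtain B where B: "\<And>n. norm (x n) \<le> B"
      using convergent_imp_bounded[OF l] unfolding bounded_iff by auto
    have pb: "norm (p n) \<le> sqrt (B / m)" for n
    proof (rule real_le_rsqrt)
      show "(norm (p n))\<^sup>2 \<le> B / m" using grow[OF p(1), of n] B[of n] p(2)[of n] m(1) by (simp add: pos_le_divide_eq mult.commute)
    qed
    have "compact (Sy \<inter> cball 0 (sqrt (B / m)))" by (intro closed_Int_compact clSy) auto
    moreover have "\<forall>n. p n \<in> Sy \<inter> cball 0 (sqrt (B / m))" using p(1) pb by simp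
    ultimately obtain q s where q: "strict_mono s" "(p \<circ> s) \<longlonglongrightarrow> q" unfolding compact_def by meson
    have "(\<lambda>n. gramsum ((p \<circ> s) n)) \<longlonglongrightarrow> gramsum q"
      by (rule continuous_on_tendsto_compose[OF continuous_gramsum[of UNIV] q(2)]) auto
    then have "(x \<circ> s) \<longlonglongrightarrow> gramsum q" by (simp add: p(2) o_def)
    then have "l = gramsum q" using LIMSEQ_subseq_LIMSEQ[OF l q(1)] LIMSEQ_unique by blast
    then show "l \<in> five_squares" by (simp add: five_squares_def)
  qed
qed

section \<open>An interior point of the cone\<close>

lemma bm_distinct:
  assumes "distinct [i, j, k, l]"
  shows "bm i j k l = bm 1 2 3 4"
proof -
  have all: "qmono i j k l = (\<Sum>a\<in>UNIV. Poly_Mapping.single (idx a) 1)" if "distinct [i, j, k, l]" for i j k l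
  proof -
    have "card {i, j, k, l} = CARD(4)" using that by simp
    then have "{i, j, k, l} = UNIV" by (metis card_eq_UNIV_imp_eq_UNIV finite)
    then have "(\<Sum>a\<in>UNIV. Poly_Mapping.single (idx a) (1::nat)) = (\<Sum>a\<in>{i, j, k, l}. Poly_Mapping.single (idx a) 1)" by simp
    then show ?thesis using that by (simp add: qmono_def add_ac)
  qed
  have "distinct [1, 2, 3, 4 :: 4]" by simp
  then show ?thesis using all assms by (simp add: bm_def)
qed

text \<open>Multiples of the four squares of variables cover every quartic monomial except the
  square-free one, which is a multiple of \<open>x1 x2\<close>.\<close>

definition base_tuple :: "real^4^4^(4 option)" where
  "base_tuple = (\<chi> i. case i of None \<Rightarrow> elem 1 2 | Some k \<Rightarrow> elem k k)"

text \<open>The derivative of \<open>gramsum\<close> sends \<open>v\<close> to twice the sum of the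
  products of corresponding entries. Its range contains all quartic monomials by the choice of the
  tuple, so the map is open there.\<close>

lemma interior_five_squares: "gramsum base_tuple \<in> interior five_squares"
proof -
  define D where "D v = (\<Sum>i\<in>UNIV. mulq (base_tuple $ i) (v $ i) + mulq (v $ i) (base_tuple $ i))" for v
  have der: "(gramsum has_derivative D) (at base_tuple)"
    unfolding gramsum_def[abs_def] D_def
    by (intro has_derivative_sum mulq.FDERIV bounded_linear_imp_has_derivative[OF bounded_linear_vec_nth])
  then have linD: "linear D" using has_derivative_bounded_linear bounded_linear.linear by blast
  have D1: "D (axis i Q) = 2 *\<^sub>R mulq (base_tuple $ i) Q" for i Q
  proof -
    have "D (axis i Q) = (\<Sum>a\<in>UNIV. if a = i then 2 *\<^sub>R mulq (base_tuple $ i) Q else 0)"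
      unfolding D_def by (intro sum.cong refl) (auto simp: axis_def mulq.zero_left mulq.zero_right scaleR_2 mulq_commute[of Q])
    then show ?thesis by simp
  qed
  have sub: "subspace (range D)" by (rule linear_subspace_image[OF linD subspace_UNIV])
  have in_range: "mulq (base_tuple $ i) Q \<in> range D" for i Q
    using subspace_scale[OF sub rangeI, of "1/2" "axis i Q"] by (simp add: D1)
  have sq: "axis (bm a a k l) 1 \<in> range D" for a k l
    using in_range[of "Some a" "elem k l"] by (simp add: base_tuple_def mulq_elem)
  have p: "axis (bm 1 2 3 4) 1 \<in> range D"
    using in_range[of None "elem 3 4"] by (simp add: base_tuple_def mulq_elem)
  have ax: "axis (bm i j k l) 1 \<in> range D" for i j k l
  proof (cases "distinct [i, j, k, l]")
    case True then show ?thesis using p bm_distinct by metis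
  next
    case False
    then consider "i = j" | "i = k" | "i = l" | "j = k" | "j = l" | "k = l" by auto
    moreover have "bm i j i l = bm i i j l" "bm i j k i = bm i i k j" "bm i j j l = bm j j i l"
      "bm i j k j = bm j j k i" "bm i j k k = bm k k i j" for i j k l
      using bm_perm by (metis (no_types))+
    ultimately have "\<exists>a b c. bm i j k l = bm a a b c" by cases metis+
    then show ?thesis using sq by auto
  qed
  have "surj D"
  proof -
    have "f \<in> range D" for f :: "real^mon4"
    proof -
      have "f = (\<Sum>m\<in>UNIV. f $ m *\<^sub>R axis m 1)" by (simp add: vec_eq_iff axis_def if_distrib cong: if_cong)
      also have "\<dots> \<in> range D"
        using ax bm_cases by (intro subspace_sum[OF sub] subspace_scale[OF sub]) metis
      finally show ?thesis .
    qed
    then show ?thesis by blast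
  qed
  then obtain g where g: "linear g" "D \<circ> g = id" using linear_surjective_right_inverse[OF linD] by blast
  have "gramsum base_tuple \<in> interior (gramsum ` UNIV)"
    by (rule sussmann_open_mapping[OF open_UNIV continuous_gramsum _ der _ g(2)])
       (use g(1) linear_conv_bounded_linear in auto)
  then show ?thesis by (simp add: five_squares_def)
qed

section \<open>Point evaluations and linear functionals\<close>

lemma expo_bound: "expo m k \<le> 4"
  by (rule bm_cases[of m]) (auto simp: expo_bm)

lemma expo_eqI: "(\<And>k. expo m k = expo n k) \<Longrightarrow> m = n"
proof -
  assume e: "\<And>k. expo m k = expo n k"
  have "Poly_Mapping.lookup (Rep_mon4 m) i = Poly_Mapping.lookup (Rep_mon4 n) i" for i
  proof (cases "i < 4")
    case True
    then obtain k where "i = idx k" using idx_bij by (metis bij_betw_imp_surj_on imageE lessThan_iff)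
    then show ?thesis using e[of k] by (simp add: expo_def)
  next
    case False
    then have "i \<notin> Poly_Mapping.keys (Rep_mon4 m)" "i \<notin> Poly_Mapping.keys (Rep_mon4 n)"
      using Rep_mon4[of m] Rep_mon4[of n] by (auto simp: quartic_monomials_def)
    then show ?thesis by (simp add: in_keys_iff)
  qed
  then show ?thesis by (metis poly_mapping_eqI Rep_mon4_inject)
qed

text \<open>
  Exponents are at most \<open>4\<close>, so the Kronecker substitution \<open>x\<^sub>k = t\<close> to the power \<open>5\<close> to the power \<open>k - 1\<close>
  separates the quartic monomials.
\<close>

definition kron :: "mon4 \<Rightarrow> nat" where
  "kron m = expo m 1 + 5 * (expo m 2 + 5 * (expo m 3 + 5 * expo m 4))"

lemma kron_inj: "kron m = kron n \<Longrightarrow> m = n"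
proof -
  have digit: "a = a' \<and> b = b'" if "a \<le> 4" "a' \<le> 4" "a + 5 * b = a' + 5 * b'" for a a' b b' :: nat
    using that by presburger
  assume "kron m = kron n"
  then have "expo m 1 = expo n 1" "expo m 2 = expo n 2" "expo m 3 = expo n 3" "expo m 4 = expo n 4"
    unfolding kron_def using digit expo_bound by metis+
  then have "\<forall>k. expo m k = expo n k" by (simp add: forall_4)
  then show ?thesis by (simp add: expo_eqI)
qed

lemma evq_cvec_eq_0:
  assumes "\<And>x. evq f (cvec x) = 0"
  shows "f = 0"
proof -
  define p where "p = (\<Sum>m\<in>UNIV. monom (f $ m) (kron m))"
  have "poly p t = 0" for t
  proof -
    define x :: "real^4" where "x = (\<chi> k. if k = 1 then t else if k = 2 then t ^ 5 else if k = 3 then t ^ 25 else t ^ 125)"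
    have "(\<Prod>k\<in>UNIV. x $ k ^ expo m k) = t ^ kron m" for m
      unfolding UNIV_4 kron_def by (simp add: x_def power_add power_mult[symmetric] mult.commute distrib_left)
    moreover have "evq f (cvec x) = of_real (\<Sum>m\<in>UNIV. f $ m * (\<Prod>k\<in>UNIV. x $ k ^ expo m k))"
      by (simp add: evq_def cvec_def)
    ultimately have "of_real (poly p t) = evq f (cvec x)"
      by (simp add: p_def poly_sum poly_monom)
    then show ?thesis using assms[of x] by simp
  qed
  then have "p = 0" using poly_all_0_iff_0 by blast
  then have "coeff p (kron m) = 0" for m by simp
  moreover have "coeff p (kron m) = f $ m" for m
  proof -
    have "coeff p (kron m) = (\<Sum>n\<in>UNIV. if n = m then f $ n else 0)"
      unfolding p_def coeff_sum by (intro sum.cong refl) (auto dest: kron_inj)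
    then show ?thesis by simp
  qed
  ultimately show ?thesis by (simp add: vec_eq_iff)
qed

text \<open>Evaluations at real points span the dual space, since a form vanishing at all real
  points is zero. A functional in this shape acts on arbitrary functions, as the duality requires
  when it is applied in one of two variables.\<close>

lemma functional_by_evaluations:
  fixes w :: "real^mon4"
  obtains K :: "(real^mon4) set" and c xs where
    "\<And>g. w \<bullet> g = (\<Sum>k\<in>K. c k * Re (evq g (cvec (xs k))))"
proof -
  define e where "e x = (\<chi> m. \<Prod>k\<in>UNIV. x $ k ^ expo m k)" for x :: "real^4"
  have ev: "evq g (cvec x) = of_real (e x \<bullet> g)" for g x
    by (simp add: evq_def e_def inner_vec_def cvec_def mult.commute)
  have "span (range e) = UNIV"
  proof (rule ccontr)
    assume "span (range e) \<noteq> UNIV"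
    then have "dim (range e) < DIM(real^mon4)"
      using dim_eq_full[of "range e"] dim_subset_UNIV[of "range e"] by linarith
    then have "\<exists>b. b \<noteq> 0 \<and> (\<forall>y\<in>span (range e). orthogonal b y)"
      by (rule orthogonal_to_subspace_exists) (intro exI conjI ballI)
    then obtain b where b: "b \<noteq> 0" "\<And>x. e x \<bullet> b = 0"
      using span_base by (metis orthogonal_def inner_commute rangeI)
    then show False using evq_cvec_eq_0[of b] ev by simp
  qed
  then have "w \<in> span (range e)" by simp
  then obtain K u where K: "finite K" "K \<subseteq> range e" "w = (\<Sum>v\<in>K. u v *\<^sub>R v)"
    unfolding span_explicit by blast
  then have "\<forall>v\<in>K. \<exists>x. v = e x" by blast
  then obtain xs where xs: "\<And>v. v \<in> K \<Longrightarrow> v = e (xs v)" by metis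
  have "w \<bullet> g = (\<Sum>k\<in>K. u k * Re (evq g (cvec (xs k))))" for g
  proof -
    have "w \<bullet> g = (\<Sum>v\<in>K. u v * (v \<bullet> g))" unfolding K(3) by (simp add: inner_sum_left)
    also have "\<dots> = (\<Sum>k\<in>K. u k * Re (evq g (cvec (xs k))))"
      using xs by (intro sum.cong refl) (simp add: ev)
    finally show ?thesis .
  qed
  then show ?thesis using that by blast
qed

section \<open>Closest points of the cone\<close>

lemma first_order_condition:
  fixes w a b :: "'a::real_inner"
  assumes "\<And>s. norm w \<le> norm (w + s *\<^sub>R a + s\<^sup>2 *\<^sub>R b)"
  shows "w \<bullet> a = 0"
proof -
  define f where "f s = (norm (w + s *\<^sub>R a + s\<^sup>2 *\<^sub>R b))\<^sup>2" for s
  have "f s = w \<bullet> w + s * (2 * (w \<bullet> a)) + s\<^sup>2 * (a \<bullet> a + 2 * (w \<bullet> b)) + s ^ 3 * (2 * (a \<bullet> b)) + s ^ 4 * (b \<bullet> b)" for s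
    unfolding f_def power2_norm_eq_inner
    by (simp add: inner_simps inner_commute power2_eq_square power3_eq_cube power4_eq_xxxx algebra_simps)
  then have "f = (\<lambda>s. w \<bullet> w + s * (2 * (w \<bullet> a)) + s\<^sup>2 * (a \<bullet> a + 2 * (w \<bullet> b)) + s ^ 3 * (2 * (a \<bullet> b)) + s ^ 4 * (b \<bullet> b))" ..
  then have d: "(f has_real_derivative 2 * (w \<bullet> a)) (at 0)"
    by (auto intro!: derivative_eq_intros)
  have m: "\<forall>y. \<bar>0 - y\<bar> < 1 \<longrightarrow> f 0 \<le> f y"
    using assms by (simp add: f_def power_mono)
  show ?thesis using DERIV_local_min[OF d zero_less_one m] by simp
qed

text \<open>Only a half line is tested, so the result is an inequality. It is applied to
  \<open>b = G^2\<close>, which occurs with coefficient proportional to \<open>s^2\<close> in a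
  perturbation without linear term.\<close>

lemma second_order_condition:
  fixes w b :: "'a::real_inner"
  assumes "\<And>t. t \<ge> 0 \<Longrightarrow> norm w \<le> norm (w + t *\<^sub>R b)"
  shows "w \<bullet> b \<ge> 0"
proof (rule ccontr)
  assume "\<not> w \<bullet> b \<ge> 0"
  then have neg: "w \<bullet> b < 0" by simp
  then have "b \<noteq> 0" by auto
  then have bb: "b \<bullet> b > 0" by simp
  \<comment> \<open>The vertex of the parabola \<open>|w + t b|^2\<close>.\<close>
  define t where "t = - (w \<bullet> b) / (b \<bullet> b)"
  have t: "t > 0" unfolding t_def using neg bb by (intro divide_pos_pos) auto
  have "(norm w)\<^sup>2 \<le> (norm (w + t *\<^sub>R b))\<^sup>2" using assms[of t] t by (simp add: power_mono)
  also have "\<dots> = (norm w)\<^sup>2 + t * (2 * (w \<bullet> b) + t * (b \<bullet> b))"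
    unfolding power2_norm_eq_inner by (simp add: inner_simps inner_commute algebra_simps)
  also have "2 * (w \<bullet> b) + t * (b \<bullet> b) = w \<bullet> b" using bb by (simp add: t_def)
  finally have "0 \<le> t * (w \<bullet> b)" by simp
  then show False using t neg by (simp add: zero_le_mult_iff)
qed

lemma interior_sos_add: "f \<in> interior sos \<Longrightarrow> g \<in> sos \<Longrightarrow> f + g \<in> interior sos"
proof -
  assume f: "f \<in> interior sos" and g: "g \<in> sos"
  have "open ((+) g ` interior sos)" by (intro open_translation open_interior)
  moreover have "(+) g ` interior sos \<subseteq> sos" using interior_subset sos_add g by blast
  moreover have "f + g \<in> (+) g ` interior sos" using f by (simp add: add.commute)
  ultimately show ?thesis using interior_maximal by blast
qed

text \<open>A small multiple of \<open>x_k^4\<close> can be subtracted without leaving the sums of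
  squares, so the value at \<open>x\<close> is at least that positive amount.\<close>

lemma interior_sos_positive:
  assumes "f \<in> interior sos" "x \<noteq> 0"
  shows "evq f (cvec x) \<noteq> 0"
proof -
  obtain k where k: "x $ k \<noteq> 0" using assms(2) by (auto simp: vec_eq_iff)
  obtain d where d: "d > 0" "ball f d \<subseteq> sos" using assms(1) mem_interior by blast
  define h where "h = axis (bm k k k k) (1::real)"
  have "f - (d / 2) *\<^sub>R h \<in> ball f d" using d(1) by (simp add: dist_norm h_def)
  then have "f - (d / 2) *\<^sub>R h \<in> sos" using d(2) by blast
  then obtain r where r: "r \<ge> 0" "evq (f - (d / 2) *\<^sub>R h) (cvec x) = of_real r" using sos_nonneg by blast
  have "evq h (cvec x) = of_real ((x $ k) ^ 4)"
    unfolding h_def evq_axis monomial_bm by (simp add: cvec_def power4_eq_xxxx)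
  then have "evq f (cvec x) = of_real (r + d / 2 * (x $ k) ^ 4)"
    using r(2) evq_add[of "f - (d / 2) *\<^sub>R h" "(d / 2) *\<^sub>R h" "cvec x"] by (simp add: evq_scaleR)
  moreover have "r + d / 2 * (x $ k) ^ 4 > 0"
    using r(1) d(1) k by (intro add_nonneg_pos mult_pos_pos) (auto simp: zero_less_power_eq)
  ultimately show ?thesis by (metis of_real_eq_0_iff less_irrefl)
qed

lemma closed_singular: "closed {f. \<exists>z. z \<in> sphere 0 1 \<and> gradq f z = 0}"
  unfolding closed_sequential_limits
proof (intro allI impI, elim conjE)
  fix x l assume x: "\<forall>n. x n \<in> {f. \<exists>z. z \<in> sphere 0 1 \<and> gradq f z = 0}" and l: "x \<longlonglongrightarrow> l"
  then obtain z where z: "\<And>n. z n \<in> sphere 0 1" "\<And>n. gradq (x n) (z n) = 0"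
    by simp metis
  obtain q s where q: "q \<in> sphere 0 1" "strict_mono s" "(z \<circ> s) \<longlonglongrightarrow> q"
    using z(1) compact_sphere[of "0::complex^4" 1] unfolding compact_def by meson
  have "(\<lambda>n. ((x \<circ> s) n, (z \<circ> s) n)) \<longlonglongrightarrow> (l, q)"
    using LIMSEQ_subseq_LIMSEQ[OF l q(2)] q(3) by (rule tendsto_Pair)
  then have "(\<lambda>n. gradq (fst ((x \<circ> s) n, (z \<circ> s) n)) (snd ((x \<circ> s) n, (z \<circ> s) n))) \<longlonglongrightarrow> gradq (fst (l, q)) (snd (l, q))"
    by (rule continuous_on_tendsto_compose[OF continuous_gradq2]) auto
  then have "gradq l q = 0" using z(2) by (simp add: LIMSEQ_const_iff)
  then show "l \<in> {f. \<exists>z. z \<in> sphere 0 1 \<and> gradq f z = 0}" using q(1) by blast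
qed

text \<open>
  The functional \<open>w\<close> kills all products \<open>p\<^sub>i G\<close> by minimality. If \<open>\<Sum> a\<^sub>i p\<^sub>i = 0\<close> nontrivially, then
  replacing \<open>p\<^sub>i\<close> by \<open>p\<^sub>i + s a\<^sub>i G\<close> adds a multiple of \<open>G\<^sup>2\<close>, so \<open>w\<close> is nonnegative on sums of squares and
  vanishes at an interior point. If the \<open>p\<^sub>i\<close> are independent, they have a common complex zero, at
  which the sum of their squares is singular.
\<close>

lemma singularity_at_closest_point:
  assumes f: "gramsum p \<in> interior sos" and sym: "\<And>i. transpose (p $ i) = p $ i"
    and closest: "\<And>k. k \<in> five_squares \<Longrightarrow> norm w \<le> norm (w + (k - gramsum p))"
    and w: "w \<noteq> 0"
  shows "\<exists>z. z \<noteq> 0 \<and> gradq (gramsum p) z = 0"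
proof -
  have kill: "w \<bullet> mulq (p $ i) G = 0" for i G
  proof -
    have eq: "gramsum (p + s *\<^sub>R axis i G) - gramsum p = s *\<^sub>R (2 *\<^sub>R mulq (p $ i) G) + s\<^sup>2 *\<^sub>R mulq G G" for s
    proof -
      have "gramsum (p + s *\<^sub>R axis i G) - gramsum p = (\<Sum>j\<in>UNIV. if j = i then s *\<^sub>R (2 *\<^sub>R mulq (p $ i) G) + s\<^sup>2 *\<^sub>R mulq G G else 0)"
        unfolding gramsum_def sum_subtractf[symmetric]
        by (intro sum.cong refl) (auto simp: axis_def mulq_bilinear mulq.zero_left mulq.zero_right mulq_commute[of G "p $ i"] scaleR_2 power2_eq_square scaleR_add_right)
      then show ?thesis by simp
    qed
    have "w \<bullet> (2 *\<^sub>R mulq (p $ i) G) = 0"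
    proof (rule first_order_condition)
      fix s
      have "gramsum (p + s *\<^sub>R axis i G) \<in> five_squares" by (simp add: five_squares_def)
      from closest[OF this] show "norm w \<le> norm (w + s *\<^sub>R (2 *\<^sub>R mulq (p $ i) G) + s\<^sup>2 *\<^sub>R mulq G G)"
        unfolding eq by (simp add: add.assoc)
    qed
    then show ?thesis by simp
  qed
  have indep: "\<forall>i. a i = 0" if dep: "(\<Sum>i\<in>UNIV. a i *\<^sub>R p $ i) = 0" for a
  proof (rule ccontr)
    assume "\<not> (\<forall>i. a i = 0)"
    then obtain i0 where i0: "a i0 \<noteq> 0" by blast
    define A where "A = (\<Sum>i\<in>UNIV. (a i)\<^sup>2)"
    have A: "A > 0" unfolding A_def
      by (rule sum_pos2[of _ i0]) (use i0 in auto)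
    have eq: "gramsum (\<chi> i. p $ i + (s * a i) *\<^sub>R G) = gramsum p + (s\<^sup>2 * A) *\<^sub>R mulq G G" for s G
    proof -
      have "gramsum (\<chi> i. p $ i + (s * a i) *\<^sub>R G) = (\<Sum>i\<in>UNIV. mulq (p $ i) (p $ i) + (2 * s) *\<^sub>R mulq (a i *\<^sub>R p $ i) G + (s\<^sup>2 * (a i)\<^sup>2) *\<^sub>R mulq G G)"
        unfolding gramsum_def
      proof (intro sum.cong refl)
        fix i :: "4 option"
        have tw: "(2 * s) *\<^sub>R mulq (a i *\<^sub>R p $ i) G = (s * a i) *\<^sub>R mulq (p $ i) G + (s * a i) *\<^sub>R mulq (p $ i) G"
          by (simp add: mulq_bilinear flip: scaleR_add_left)
        show "mulq ((\<chi> i. p $ i + (s * a i) *\<^sub>R G) $ i) ((\<chi> i. p $ i + (s * a i) *\<^sub>R G) $ i)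
          = mulq (p $ i) (p $ i) + (2 * s) *\<^sub>R mulq (a i *\<^sub>R p $ i) G + (s\<^sup>2 * (a i)\<^sup>2) *\<^sub>R mulq G G"
          unfolding tw by (simp add: mulq_bilinear mulq_commute[of G "p $ i"] power2_eq_square mult_ac scaleR_add_right)
      qed
      also have "\<dots> = gramsum p + (2 * s) *\<^sub>R mulq (\<Sum>i\<in>UNIV. a i *\<^sub>R p $ i) G + (s\<^sup>2 * A) *\<^sub>R mulq G G"
        unfolding sum.distrib gramsum_def A_def mulq.sum_left by (simp add: scaleR_sum_right scaleR_sum_left sum_distrib_left)
      finally show ?thesis unfolding dep by (simp add: mulq.zero_left)
    qed
    have pos: "w \<bullet> mulq G G \<ge> 0" for G
    proof (rule second_order_condition)
      fix t :: real assume t: "t \<ge> 0"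
      have "gramsum (\<chi> i. p $ i + (sqrt (t / A) * a i) *\<^sub>R G) \<in> five_squares" by (simp add: five_squares_def)
      from closest[OF this] show "norm w \<le> norm (w + t *\<^sub>R mulq G G)"
        unfolding eq using t A by simp
    qed
    have sospos: "w \<bullet> f \<ge> 0" if fs: "f \<in> sos" for f
    proof -
      obtain n :: nat and q where "f = (\<Sum>i<n. mulq (q i) (q i))" using fs by (auto simp: sos_def)
      then show ?thesis by (simp add: inner_sum_right sum_nonneg pos)
    qed
    have w0: "w \<bullet> gramsum p = 0" unfolding gramsum_def by (simp add: inner_sum_right kill)
    obtain d where d: "d > 0" "ball (gramsum p) d \<subseteq> sos" using f mem_interior by blast
    \<comment> \<open>Moving by \<open>- e w\<close> stays inside the ball of sums of squares, yet
      lowers the value of the functional from 0 to \<open>- e |w|^2\<close>.\<close>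
    define e where "e = d / (2 * norm w)"
    have e: "e > 0" using d(1) w by (simp add: e_def)
    have "gramsum p - e *\<^sub>R w \<in> ball (gramsum p) d" using d(1) w by (simp add: dist_norm e_def)
    then have "w \<bullet> (gramsum p - e *\<^sub>R w) \<ge> 0" using d(2) sospos by blast
    then have "e * (w \<bullet> w) \<le> 0" by (simp add: inner_diff_right w0)
    moreover have "w \<bullet> w > 0" using w by simp
    ultimately show False using e by (simp add: mult_le_0_iff)
  qed
  obtain K :: "(real^mon4) set" and c xs where L: "\<And>g. w \<bullet> g = (\<Sum>k\<in>K. c k * Re (evq g (cvec (xs k))))"
    by (rule functional_by_evaluations[of w]) (rule that)
  have ev: "Re (evq (mulq P G) (cvec x)) = qform P x * qform G x" for P G x
    by (simp add: evq_mulq qform_cmat_cvec)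
  have "\<exists>m. w $ m \<noteq> 0" using w by (simp add: vec_eq_iff)
  then obtain i j k l where "w $ bm i j k l \<noteq> 0" using bm_cases by metis
  \<comment> \<open>Every quartic monomial is a product of two quadrics, so a nonzero functional is
    nonzero on some such product.\<close>
  then have nz: "w \<bullet> mulq (symm (elem i j)) (symm (elem k l)) \<noteq> 0"
    unfolding mulq_symm mulq_elem by (simp add: inner_axis)
  have "\<exists>z. z \<noteq> 0 \<and> (\<forall>i. qform (cmat (p $ i)) z = 0)"
  proof (rule five_quadrics_common_zero[where P = "\<lambda>i. p $ i" and c = c and xs = xs and K = K])
    show "(\<Sum>k\<in>K. c k * (qform (p $ i) (xs k) * qform G (xs k))) = 0" for i G
      using kill[of i G] unfolding L ev .
    show "(\<Sum>a\<in>K. c a * (qform (symm (elem i j)) (xs a) * qform (symm (elem k l)) (xs a))) \<noteq> 0"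
      using nz unfolding L ev .
  qed (use sym indep in auto)
  then obtain z where z: "z \<noteq> 0" "\<And>i. qform (cmat (p $ i)) z = 0" by blast
  have "gradq (mulq (p $ i) (p $ i)) z = 0" for i
  proof -
    have "gradq (mulq (p $ i) (p $ i)) z $ a = 0" for a
    proof -
      have "(\<Sum>k\<in>UNIV. gradq (mulq (p $ i) (p $ i)) z $ k * axis a 1 $ k) = (\<Sum>k\<in>UNIV. if k = a then gradq (mulq (p $ i) (p $ i)) z $ k else 0)"
        by (intro sum.cong) (auto simp: axis_def)
      then show ?thesis using gradq_mulq[of "p $ i" "p $ i" z "axis a 1"] z(2) by simp
    qed
    then show ?thesis by (simp add: vec_eq_iff)
  qed
  then have "gradq (gramsum p) z = 0"
    unfolding gramsum_def using linear_sum[OF linear_gradq, of "\<lambda>i. mulq (p $ i) (p $ i)" UNIV z] by simp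
  then show ?thesis using z(1) by blast
qed

theorem sos_subset_five_squares: "sos \<subseteq> five_squares"
proof (rule ccontr)
  assume "\<not> sos \<subseteq> five_squares"
  then obtain g where g: "g \<in> sos" "g \<notin> five_squares" by blast
  define h where "h = gramsum base_tuple"
  have hK: "h \<in> interior five_squares" unfolding h_def by (rule interior_five_squares)
  have hsos: "h \<in> interior sos" using hK five_squares_sos interior_mono by blast
  have hsos': "h \<in> sos" using hsos interior_subset by blast
  have smult: "t *\<^sub>R h \<in> interior sos" if t: "t > 0" for t
  proof -
    have "open ((*\<^sub>R) t ` interior sos)" using t by (intro open_scaling open_interior) auto
    moreover have "(*\<^sub>R) t ` interior sos \<subseteq> sos"
    proof
      fix y assume "y \<in> (*\<^sub>R) t ` interior sos"
      then obtain v where "v \<in> interior sos" "y = t *\<^sub>R v" by blast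
      then show "y \<in> sos" using sos_scaleR[of v t] interior_subset[of sos] t by auto
    qed
    ultimately show ?thesis using interior_maximal hsos by blast
  qed
  define W where "W = interior sos - five_squares"
  have openW: "open W" unfolding W_def by (intro open_Diff open_interior closed_five_squares)
  \<comment> \<open>The form \<open>g\<close> may lie on the boundary of the sums of squares. A
    small multiple of \<open>h\<close> moves it into the interior without reaching the closed set
    \<open>five_squares\<close>.\<close>
  have "W \<noteq> {}"
  proof -
    have "open (- five_squares)" using closed_five_squares by (simp add: open_Compl)
    then obtain e where e: "e > 0" "ball g e \<subseteq> - five_squares" using g(2) open_contains_ball by (metis ComplI)
    define N where "N = norm h + 1"
    have n1: "N > 0" by (simp add: N_def add_nonneg_pos)
    define s where "s = e / (2 * N)"
    have s: "s > 0" using e(1) n1 by (simp add: s_def)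
    have "s * norm h < e"
    proof -
      have "s * norm h \<le> s * N" using s by (simp add: N_def)
      also have "\<dots> = e / 2" using n1 by (simp add: s_def)
      finally show ?thesis using e(1) by simp
    qed
    then have "s *\<^sub>R h + g \<in> ball g e" using s by (simp add: dist_norm)
    then have "s *\<^sub>R h + g \<notin> five_squares" using e(2) by blast
    moreover have "s *\<^sub>R h + g \<in> interior sos" using interior_sos_add[OF smult[OF s] g(1)] .
    ultimately show ?thesis unfolding W_def by blast
  qed
  then obtain c where c: "c \<in> W" "\<And>z t. nonreal z \<Longrightarrow> gradq (c + t *\<^sub>R h) z \<noteq> 0"
    using generic_no_nonreal_singularity[OF openW, of h] by blast
  have cW: "c \<in> interior sos" "c \<notin> five_squares" using c(1) by (auto simp: W_def)
  define T where "T = {t. t \<ge> 0 \<and> c + t *\<^sub>R h \<in> five_squares}"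
  have "closed T"
  proof -
    have "T = {0..} \<inter> (\<lambda>t. c + t *\<^sub>R h) -` five_squares" by (auto simp: T_def)
    moreover have "closed ((\<lambda>t. c + t *\<^sub>R h) -` five_squares)"
      by (intro continuous_closed_vimage closed_five_squares) (auto intro!: continuous_intros)
    ultimately show ?thesis by (simp add: closed_Int)
  qed
  \<comment> \<open>For large \<open>t\<close> the form \<open>h + c / t\<close> lies in the ball
    around \<open>h\<close>, and \<open>five_squares\<close> is a cone.\<close>
  have "T \<noteq> {}"
  proof -
    obtain e where e: "e > 0" "ball h e \<subseteq> five_squares" using hK mem_interior by blast
    define t where "t = 2 * (norm c + 1) / e"
    have n1: "norm c + 1 > 0" by (simp add: add_nonneg_pos)
    have t: "t > 0" using e(1) n1 by (simp add: t_def)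
    have "norm ((1 / t) *\<^sub>R c) < e"
    proof -
      have "norm c < t * e" using e(1) by (simp add: t_def) (smt (verit) norm_ge_zero)
      then show ?thesis using t by (simp add: pos_divide_less_eq mult.commute)
    qed
    then have "h + (1 / t) *\<^sub>R c \<in> five_squares" using e(2) by (auto simp: dist_norm)
    then have "t *\<^sub>R (h + (1 / t) *\<^sub>R c) \<in> five_squares" using t by (intro five_squares_scaleR) auto
    moreover have "t *\<^sub>R (h + (1 / t) *\<^sub>R c) = c + t *\<^sub>R h" using t by (simp add: scaleR_add_right add.commute)
    ultimately show ?thesis using t unfolding T_def by (metis (mono_tags, lifting) empty_iff less_imp_le mem_Collect_eq)
  qed
  have bdd: "bdd_below T" by (rule bdd_belowI[of _ 0]) (auto simp: T_def)
  define t0 where "t0 = Inf T"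
  have t0T: "t0 \<in> T" unfolding t0_def by (rule closed_contains_Inf[OF \<open>T \<noteq> {}\<close> bdd \<open>closed T\<close>])
  have t0: "t0 \<ge> 0" "c + t0 *\<^sub>R h \<in> five_squares" using t0T by (auto simp: T_def)
  have "t0 \<noteq> 0" using t0(2) cW(2) by auto
  then have t0pos: "t0 > 0" using t0(1) by simp
  have below: "c + t *\<^sub>R h \<notin> five_squares" if "0 \<le> t" "t < t0" for t
    using that cInf_lower[OF _ bdd, of t] unfolding t0_def T_def by force
  define f where "f = c + t0 *\<^sub>R h"
  have fint: "f \<in> interior sos" unfolding f_def
    by (intro interior_sos_add cW(1) sos_scaleR hsos' t0(1))
  define Sg where "Sg = {f. \<exists>z. z \<in> sphere 0 1 \<and> gradq f z = 0}"
  \<comment> \<open>A nonreal singular point is excluded by the choice of \<open>c\<close>. At a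
    real one \<open>f\<close> would vanish by Euler's identity, against positivity in the
    interior.\<close>
  have fSg: "f \<notin> Sg"
  proof
    assume "f \<in> Sg"
    then obtain z where z: "norm z = 1" "gradq f z = 0" by (auto simp: Sg_def)
    then have "\<not> nonreal z" using c(2) unfolding f_def by blast
    then obtain a x where ax: "z = a *s cvec x" by (auto simp: nonreal_def)
    have "a \<noteq> 0" using ax z(1) by auto
    moreover have "x \<noteq> 0" 
    proof
      assume "x = 0"
      then have "cvec x = 0" by (simp add: cvec_def vec_eq_iff)
      then show False using ax z(1) by simp
    qed
    moreover have "gradq f ((1 / a) *s z) = 0" using \<open>a \<noteq> 0\<close> z(2) by (intro gradq_smult_eq_0) auto
    ultimately have "gradq f (cvec x) = 0" by (simp add: ax)
    then have "evq f (cvec x) = 0" by (rule euler_zero)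
    then show False using interior_sos_positive[OF fint \<open>x \<noteq> 0\<close>] by simp
  qed
  have "open (interior sos - Sg)" unfolding Sg_def by (intro open_Diff open_interior closed_singular)
  moreover have "f \<in> interior sos - Sg" using fint fSg by blast
  ultimately obtain r where r: "r > 0" "ball f r \<subseteq> interior sos - Sg" using open_contains_ball by metis
  define N where "N = norm h + 1"
  have n1: "N > 0" by (simp add: N_def add_nonneg_pos)
  \<comment> \<open>The point \<open>c'\<close> lies just before the entry point, closer than
    \<open>r / 2\<close> to \<open>f\<close>; hence its closest point in the cone is within
    \<open>r\<close> of \<open>f\<close>. The bound by \<open>t0\<close> keeps the parameter
    nonnegative.\<close>
  define del where "del = min t0 (r / (2 * N))"
  have del: "del > 0" "del \<le> t0" using t0pos r(1) n1 by (auto simp: del_def)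
  define c' where "c' = c + (t0 - del) *\<^sub>R h"
  have c'K: "c' \<notin> five_squares" unfolding c'_def using del by (intro below) auto
  have c'f: "dist c' f < r / 2"
  proof -
    have "dist c' f = del * norm h" 
    proof -
      have "c' - f = - (del *\<^sub>R h)" by (simp add: c'_def f_def scaleR_diff_left)
      then show ?thesis using del(1) by (simp add: dist_norm)
    qed
    also have "\<dots> < del * N" using del(1) by (simp add: N_def)
    also have "\<dots> \<le> r / (2 * N) * N" using n1 by (intro mult_right_mono) (auto simp: del_def)
    also have "\<dots> = r / 2" using n1 by simp
    finally show ?thesis .
  qed
  obtain f' where f': "f' \<in> five_squares" "\<And>k. k \<in> five_squares \<Longrightarrow> dist c' f' \<le> dist c' k"
    using distance_attains_inf[OF closed_five_squares, of c'] t0(2) by blast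
  have "dist c' f' \<le> dist c' f" using f'(2) t0(2) unfolding f_def by blast
  then have "dist f f' < r" using c'f dist_triangle2[of f f' c'] by (simp add: dist_commute)
  then have f'ball: "f' \<in> interior sos" "f' \<notin> Sg" using r(2) by auto
  obtain p where p: "f' = gramsum p" "\<And>i. transpose (p $ i) = p $ i"
    using five_squares_symmetric[OF f'(1)] by blast
  have "\<exists>z. z \<noteq> 0 \<and> gradq (gramsum p) z = 0"
  proof (rule singularity_at_closest_point[where w = "f' - c'"])
    show "norm (f' - c') \<le> norm (f' - c' + (k - gramsum p))" if "k \<in> five_squares" for k
      using f'(2)[OF that] by (simp add: dist_norm norm_minus_commute flip: p(1))
    show "f' - c' \<noteq> 0" using f'(1) c'K by auto
  qed (use f'ball p in auto)
  then obtain z where z: "z \<noteq> 0" "gradq f' z = 0" by (auto simp: p(1))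
  have "gradq f' (of_real (1 / norm z) *s z) = 0" using z by (intro gradq_smult_eq_0) auto
  moreover have "norm (of_real (1 / norm z) *s z) = 1" using z(1) unfolding norm_smult_complex by (simp add: norm_divide)
  ultimately have "f' \<in> Sg" unfolding Sg_def by auto
  then show False using f'ball by blast
qed

section \<open>From polynomials to coefficient vectors\<close>

definition coeffs4 :: "rpoly \<Rightarrow> real^mon4" where
  "coeffs4 f = (\<chi> m. Poly_Mapping.lookup f (Rep_mon4 m))"

definition quadric :: "real^4^4 \<Rightarrow> rpoly" where
  "quadric P = (\<Sum>i\<in>UNIV. \<Sum>j\<in>UNIV. Poly_Mapping.single (Poly_Mapping.single (idx i) 1 + Poly_Mapping.single (idx j) 1) (P $ i $ j))"

lemma coeffs4_add: "coeffs4 (f + g) = coeffs4 f + coeffs4 g"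
  by (simp add: coeffs4_def vec_eq_iff lookup_add)

lemma coeffs4_sum: "coeffs4 (\<Sum>i\<in>I. f i) = (\<Sum>i\<in>I. coeffs4 (f i))"
  by (induction I rule: infinite_finite_induct) (simp_all add: coeffs4_add, simp_all add: coeffs4_def vec_eq_iff)

lemma coeffs4_single: "coeffs4 (Poly_Mapping.single (qmono i j k l) c) = c *\<^sub>R axis (bm i j k l) 1"
proof -
  have "qmono i j k l = Rep_mon4 m \<longleftrightarrow> m = bm i j k l" for m
    by (metis Rep_bm Rep_mon4_inject)
  then show ?thesis by (auto simp: coeffs4_def vec_eq_iff lookup_single when_def axis_def)
qed

lemma quadric_mult: "quadric P * quadric Q = (\<Sum>i\<in>UNIV. \<Sum>j\<in>UNIV. \<Sum>k\<in>UNIV. \<Sum>l\<in>UNIV. Poly_Mapping.single (qmono i j k l) (P $ i $ j * Q $ k $ l))"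
proof -
  have "quadric P * quadric Q = (\<Sum>i\<in>UNIV. \<Sum>j\<in>UNIV. Poly_Mapping.single (Poly_Mapping.single (idx i) 1 + Poly_Mapping.single (idx j) 1) (P $ i $ j) * quadric Q)"
    unfolding quadric_def[of P] sum_distrib_right ..
  also have "\<dots> = (\<Sum>i\<in>UNIV. \<Sum>j\<in>UNIV. \<Sum>k\<in>UNIV. \<Sum>l\<in>UNIV. Poly_Mapping.single (qmono i j k l) (P $ i $ j * Q $ k $ l))"
    unfolding quadric_def[of Q] sum_distrib_left mult_single qmono_def by (simp only: add.assoc)
  finally show ?thesis .
qed

lemma coeffs4_quadric_mult: "coeffs4 (quadric P * quadric Q) = mulq P Q"
  unfolding quadric_mult coeffs4_sum coeffs4_single mulq_def ..

lemma forms_4_iff: "f \<in> forms 4 4 \<longleftrightarrow> Poly_Mapping.keys f \<subseteq> quartic_monomials"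
  by (auto simp: forms_def quartic_monomials_def)

lemma forms_add: "f \<in> forms n e \<Longrightarrow> g \<in> forms n e \<Longrightarrow> f + g \<in> forms n e"
  using keys_add[of f g] unfolding forms_def by blast

lemma forms_zero: "0 \<in> forms n e"
  by (simp add: forms_def)

lemma forms_sum: "(\<And>i. i \<in> I \<Longrightarrow> f i \<in> forms n e) \<Longrightarrow> (\<Sum>i\<in>I. f i) \<in> forms n e"
  by (induction I rule: infinite_finite_induct) (auto intro: forms_add forms_zero)

lemma quadric_mult_forms: "quadric P * quadric Q \<in> forms 4 4"
proof -
  have "Poly_Mapping.single (qmono i j k l) c \<in> forms 4 4" for i j k l c
    unfolding forms_4_iff by (auto simp: quartic_monomials_eq)
  then show ?thesis unfolding quadric_mult by (intro forms_sum)
qed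

lemma quadric_forms: "quadric P \<in> forms 4 2"
proof -
  have lt: "idx i < 4" for i using idx_bij by (auto simp: bij_betw_def)
  have "Poly_Mapping.single (Poly_Mapping.single (idx i) 1 + Poly_Mapping.single (idx j) 1) (c::real) \<in> forms 4 2" for i j c
    using lt by (auto simp: forms_def lookup_add lookup_single when_def sum.distrib in_keys_iff split: if_splits)
  then show ?thesis unfolding quadric_def by (intro forms_sum)
qed

lemma quadric_add: "quadric (P + Q) = quadric P + quadric Q"
  by (simp add: quadric_def single_add sum.distrib)

lemma quadric_elem: "quadric (c *\<^sub>R elem i j) = Poly_Mapping.single (Poly_Mapping.single (idx i) 1 + Poly_Mapping.single (idx j) 1) c"
proof -
  have "quadric (c *\<^sub>R elem i j) = (\<Sum>a\<in>UNIV. \<Sum>b\<in>UNIV. if b = j then if a = i then Poly_Mapping.single (Poly_Mapping.single (idx i) 1 + Poly_Mapping.single (idx j) 1) c else 0 else 0)"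
    unfolding quadric_def by (intro sum.cong refl) (auto simp: elem_def axis_def)
  then show ?thesis by simp
qed

lemma forms_2_quadric:
  assumes "p \<in> forms 4 2"
  shows "\<exists>P. p = quadric P"
proof -
  have single: "\<exists>P. Poly_Mapping.single m (c::real) = quadric P" if m: "m \<in> Poly_Mapping.keys p" for m c
  proof -
    have k: "Poly_Mapping.keys m \<subseteq> {..<4}" "(\<Sum>i<4. Poly_Mapping.lookup m i) = Suc (Suc 0)"
      using m assms by (auto simp: forms_def)
    obtain i m1 where 1: "m = m1 + Poly_Mapping.single (idx i) 1" "Poly_Mapping.keys m1 \<subseteq> {..<4}" "(\<Sum>i<4. Poly_Mapping.lookup m1 i) = Suc 0"
      using degree_induct_step[OF k] by metis
    obtain j m2 where 2: "m1 = m2 + Poly_Mapping.single (idx j) 1" "Poly_Mapping.keys m2 \<subseteq> {..<4}" "(\<Sum>i<4. Poly_Mapping.lookup m2 i) = 0"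
      using degree_induct_step[OF 1(2,3)] by metis
    have "m2 = 0" using 2(2,3) by (intro poly_mapping_eqI) (auto simp: in_keys_iff subset_iff)
    then have "Poly_Mapping.single m c = quadric (c *\<^sub>R elem j i)" unfolding quadric_elem using 1 2 by simp
    then show ?thesis by blast
  qed
  have "\<exists>P. (\<Sum>m\<in>I. Poly_Mapping.single m (Poly_Mapping.lookup p m)) = quadric P" if "finite I" "I \<subseteq> Poly_Mapping.keys p" for I
    using that
  proof (induction I rule: finite_induct)
    case empty
    have "quadric 0 = 0" by (simp add: quadric_def)
    then show ?case by (metis sum.empty)
  next
    case (insert m I)
    then obtain P where P: "(\<Sum>m\<in>I. Poly_Mapping.single m (Poly_Mapping.lookup p m)) = quadric P" by auto
    obtain Q where "Poly_Mapping.single m (Poly_Mapping.lookup p m) = quadric Q" using single[of m] insert.prems by blast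
    then have "(\<Sum>m\<in>insert m I. Poly_Mapping.single m (Poly_Mapping.lookup p m)) = quadric (Q + P)"
      using insert.hyps P by (simp add: quadric_add)
    then show ?case by blast
  qed
  moreover have "p = (\<Sum>m\<in>Poly_Mapping.keys p. Poly_Mapping.single m (Poly_Mapping.lookup p m))"
    by (intro poly_mapping_eqI) (simp add: lookup_sum lookup_single when_def in_keys_iff)
  ultimately show ?thesis by (metis finite_keys order_refl)
qed

lemma coeffs4_inj:
  assumes "f \<in> forms 4 4" "g \<in> forms 4 4" "coeffs4 f = coeffs4 g"
  shows "f = g"
proof (rule poly_mapping_eqI)
  fix m
  show "Poly_Mapping.lookup f m = Poly_Mapping.lookup g m"
  proof (cases "m \<in> quartic_monomials")
    case True
    then have "Rep_mon4 (Abs_mon4 m) = m" by (rule Abs_mon4_inverse)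
    then show ?thesis using assms(3) unfolding coeffs4_def vec_eq_iff by (metis vec_lambda_beta)
  next
    case False
    then have "m \<notin> Poly_Mapping.keys f" "m \<notin> Poly_Mapping.keys g" using assms(1,2) unfolding forms_4_iff by blast+
    then show ?thesis by (simp add: in_keys_iff)
  qed
qed

lemma coeffs4_sum_of_squares: "coeffs4 (\<Sum>i\<in>I. (quadric (P i))\<^sup>2) = (\<Sum>i\<in>I. mulq (P i) (P i))"
  by (simp add: coeffs4_sum power2_eq_square coeffs4_quadric_mult)

lemma sum_of_squares_forms: "(\<Sum>i\<in>I. (quadric (P i))\<^sup>2) \<in> forms 4 4"
  unfolding power2_eq_square by (intro forms_sum quadric_mult_forms)

lemma is_sum_of_squares_quadric:
  assumes "is_sum_of_squares 4 2 r f"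
  obtains P where "f = (\<Sum>i<r. (quadric (P i))\<^sup>2)"
proof -
  obtain p where p: "\<forall>i<r. p i \<in> forms 4 2" "f = (\<Sum>i<r. (p i)\<^sup>2)"
    using assms by (auto simp: is_sum_of_squares_def)
  have "\<forall>i. \<exists>P. i < r \<longrightarrow> p i = quadric P" using p(1) forms_2_quadric by blast
  then obtain P where "\<And>i. i < r \<Longrightarrow> p i = quadric (P i)" by metis
  then have "f = (\<Sum>i<r. (quadric (P i))\<^sup>2)" unfolding p(2) by (intro sum.cong refl) simp
  then show ?thesis using that by blast
qed

theorem sum_of_five_squares:
  assumes "f \<in> sos_forms 4 2"
  shows "is_sum_of_squares 4 2 5 f"
proof -
  obtain r where "is_sum_of_squares 4 2 r f" using assms by (auto simp: sos_forms_def)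
  then obtain P where f: "f = (\<Sum>i<r. (quadric (P i))\<^sup>2)" by (rule is_sum_of_squares_quadric)
  have "coeffs4 f \<in> sos" unfolding f coeffs4_sum_of_squares sos_def by blast
  then have "coeffs4 f \<in> five_squares" using sos_subset_five_squares by blast
  then obtain q where q: "coeffs4 f = gramsum q" by (auto simp: five_squares_def)
  obtain b where b: "bij_betw b {..<5::nat} (UNIV :: 4 option set)"
    using ex_bij_betw_nat_finite[of "UNIV :: 4 option set"] by (auto simp: atLeast0LessThan)
  define g where "g = (\<Sum>i<5. (quadric (q $ b i))\<^sup>2)"
  have "coeffs4 g = (\<Sum>i<5. mulq (q $ b i) (q $ b i))" unfolding g_def by (rule coeffs4_sum_of_squares)
  also have "\<dots> = gramsum q" unfolding gramsum_def by (rule sum.reindex_bij_betw[OF b])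
  finally have "coeffs4 f = coeffs4 g" using q by simp
  moreover have "f \<in> forms 4 4" unfolding f by (rule sum_of_squares_forms)
  moreover have "g \<in> forms 4 4" unfolding g_def by (rule sum_of_squares_forms)
  ultimately have "f = g" by (intro coeffs4_inj)
  then show ?thesis unfolding is_sum_of_squares_def g_def
    by (intro exI[of _ "\<lambda>i. quadric (q $ b i)"]) (simp add: quadric_forms)
qed

section \<open>Lower bound: a form that is not a sum of four squares\<close>

definition vec4 :: "real \<Rightarrow> real \<Rightarrow> real \<Rightarrow> real \<Rightarrow> real^4" where
  "vec4 a b c d = (\<chi> k. if k = 1 then a else if k = 2 then b else if k = 3 then c else d)"

lemma qform_vec4:
  assumes "transpose P = P"
  shows "qform P (vec4 a b c d) = P$1$1 * a^2 + P$2$2 * b^2 + P$3$3 * c^2 + P$4$4 * d^2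
    + 2 * P$1$2 * a * b + 2 * P$1$3 * a * c + 2 * P$1$4 * a * d + 2 * P$2$3 * b * c + 2 * P$2$4 * b * d + 2 * P$3$4 * c * d"
proof -
  have "P$j$i = P$i$j" for i j using arg_cong[OF assms, of "\<lambda>A. A $ i $ j"] by (simp add: transpose_def)
  from this[of 1 2] this[of 1 3] this[of 1 4] this[of 2 3] this[of 2 4] this[of 3 4]
  show ?thesis unfolding qform_def bform_sum_def sum_4 vec4_def
    by (simp add: power2_eq_square algebra_simps)
qed

text \<open>
  The fifteen products of the five monomials below are distinct, and the vanishing coefficients force
  every quadric in a representation as a sum of squares into their span. Hence the Gram matrix of
  the form is unique, and it has rank five.
\<close>

definition long_form_matrix :: "nat \<Rightarrow> real^4^4" where
  "long_form_matrix i = (if i = 0 then elem 1 3 else if i = 1 then elem 2 3 else if i = 2 then elem 4 4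
     else if i = 3 then elem 1 2 else elem 3 4)"

definition long_form :: rpoly where
  "long_form = (\<Sum>i<5. (quadric (long_form_matrix i))\<^sup>2)"

lemma qform_elem: "qform (elem i j) x = x $ i * x $ j"
proof -
  have "qform (elem i j) x = (\<Sum>a\<in>UNIV. \<Sum>b\<in>UNIV. if b = j then if a = i then x $ a * x $ b else 0 else 0)"
    unfolding qform_def bform_sum_def by (intro sum.cong refl) (auto simp: elem_def axis_def)
  then show ?thesis by simp
qed

text \<open>Five orthonormal vectors do not fit into four dimensions. Entry \<open>i\<close> of
  \<open>v a\<close> will be the coefficient of monomial \<open>a\<close> in the \<open>i\<close>-th
  of four squares.\<close>

lemma orthonormal_bound:
  fixes v :: "nat \<Rightarrow> nat \<Rightarrow> real"
  assumes orth: "\<And>a b. a < 5 \<Longrightarrow> b < 5 \<Longrightarrow> (\<Sum>i<4. v a i * v b i) = (if a = b then 1 else 0)"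
  shows False
proof -
  define w :: "nat \<Rightarrow> real^4" where "w a = (\<chi> k. v a (idx k))" for a
  have w: "w a \<bullet> w b = (if a = b then 1 else 0)" if "a < 5" "b < 5" for a b
    using orth[OF that] sum.reindex_bij_betw[OF idx_bij, of "\<lambda>i. v a i * v b i"]
    by (simp add: w_def inner_vec_def)
  have inj: "inj_on w {..<5}"
  proof (rule inj_onI)
    fix a b assume "a \<in> {..<5::nat}" "b \<in> {..<5::nat}" "w a = w b"
    then show "a = b" using w[of a b] w[of b b] by (auto split: if_splits)
  qed
  have "pairwise orthogonal (w ` {..<5})"
    using w by (auto simp: pairwise_def orthogonal_def)
  moreover have "0 \<notin> w ` {..<5}"
  proof
    assume "0 \<in> w ` {..<5}"
    then obtain a where "a < 5" "w a = 0" by auto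
    then show False using w[of a a] by simp
  qed
  ultimately have "independent (w ` {..<5})" by (rule pairwise_orthogonal_independent)
  then have "card (w ` {..<5}) \<le> DIM(real^4)" using independent_bound by blast
  then show False using card_image[OF inj] by simp
qed

lemma long_form_not_four_squares: "\<not> is_sum_of_squares 4 2 4 long_form"
proof
  assume "is_sum_of_squares 4 2 4 long_form"
  then obtain P0 where P0: "long_form = (\<Sum>i<(4::nat). (quadric (P0 i))\<^sup>2)" by (rule is_sum_of_squares_quadric)
  define P where "P i = symm (P0 i)" for i
  have "(\<Sum>i<5. mulq (long_form_matrix i) (long_form_matrix i)) = (\<Sum>i<4. mulq (P i) (P i))"
    using arg_cong[OF P0, of coeffs4] unfolding long_form_def coeffs4_sum_of_squares P_def mulq_symm .
  then have "evq (\<Sum>i<5. mulq (long_form_matrix i) (long_form_matrix i)) (cvec x) = evq (\<Sum>i<4. mulq (P i) (P i)) (cvec x)" for x by simp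
  then have "complex_of_real (\<Sum>i<5. (qform (long_form_matrix i) x)\<^sup>2) = of_real (\<Sum>i<4. (qform (P i) x)\<^sup>2)" for x
    unfolding evq_sum evq_square_real of_real_sum .
  then have eq: "(\<Sum>i<5. (qform (long_form_matrix i) x)\<^sup>2) = (\<Sum>i<4. (qform (P i) x)\<^sup>2)" for x
    by (simp only: of_real_eq_iff)
  have s5: "(\<Sum>i<5. f i) = f 0 + f 1 + f 2 + f 3 + f (4::nat)" for f :: "nat \<Rightarrow> real"
    by (simp add: eval_nat_numeral)
  have key: "(\<Sum>i<4. (P i$1$1 * a^2 + P i$2$2 * b^2 + P i$3$3 * c^2 + P i$4$4 * d^2
    + 2 * P i$1$2 * a * b + 2 * P i$1$3 * a * c + 2 * P i$1$4 * a * d + 2 * P i$2$3 * b * c + 2 * P i$2$4 * b * d + 2 * P i$3$4 * c * d)\<^sup>2)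
    = (a * c)^2 + (b * c)^2 + (d * d)^2 + (a * b)^2 + (c * d)^2" for a b c d
    using eq[of "vec4 a b c d"] unfolding s5
    by (simp add: qform_vec4 P_def long_form_matrix_def qform_elem) (simp add: vec4_def)
  have sq0: "\<forall>i<4. f i = 0" if "(\<Sum>i<4. (f i)\<^sup>2) = 0" for f :: "nat \<Rightarrow> real"
    using that by (simp add: sum_nonneg_eq_0_iff)
  have p11: "\<forall>i<4. P i $ 1 $ 1 = 0" using key[of 1 0 0 0] by (intro sq0) simp
  have p22: "\<forall>i<4. P i $ 2 $ 2 = 0" using key[of 0 1 0 0] by (intro sq0) simp
  have p33: "\<forall>i<4. P i $ 3 $ 3 = 0" using key[of 0 0 1 0] by (intro sq0) simp
  \<comment> \<open>Adding the values at two points that differ in one sign isolates a coefficient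
    such as that of \<open>x1^2 x4^2\<close>. Once the pure squares are gone, it is a sum of squares
    of mixed coefficients.\<close>
  have par: "(\<Sum>i<4. (f i + g i)\<^sup>2) + (\<Sum>i<4. (f i - g i)\<^sup>2) = 2 * (\<Sum>i<4. (f i)\<^sup>2) + 2 * (\<Sum>i<4. (g i)\<^sup>2)" for f g :: "nat \<Rightarrow> real"
    by (simp add: sum.distrib[symmetric] sum_distrib_left power2_eq_square algebra_simps)
  have p14: "\<forall>i<4. P i $ 1 $ 4 = 0"
  proof -
    have "(\<Sum>i<4. (2 * P i $ 1 $ 4)\<^sup>2) = 0"
      using key[of 1 0 0 1] key[of "-1" 0 0 1] key[of 0 0 0 1] p11
        par[of "\<lambda>i. P i $ 4 $ 4" "\<lambda>i. 2 * P i $ 1 $ 4"] by simp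
    from sq0[OF this] show ?thesis by simp
  qed
  have p24: "\<forall>i<4. P i $ 2 $ 4 = 0"
  proof -
    have "(\<Sum>i<4. (2 * P i $ 2 $ 4)\<^sup>2) = 0"
      using key[of 0 1 0 1] key[of 0 "-1" 0 1] key[of 0 0 0 1] p22
        par[of "\<lambda>i. P i $ 4 $ 4" "\<lambda>i. 2 * P i $ 2 $ 4"] by simp
    from sq0[OF this] show ?thesis by simp
  qed
  define A B C D E where "A i = 2 * P i $ 1 $ 3" and "B i = 2 * P i $ 2 $ 3" and "C i = P i $ 4 $ 4"
    and "D i = 2 * P i $ 1 $ 2" and "E i = 2 * P i $ 3 $ 4" for i
  \<comment> \<open>The entries of the Gram matrix. The identity \<open>main\<close> is to show that
    this matrix is the identity, through points at which few of the five monomials are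
    nonzero.\<close>
  define S where "S f g = (\<Sum>i<4. f i * g i)" for f g :: "nat \<Rightarrow> real"
  have expand: "(\<Sum>i<4. (A i * x1 + B i * x2 + C i * x3 + D i * x4 + E i * x5)\<^sup>2) =
     S A A * x1^2 + S B B * x2^2 + S C C * x3^2 + S D D * x4^2 + S E E * x5^2
     + 2 * (S A B * x1 * x2 + S A C * x1 * x3 + S A D * x1 * x4 + S A E * x1 * x5 + S B C * x2 * x3 + S B D * x2 * x4 + S B E * x2 * x5
     + S C D * x3 * x4 + S C E * x3 * x5 + S D E * x4 * x5)" for x1 x2 x3 x4 x5
    unfolding S_def sum_distrib_right sum_distrib_left sum.distrib[symmetric]
    by (intro sum.cong refl) (simp add: power2_eq_square algebra_simps)
  have main: "S A A * (a * c)^2 + S B B * (b * c)^2 + S C C * (d * d)^2 + S D D * (a * b)^2 + S E E * (c * d)^2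
     + 2 * (S A B * (a * c) * (b * c) + S A C * (a * c) * (d * d) + S A D * (a * c) * (a * b) + S A E * (a * c) * (c * d)
     + S B C * (b * c) * (d * d) + S B D * (b * c) * (a * b) + S B E * (b * c) * (c * d)
     + S C D * (d * d) * (a * b) + S C E * (d * d) * (c * d) + S D E * (a * b) * (c * d))
     = (a * c)^2 + (b * c)^2 + (d * d)^2 + (a * b)^2 + (c * d)^2" for a b c d
  proof -
    have "(\<Sum>i<4. (A i * (a * c) + B i * (b * c) + C i * (d * d) + D i * (a * b) + E i * (c * d))\<^sup>2)
      = (a * c)^2 + (b * c)^2 + (d * d)^2 + (a * b)^2 + (c * d)^2"
      unfolding key[symmetric] using p11 p22 p33 p14 p24
      by (intro sum.cong refl) (simp add: A_def B_def C_def D_def E_def power2_eq_square algebra_simps)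
    then show ?thesis unfolding expand .
  qed
  have diag: "S A A = 1" "S B B = 1" "S C C = 1" "S D D = 1"
    using main[of 1 0 1 0] main[of 0 1 1 0] main[of 0 0 0 1] main[of 1 1 0 0] by simp_all
  note main1 = main[unfolded diag]
  have ce: "S E E = 1" "S C E = 0"
    using main1[where a = 0 and b = 0 and c = 1 and d = 1, simplified]
      main1[where a = 0 and b = 0 and c = 1 and d = "-1", simplified] by linarith+
  note main2 = main1[unfolded ce]
  have ac: "S A C = 0" "S A E = 0"
    using main2[where a = 1 and b = 0 and c = 1 and d = 1, simplified]
      main2[where a = 1 and b = 0 and c = 1 and d = "-1", simplified] by linarith+
  have bc: "S B C = 0" "S B E = 0"
    using main2[where a = 0 and b = 1 and c = 1 and d = 1, simplified]
      main2[where a = 0 and b = 1 and c = 1 and d = "-1", simplified] by linarith+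
  have cd: "S C D = 0" using main2[where a = 1 and b = 1 and c = 0 and d = 1, simplified] by linarith
  \<comment> \<open>With \<open>d = 0\<close> three mixed monomials remain, so three points are
    needed; the coordinates 2 make the three equations independent.\<close>
  have ab: "S A B = 0" "S A D = 0" "S B D = 0"
    using main2[where a = 1 and b = 1 and c = 1 and d = 0, simplified]
      main2[where a = 2 and b = 1 and c = 1 and d = 0, simplified]
      main2[where a = 1 and b = 2 and c = 1 and d = 0, simplified] by linarith+
  have de: "S D E = 0"
    using main2[where a = 1 and b = 1 and c = 1 and d = 1, unfolded ac bc cd ab, simplified] by linarith
  define v where "v a = (if a = 0 then A else if a = 1 then B else if a = 2 then C else if a = 3 then D else E)" for a :: nat
  have comm: "S f g = S g f" for f g by (simp add: S_def mult.commute)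
  show False
  proof (rule orthonormal_bound[of v])
    fix a b :: nat assume "a < 5" "b < 5"
    then have "a \<in> {0, 1, 2, 3, 4}" "b \<in> {0, 1, 2, 3, 4}" by auto
    then have "S (v a) (v b) = (if a = b then 1 else 0)"
      using diag ce ac bc cd ab de comm by (auto simp: v_def)
    then show "(\<Sum>i<4. v a i * v b i) = (if a = b then 1 else 0)" by (simp add: S_def)
  qed
qed

text \<open>Pad with zero forms. A length below four is thereby reduced to exactly four
  squares.\<close>

lemma is_sum_of_squares_mono:
  assumes "is_sum_of_squares n d r f" "r \<le> s"
  shows "is_sum_of_squares n d s f"
proof -
  obtain p where p: "\<forall>i<r. p i \<in> forms n d" "f = (\<Sum>i<r. (p i)\<^sup>2)"
    using assms(1) by (auto simp: is_sum_of_squares_def)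
  define q where "q i = (if i < r then p i else 0)" for i
  have "(\<Sum>i<s. (q i)\<^sup>2) = (\<Sum>i<r. (q i)\<^sup>2)"
    by (rule sum.mono_neutral_right) (use assms(2) in \<open>auto simp: q_def\<close>)
  also have "\<dots> = f" unfolding p(2) by (intro sum.cong refl) (simp add: q_def)
  finally show ?thesis unfolding is_sum_of_squares_def
    using p(1) forms_zero by (intro exI[of _ q]) (auto simp: q_def)
qed

theorem theorem4p2:
  "pythagoras_number 4 2 = 5 \<and>
   (\<forall>f \<in> sos_forms 4 2.
      \<exists>p :: nat \<Rightarrow> rpoly. (\<forall>i<5. p i \<in> forms 4 2) \<and> f = (\<Sum>i<5. (p i)\<^sup>2))"
proof
  have "sos_length 4 2 f \<le> 5" if "f \<in> sos_forms 4 2" for f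
    unfolding sos_length_def using sum_of_five_squares[OF that] by (rule Least_le)
  then have upper: "enat (sos_length 4 2 f) \<le> 5" if "f \<in> sos_forms 4 2" for f
    using that by (simp add: numeral_eq_enat)
  have s5: "is_sum_of_squares 4 2 5 long_form"
    unfolding is_sum_of_squares_def long_form_def
    by (intro exI[of _ "\<lambda>i. quadric (long_form_matrix i)"]) (simp add: quadric_forms)
  then have lf: "long_form \<in> sos_forms 4 2"
    using sum_of_squares_forms[of long_form_matrix "{..<5}"] by (auto simp: sos_forms_def long_form_def)
  have "is_sum_of_squares 4 2 (sos_length 4 2 long_form) long_form"
    unfolding sos_length_def using s5 by (rule LeastI)
  then have "\<not> sos_length 4 2 long_form \<le> 4"
    using is_sum_of_squares_mono long_form_not_four_squares by blast
  then have "5 \<le> enat (sos_length 4 2 long_form)" by (simp add: numeral_eq_enat)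
  also have "\<dots> \<le> pythagoras_number 4 2"
    unfolding pythagoras_number_def using lf by (rule SUP_upper)
  finally show "pythagoras_number 4 2 = 5"
    unfolding pythagoras_number_def using upper by (intro antisym SUP_least) auto
  show "\<forall>f \<in> sos_forms 4 2.
      \<exists>p :: nat \<Rightarrow> rpoly. (\<forall>i<5. p i \<in> forms 4 2) \<and> f = (\<Sum>i<5. (p i)\<^sup>2)"
    using sum_of_five_squares by (auto simp: is_sum_of_squares_def)
qed

end
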